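(* Let $q=2$. Let $A=\begin{pmatrix}a_{11} & a_{12} \\ a_{21} & 0\end{pmatrix}$ with entries in $\mathbb{C}_\infty$, $\operatorname{ord}a_{11}=-1$, $a_{12}\neq0$, $a_{21}\neq0$, and put $u=\operatorname{ord}a_{12}$, $v=\operatorname{ord}a_{21}$. If $(u,v)\in D_{13}$ and $v\ge0$, then $h^1(M(A))=4$.
   Context: Let $q=2$ and $\theta$ a variable. $\mathbb{C}_\infty$ is the completion of an algebraic closure of the completion of $\mathbb{F}_q(\theta)$ at the valuation at infinity $\operatorname{ord}$, normalized by $\operatorname{ord}\theta=-1$ (and $\operatorname{ord}0=+\infty$). $\mathbb{C}_\infty[T,\tau]$ is the ring of non-commutative polynomials with relations $Ta=aT$, $T\tau=\tau T$, $\tau a=a^q\tau$ for $a\in\mathbb{C}_\infty$; $\mathbb{C}_\infty\{\tau\}$ is the subring generated over $\mathbb{C}_\infty$ by $\tau$. For a $2\times2$ matrix $A$ over $\mathbb{C}_\infty$, $M(A)$ is the left $\mathbb{C}_\infty[T,\tau]$-module (Anderson t-motive of dimension 2 and rank 4) which is free over $\mathbb{C}_\infty\{\tau\}$ with basis $e_1,e_2$, where multiplication by $T$ is given, for the column $e_*=(e_1,e_2)^t$, by $Te_*=\theta e_*+A\tau e_*+\tau^2e_*$. It is free of rank 4 over $\mathbb{C}_\infty[T]$. $\mathbb{C}_\infty\{T\}$ is the ring of power series $\sum_{i\ge0}a_iT^i$ with $a_i\in\mathbb{C}_\infty$, $a_i\to0$, on which $\tau$ acts by $\tau(\sum a_iT^i)=\sum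 a_i^qT^i$. On $M\otimes_{\mathbb{C}_\infty[T]}\mathbb{C}_\infty\{T\}$, $\tau$ acts by $\tau(m\otimes f)=\tau(m)\otimes\tau(f)$. $H^1(M)$ is the $\mathbb{F}_q[T]$-module of $\tau$-invariant elements of $M\otimes_{\mathbb{C}_\infty[T]}\mathbb{C}_\infty\{T\}$; it is free, and $h^1(M)$ is its rank over $\mathbb{F}_q[T]$. The domain $D_{13}$ is the set of $(u,v)$ with $\operatorname{ord}\frac{\theta^{q^2}}{a_{21}^{q^2}}<\operatorname{ord}\frac{\theta^q}{a_{21}}$ and $\operatorname{ord}\frac{\theta^{q^2}}{a_{21}^{q^2}}<\operatorname{ord}a_{12}^q$; for $q=2$ this is $-4v-4<-v-2$ and $-4v-4<2u$, i.e. $v>-\frac23$ and $v>-\frac12u-1$. *)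

theory Defs
  imports
    "HOL-Analysis.Analysis"
    "HOL-Computational_Algebra.Computational_Algebra"
    "HOL-Algebra.Algebraic_Closure_Type"
    "HOL-Algebra.Free_Abelian_Groups"
    "HOL-Library.Z2"
begin

hide_const (open) up_ring.monom up_ring.coeff Polynomials.degree

unbundle no fps_syntax

text \<open>Throughout \<open>q = 2\<close>; the field \<open>F\<^sub>2\<close> is the type \<^typ>\<open>bit\<close>.\<close>

section \<open>The field \<open>C\<^sub>\<infinity>\<close>\<close>

definition ord_tendsto :: "('a::field \<Rightarrow> ereal) \<Rightarrow> (nat \<Rightarrow> 'a) \<Rightarrow> 'a \<Rightarrow> bool" where
  "ord_tendsto ord s x \<longleftrightarrow> (\<lambda>n. ord (s n - x)) \<longlonglongrightarrow> \<infinity>"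

definition ord_Cauchy :: "('a::field \<Rightarrow> ereal) \<Rightarrow> (nat \<Rightarrow> 'a) \<Rightarrow> bool" where
  "ord_Cauchy ord s \<longleftrightarrow> (\<forall>r::real. \<exists>N. \<forall>m\<ge>N. \<forall>n\<ge>N. ord (s m - s n) > ereal r)"

definition ord_closure :: "('a::field \<Rightarrow> ereal) \<Rightarrow> 'a set \<Rightarrow> 'a set" where
  "ord_closure ord S = {x. \<exists>s. range s \<subseteq> S \<and> ord_tendsto ord s x}"

definition F2_theta :: "'a::field \<Rightarrow> 'a set" where
  "F2_theta \<theta> = {poly (map_poly of_bit f) \<theta> / poly (map_poly of_bit g) \<theta> | f g :: bit poly.
      poly (map_poly of_bit g) \<theta> \<noteq> 0}"

definition K_infinity :: "('a::field \<Rightarrow> ereal) \<Rightarrow> 'a \<Rightarrow> 'a set" where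
  "K_infinity ord \<theta> = ord_closure ord (F2_theta \<theta>)"

definition algebraic_over :: "'a::field set \<Rightarrow> 'a set" where
  "algebraic_over K = {x. \<exists>p. p \<noteq> 0 \<and> set (coeffs p) \<subseteq> K \<and> poly p x = 0}"

text \<open>
  The type \<open>'a\<close>, with \<open>ord\<close> and \<open>\<theta>\<close>, is the completion of an algebraic closure of the
  completion of \<open>F\<^sub>2(\<theta>)\<close> at the infinite place. In a complete field, the completion of a subfield
  is its closure, so \<open>K_infinity\<close> is the completion of \<open>F\<^sub>2(\<theta>)\<close>. These conditions determine
  \<open>('a, ord, \<theta>)\<close> up to isomorphism: the axioms of a valuation and \<open>ord \<theta> = -1\<close> force \<open>\<theta>\<close> to be
  transcendental over \<open>F\<^sub>2\<close> and \<open>ord\<close> to be minus the degree on \<open>F\<^sub>2(\<theta>)\<close>, and a valuation of a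
  complete field extends uniquely to its algebraic closure.
\<close>
locale C_infinity =
  fixes ord :: "'a::field \<Rightarrow> ereal" and \<theta> :: 'a
  assumes char_two: "CHAR('a) = 2"
    and ord_not_MInfty: "ord x \<noteq> -\<infinity>"
    and ord_eq_PInfty_iff: "ord x = \<infinity> \<longleftrightarrow> x = 0"
    and ord_mult: "ord (x * y) = ord x + ord y"
    and ord_add: "ord (x + y) \<ge> min (ord x) (ord y)"
    and ord_theta: "ord \<theta> = -1"
    and complete: "ord_Cauchy ord s \<Longrightarrow> \<exists>x. ord_tendsto ord s x"
    and alg_closed: "\<lbrakk>set (coeffs p) \<subseteq> algebraic_over (K_infinity ord \<theta>); degree p > 0\<rbrakk>
          \<Longrightarrow> \<exists>x \<in> algebraic_over (K_infinity ord \<theta>). poly p x = 0"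
    and dense: "ord_closure ord (algebraic_over (K_infinity ord \<theta>)) = UNIV"

section \<open>Modules over \<open>C\<^sub>\<infinity>[T, \<tau>]\<close>\<close>

text \<open>
  The relations say that \<open>T\<close> commutes with \<open>\<tau>\<close> and with scalars and that \<open>\<tau> a = a\<^sup>2 \<tau>\<close>, so a left
  module over \<open>C\<^sub>\<infinity>[T, \<tau>]\<close> is a module over \<open>C\<^sub>\<infinity>[T]\<close> with an additive operator \<open>tau\<close> that is
  semilinear for the map squaring the coefficients of a polynomial.
\<close>
record ('r, 'm) tau_module = "('r, 'm) module" +
  tau :: "'m \<Rightarrow> 'm"

locale tau_module =
  fixes M :: "('k::field poly, 'm) tau_module" (structure)
  assumes module: "module ring_of_type_algebra M"
    and tau_closed: "x \<in> carrier M \<Longrightarrow> tau M x \<in> carrier M"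
    and tau_add: "\<lbrakk>x \<in> carrier M; y \<in> carrier M\<rbrakk> \<Longrightarrow> tau M (x \<oplus> y) = tau M x \<oplus> tau M y"
    and tau_smult: "x \<in> carrier M \<Longrightarrow> tau M (p \<odot> x) = map_poly (\<lambda>a. a\<^sup>2) p \<odot> tau M x"

text \<open>
  The polynomial \<open>\<Sum>\<^sub>i a\<^sub>i X\<^sup>i\<close> stands for the element \<open>\<Sum>\<^sub>i a\<^sub>i \<tau>\<^sup>i\<close> of \<open>C\<^sub>\<infinity>{\<tau>}\<close>, and
  \<open>skew_times\<close> is the product of \<open>C\<^sub>\<infinity>{\<tau>}\<close>: \<open>(a \<tau>\<^sup>i)(b \<tau>\<^sup>j) = a b\<^bsup>2^i\<^esup> \<tau>\<^bsup>i+j\<^esup>\<close>.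
\<close>
definition skew_times :: "'a::field poly \<Rightarrow> 'a poly \<Rightarrow> 'a poly" where
  "skew_times p r =
    (\<Sum>i\<le>degree p. \<Sum>j\<le>degree r. monom (coeff p i * coeff r j ^ (2 ^ i)) (i + j))"

text \<open>
  The vector \<open>m\<close> stands for \<open>m\<^sub>1 e\<^sub>1 + m\<^sub>2 e\<^sub>2\<close> with \<open>m\<^sub>1, m\<^sub>2\<close> in \<open>C\<^sub>\<infinity>{\<tau>}\<close>. As \<open>T\<close> commutes with
  \<open>C\<^sub>\<infinity>{\<tau>}\<close>, we have \<open>T m = m\<^sub>1 (T e\<^sub>1) + m\<^sub>2 (T e\<^sub>2)\<close>, and \<open>motive_T_coeff \<theta> A $ j $ k\<close> is the
  coefficient of \<open>e\<^sub>k\<close> in \<open>T e\<^sub>j\<close>.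
\<close>
definition motive_T_coeff :: "'a::field \<Rightarrow> 'a^2^2 \<Rightarrow> 'a poly^2^2" where
  "motive_T_coeff \<theta> A = (\<chi> j k. (if j = k then [:\<theta>:] else 0) + monom (A $ j $ k) 1
      + (if j = k then monom 1 2 else 0))"

definition motive_T :: "'a::field \<Rightarrow> 'a^2^2 \<Rightarrow> 'a poly^2 \<Rightarrow> 'a poly^2" where
  "motive_T \<theta> A m = (\<chi> k. \<Sum>j\<in>UNIV. skew_times (m $ j) (motive_T_coeff \<theta> A $ j $ k))"

definition t_motive :: "'a::field \<Rightarrow> 'a^2^2 \<Rightarrow> ('a poly, 'a poly^2) tau_module" where
  "t_motive \<theta> A = \<lparr>carrier = UNIV, monoid.mult = undefined, one = undefined,
     ring.zero = 0, ring.add = (+),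
     smult = (\<lambda>p m. \<chi> k. \<Sum>i\<le>degree p. Polynomial.smult (coeff p i) ((motive_T \<theta> A ^^ i) m $ k)),
     tau = (\<lambda>m. \<chi> k. skew_times (monom 1 1) (m $ k))\<rparr>"

definition tate_algebra :: "('a::field \<Rightarrow> ereal) \<Rightarrow> ('a poly, 'a fps) tau_module" where
  "tate_algebra ord = \<lparr>carrier = {f. (\<lambda>i. ord (fps_nth f i)) \<longlonglongrightarrow> \<infinity>},
     monoid.mult = (*), one = 1, ring.zero = 0, ring.add = (+),
     smult = (\<lambda>p f. fps_of_poly p * f),
     tau = (\<lambda>f. Abs_fps (\<lambda>i. (fps_nth f i)\<^sup>2))\<rparr>"

lemma coeff_skew_times:
  "coeff (skew_times p r) n = (\<Sum>i\<le>n. coeff p i * coeff r (n - i) ^ (2 ^ i))"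
proof -
  have "coeff (skew_times p r) n = (\<Sum>i\<le>degree p. \<Sum>j\<le>degree r.
      if i + j = n then coeff p i * coeff r j ^ (2 ^ i) else 0)"
    by (simp add: skew_times_def coeff_sum)
  also have "\<dots> = (\<Sum>i\<le>degree p. if i \<le> n then coeff p i * coeff r (n - i) ^ (2 ^ i) else 0)"
  proof (rule sum.cong [OF refl])
    fix i
    have "(\<Sum>j\<le>degree r. if i + j = n then coeff p i * coeff r j ^ (2 ^ i) else 0)
        = (\<Sum>j\<le>degree r. if j = n - i then (if i \<le> n then coeff p i * coeff r j ^ (2 ^ i) else 0) else 0)"
      by (rule sum.cong) auto
    also have "\<dots> = (if i \<le> n then coeff p i * coeff r (n - i) ^ (2 ^ i) else 0)"
      by (auto simp: coeff_eq_0 power_0_left)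
    finally show "(\<Sum>j\<le>degree r. if i + j = n then coeff p i * coeff r j ^ (2 ^ i) else 0)
        = (if i \<le> n then coeff p i * coeff r (n - i) ^ (2 ^ i) else 0)" .
  qed
  also have "\<dots> = (\<Sum>i\<in>{..degree p} \<inter> {..n}. coeff p i * coeff r (n - i) ^ (2 ^ i))"
    by (subst sum.inter_restrict) auto
  also have "\<dots> = (\<Sum>i\<le>n. coeff p i * coeff r (n - i) ^ (2 ^ i))"
    by (rule sum.mono_neutral_left) (auto simp: coeff_eq_0)
  finally show ?thesis .
qed

lemma skew_times_add: "skew_times (p + p') r = skew_times p r + skew_times p' r"
  by (simp add: poly_eq_iff coeff_skew_times sum.distrib distrib_right)

lemma skew_times_smult: "skew_times (Polynomial.smult a p) r = Polynomial.smult a (skew_times p r)"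
  by (simp add: poly_eq_iff coeff_skew_times sum_distrib_left mult.assoc)

lemma skew_times_tau: "skew_times (monom 1 1) p = pCons 0 (map_poly (\<lambda>a. a\<^sup>2) p)"
proof (rule poly_eqI)
  fix n
  show "coeff (skew_times (monom 1 1) p) n = coeff (pCons 0 (map_poly (\<lambda>a. a\<^sup>2) p)) n"
  proof (cases n)
    case (Suc m)
    have "(\<Sum>i\<le>n. coeff (monom 1 1) i * coeff p (n - i) ^ (2 ^ i))
      = (\<Sum>i\<le>n. if i = 1 then (coeff p (n - 1))\<^sup>2 else 0)"
      by (rule sum.cong) auto
    thus ?thesis using Suc by (simp add: coeff_skew_times coeff_map_poly)
  qed (simp add: coeff_skew_times)
qed

definition "poly_tau p = skew_times (monom 1 1) p"

lemmas poly_tau_eq = skew_times_tau[folded poly_tau_def]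

lemma char_two_square_add: "CHAR('a::field) = 2 \<Longrightarrow> (x + y :: 'a)\<^sup>2 = x\<^sup>2 + y\<^sup>2"
  using of_nat_CHAR[where 'a='a] by (simp add: power2_sum)

lemma char_two_square_sum: "finite A \<Longrightarrow> CHAR('a::field) = 2 \<Longrightarrow> (sum f A :: 'a)\<^sup>2 = (\<Sum>x\<in>A. (f x)\<^sup>2)"
  by (induction A rule: finite_induct) (simp_all add: char_two_square_add)

lemma skew_times_poly_tau:
  fixes p :: "'a::field poly"
  assumes "CHAR('a) = 2"
  shows "skew_times (poly_tau p) r = poly_tau (skew_times p r)"
proof (rule poly_eqI)
  fix n
  show "coeff (skew_times (poly_tau p) r) n
      = coeff (poly_tau (skew_times p r)) n"
  proof (cases n)
    case 0 then show ?thesis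
      by (simp only: poly_tau_eq) (simp add: coeff_skew_times)
  next
    case (Suc m)
    have "(\<Sum>i\<le>n. coeff (pCons 0 (map_poly (\<lambda>a. a\<^sup>2) p)) i * coeff r (n - i) ^ (2 ^ i))
       = (\<Sum>i\<le>m. (coeff p i)\<^sup>2 * coeff r (m - i) ^ (2 ^ Suc i))"
      unfolding Suc by (subst sum.atMost_Suc_shift) (simp add: coeff_map_poly)
    also have "\<dots> = (\<Sum>i\<le>m. coeff p i * coeff r (m - i) ^ (2 ^ i))\<^sup>2"
      by (simp add: char_two_square_sum assms power_mult_distrib power_mult[symmetric] mult.commute)
    finally show ?thesis
      unfolding poly_tau_eq by (simp add: coeff_skew_times Suc coeff_map_poly del: sum.atMost_Suc)
  qed
qed

definition "vec_scale a (m::'a::field poly^2) = (\<chi> k. Polynomial.smult a (m $ k))"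

definition "vec_tau (m::'a::field poly^2) = (\<chi> k. poly_tau (m $ k))"

lemma smult_sum_right: "Polynomial.smult a (\<Sum>i\<in>S. f i) = (\<Sum>i\<in>S. Polynomial.smult a (f i))"
  by (induction S rule: infinite_finite_induct) (simp_all add: smult_add_right)

lemma motive_T_add: "motive_T \<theta> A (x + y) = motive_T \<theta> A x + motive_T \<theta> A y"
  by (simp add: motive_T_def vec_eq_iff skew_times_add sum.distrib)

lemma motive_T_0: "motive_T \<theta> A 0 = 0"
  using motive_T_add[of \<theta> A 0 0] by simp

lemma motive_T_scale: "motive_T \<theta> A (vec_scale a x) = vec_scale a (motive_T \<theta> A x)"
  by (simp add: motive_T_def vec_scale_def vec_eq_iff skew_times_smult smult_sum_right)

lemma poly_tau_add: "CHAR('a::field) = 2 \<Longrightarrow>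
  poly_tau (p + r) = poly_tau p + poly_tau (r :: 'a poly)"
  by (auto simp: poly_tau_eq poly_eq_iff coeff_pCons coeff_map_poly char_two_square_add split: nat.split)

lemma poly_tau_0: "poly_tau 0 = 0" by (simp add: poly_tau_eq)

lemma poly_tau_sum: "finite S \<Longrightarrow> CHAR('a::field) = 2 \<Longrightarrow> 
  poly_tau (\<Sum>i\<in>S. f i) = (\<Sum>i\<in>S. poly_tau (f i :: 'a poly))"
  by (induction S rule: finite_induct) (simp_all add: poly_tau_0 poly_tau_add)

lemma vec_tau_add: "CHAR('a::field) = 2 \<Longrightarrow> vec_tau (x + y) = vec_tau x + vec_tau (y :: 'a poly^2)"
  by (simp add: vec_tau_def vec_eq_iff poly_tau_add)

lemma vec_tau_scale: "vec_tau (vec_scale a x) = vec_scale (a\<^sup>2) (vec_tau x)"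
  by (auto simp: vec_tau_def vec_scale_def vec_eq_iff poly_tau_eq poly_eq_iff coeff_pCons coeff_map_poly power_mult_distrib split: nat.split)

lemma motive_T_tau: "CHAR('a::field) = 2 \<Longrightarrow> motive_T \<theta> A (vec_tau x) = vec_tau (motive_T \<theta> A (x :: 'a poly^2))"
  by (simp add: motive_T_def vec_tau_def vec_eq_iff poly_tau_sum skew_times_poly_tau)

lemma t_motive_smult_eq: "p \<odot>\<^bsub>t_motive \<theta> A\<^esub> m = (\<Sum>i\<le>degree p. vec_scale (coeff p i) ((motive_T \<theta> A ^^ i) m))"
  by (simp add: t_motive_def vec_scale_def vec_eq_iff)

lemma vec_scale_0: "vec_scale 0 m = 0" by (simp add: vec_scale_def vec_eq_iff)

lemma t_motive_smult_0: "0 \<odot>\<^bsub>t_motive \<theta> A\<^esub> m = 0" by (simp add: t_motive_smult_eq vec_scale_0)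

lemma vec_scale_add: "vec_scale a (m + n) = vec_scale a m + vec_scale a n" by (simp add: vec_scale_def vec_eq_iff smult_add_right)

lemma vec_scale_add_left: "vec_scale (a + b) m = vec_scale a m + vec_scale b m" by (simp add: vec_scale_def vec_eq_iff smult_add_left)

lemma vec_scale_scale: "vec_scale a (vec_scale b m) = vec_scale (a * b) m" by (simp add: vec_scale_def vec_eq_iff)

lemma vec_scale_1: "vec_scale 1 m = m" by (simp add: vec_scale_def vec_eq_iff)

lemma vec_scale_zero: "vec_scale a 0 = 0" by (simp add: vec_scale_def vec_eq_iff)

lemma motive_T_sum: "finite S \<Longrightarrow> motive_T \<theta> A (\<Sum>i\<in>S. f i) = (\<Sum>i\<in>S. motive_T \<theta> A (f i))"
  by (induction S rule: finite_induct) (simp_all add: motive_T_add motive_T_0)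

lemma t_motive_smult_pCons: "pCons a p \<odot>\<^bsub>t_motive \<theta> A\<^esub> m = vec_scale a m + motive_T \<theta> A (p \<odot>\<^bsub>t_motive \<theta> A\<^esub> m)"
proof (cases "p = 0")
  case False
  show ?thesis unfolding t_motive_smult_eq degree_pCons_eq[OF False]
    by (subst sum.atMost_Suc_shift) (simp add: motive_T_sum motive_T_scale)
qed (simp add: t_motive_smult_0 motive_T_0, simp add: t_motive_smult_eq)

lemma t_motive_carrier: "carrier (t_motive \<theta> A) = UNIV" by (simp add: t_motive_def)

lemma t_motive_add: "x \<oplus>\<^bsub>t_motive \<theta> A\<^esub> y = x + y" by (simp add: t_motive_def)

lemma t_motive_smult_add: "p \<odot>\<^bsub>t_motive \<theta> A\<^esub> (m + n) = p \<odot>\<^bsub>t_motive \<theta> A\<^esub> m + p \<odot>\<^bsub>t_motive \<theta> A\<^esub> n"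
  by (induction p) (simp_all add: t_motive_smult_0 t_motive_smult_pCons motive_T_add vec_scale_add)

lemma t_motive_smult_addl: "(p + r) \<odot>\<^bsub>t_motive \<theta> A\<^esub> m = p \<odot>\<^bsub>t_motive \<theta> A\<^esub> m + r \<odot>\<^bsub>t_motive \<theta> A\<^esub> m"
  by (induction p r rule: poly_induct2) (simp_all add: t_motive_smult_0 t_motive_smult_pCons motive_T_add vec_scale_add_left)

lemma t_motive_smult_smult: "Polynomial.smult a p \<odot>\<^bsub>t_motive \<theta> A\<^esub> m = vec_scale a (p \<odot>\<^bsub>t_motive \<theta> A\<^esub> m)"
  by (induction p) (simp_all add: t_motive_smult_0 t_motive_smult_pCons vec_scale_zero vec_scale_add vec_scale_scale motive_T_scale)

lemma t_motive_smult_mult: "(p * r) \<odot>\<^bsub>t_motive \<theta> A\<^esub> m = p \<odot>\<^bsub>t_motive \<theta> A\<^esub> (r \<odot>\<^bsub>t_motive \<theta> A\<^esub> m)"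
  by (induction p) (simp_all add: t_motive_smult_0 t_motive_smult_pCons t_motive_smult_addl t_motive_smult_smult vec_scale_0)

lemma t_motive_smult_1: "1 \<odot>\<^bsub>t_motive \<theta> A\<^esub> m = m"
  by (simp add: one_pCons t_motive_smult_pCons t_motive_smult_0 motive_T_0 vec_scale_1)

lemma t_motive_smult_tau: assumes "CHAR('a::field) = 2"
  shows "vec_tau (p \<odot>\<^bsub>t_motive \<theta> A\<^esub> (m :: 'a poly^2)) = map_poly (\<lambda>a. a\<^sup>2) p \<odot>\<^bsub>t_motive \<theta> A\<^esub> vec_tau m"
proof (induction p)
  case 0 then show ?case by (simp add: t_motive_smult_0) (simp add: vec_tau_def vec_eq_iff poly_tau_0)
qed (simp add: t_motive_smult_pCons map_poly_pCons vec_tau_add assms vec_tau_scale motive_T_tau[symmetric])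

lemma tau_module_t_motive:
  fixes A :: "'a::field^2^2"
  assumes c: "CHAR('a) = 2"
  shows "tau_module (t_motive \<theta> A)"
proof (rule tau_module.intro)
  show "module ring_of_type_algebra (t_motive \<theta> A)"
  proof (rule moduleI)
    show "cring (ring_of_type_algebra :: 'a poly ring)" by (rule cring_from_type_algebra)
    have "\<exists>y. y + x = 0" for x :: "'a poly^2"
      by (rule exI[of _ "- x"]) simp
    then show "abelian_group (t_motive \<theta> A)"
      by (intro abelian_groupI) (simp_all add: t_motive_def ac_simps)
  qed (simp_all add: ring_of_type_algebra_def t_motive_smult_add t_motive_smult_addl t_motive_smult_mult t_motive_smult_1 t_motive_add t_motive_carrier)
  have tt: "tau (t_motive \<theta> A) = vec_tau" by (simp add: t_motive_def vec_tau_def poly_tau_def fun_eq_iff)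
  fix x y p
  show "tau (t_motive \<theta> A) x \<in> carrier (t_motive \<theta> A)" by (simp add: t_motive_def)
  show "tau (t_motive \<theta> A) (x \<oplus>\<^bsub>t_motive \<theta> A\<^esub> y) = tau (t_motive \<theta> A) x \<oplus>\<^bsub>t_motive \<theta> A\<^esub> tau (t_motive \<theta> A) y"
    unfolding tt by (simp add: t_motive_def vec_tau_add c)
  show "tau (t_motive \<theta> A) (p \<odot>\<^bsub>t_motive \<theta> A\<^esub> x) = map_poly (\<lambda>a. a\<^sup>2) p \<odot>\<^bsub>t_motive \<theta> A\<^esub> tau (t_motive \<theta> A) x"
    unfolding tt by (rule t_motive_smult_tau[OF c])
qed

context C_infinity
begin

lemma ord_0: "ord 0 = \<infinity>"
  by (simp add: ord_eq_PInfty_iff)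

lemma tate_smult_closed:
  assumes "(\<lambda>i. ord (fps_nth f i)) \<longlonglongrightarrow> \<infinity>"
  shows "(\<lambda>i. ord (fps_nth (fps_const a * f) i)) \<longlonglongrightarrow> \<infinity>"
proof (cases "a = 0")
  case False
  then obtain r where r: "ord a = ereal r"
    using ord_not_MInfty[of a] ord_eq_PInfty_iff[of a] by (cases "ord a") auto
  have "(\<lambda>i. ereal r + ord (fps_nth f i)) \<longlonglongrightarrow> ereal r + \<infinity>"
    by (rule tendsto_add_ereal_general) (use assms in auto)
  then show ?thesis by (simp add: ord_mult r)
qed (simp add: ord_0)

lemma tate_add_closed:
  assumes "(\<lambda>i. ord (fps_nth f i)) \<longlonglongrightarrow> \<infinity>" "(\<lambda>i. ord (fps_nth g i)) \<longlonglongrightarrow> \<infinity>"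
  shows "(\<lambda>i. ord (fps_nth (f + g) i)) \<longlonglongrightarrow> \<infinity>"
proof -
  have "(\<lambda>i. min (ord (fps_nth f i)) (ord (fps_nth g i))) \<longlonglongrightarrow> min \<infinity> \<infinity>"
    by (intro tendsto_min assms)
  then have "(\<lambda>i. min (ord (fps_nth f i)) (ord (fps_nth g i))) \<longlonglongrightarrow> \<infinity>" by simp
  moreover have "\<forall>\<^sub>F i in sequentially.
      min (ord (fps_nth f i)) (ord (fps_nth g i)) \<le> ord (fps_nth (f + g) i)"
    by (rule always_eventually, rule allI, subst fps_add_nth, rule ord_add)
  moreover have "\<forall>\<^sub>F i in sequentially. ord (fps_nth (f + g) i) \<le> \<infinity>"
    by simp
  ultimately show ?thesis
    by (rule tendsto_sandwich [rotated 2, OF _ tendsto_const])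
qed

lemma tate_shift_closed:
  assumes "(\<lambda>i. ord (fps_nth f i)) \<longlonglongrightarrow> \<infinity>"
  shows "(\<lambda>i. ord (fps_nth (fps_X * f) i)) \<longlonglongrightarrow> \<infinity>"
  by (rule LIMSEQ_imp_Suc) (use assms in simp)

lemma tate_poly_closed:
  assumes "(\<lambda>i. ord (fps_nth f i)) \<longlonglongrightarrow> \<infinity>"
  shows "(\<lambda>i. ord (fps_nth (fps_of_poly p * f) i)) \<longlonglongrightarrow> \<infinity>"
proof (induction p)
  case (pCons a p)
  have "fps_of_poly (pCons a p) * f = fps_const a * f + fps_X * (fps_of_poly p * f)"
    by (simp add: fps_of_poly_pCons distrib_right mult.assoc)
  then show ?case
    by (simp only: tate_add_closed [OF tate_smult_closed[OF assms] tate_shift_closed[OF pCons.IH]])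
qed (simp add: ord_0)

lemma tate_square_closed:
  assumes "(\<lambda>i. ord (fps_nth f i)) \<longlonglongrightarrow> \<infinity>"
  shows "(\<lambda>i. ord ((fps_nth f i)\<^sup>2)) \<longlonglongrightarrow> \<infinity>"
proof -
  have "(\<lambda>i. ord (fps_nth f i) + ord (fps_nth f i)) \<longlonglongrightarrow> \<infinity> + \<infinity>"
    by (rule tendsto_add_ereal_general) (use assms in auto)
  then show ?thesis by (simp add: power2_eq_square ord_mult)
qed

lemma tau_module_tate_algebra: "tau_module (tate_algebra ord)"
proof (rule tau_module.intro)
  show "module ring_of_type_algebra (tate_algebra ord)"
  proof (rule moduleI)
    show "cring (ring_of_type_algebra :: 'a poly ring)" by (rule cring_from_type_algebra)
    have "\<exists>g. (\<lambda>i. ord (fps_nth g i)) \<longlonglongrightarrow> \<infinity> \<and> g + f = 0"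
      if "(\<lambda>i. ord (fps_nth f i)) \<longlonglongrightarrow> \<infinity>" for f
    proof (intro exI[of _ "- f"] conjI)
      have "fps_const (- 1) * f = - f" by (simp add: fps_eq_iff)
      then show "(\<lambda>i. ord (fps_nth (- f) i)) \<longlonglongrightarrow> \<infinity>"
        using tate_smult_closed[OF that, of "- 1"] by metis
    qed simp
    then show "abelian_group (tate_algebra ord)"
      by (intro abelian_groupI)
        (use tate_add_closed in \<open>simp_all add: tate_algebra_def ac_simps ord_0\<close>)
  qed (use tate_poly_closed in \<open>simp_all add: ring_of_type_algebra_def tate_algebra_def
      fps_of_poly_add fps_of_poly_mult distrib_left distrib_right mult.assoc\<close>)
next
  fix x y p
  show "x \<in> carrier (tate_algebra ord) \<Longrightarrow> tau (tate_algebra ord) x \<in> carrier (tate_algebra ord)"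
    using tate_square_closed by (simp add: tate_algebra_def)
  show "tau (tate_algebra ord) (x \<oplus>\<^bsub>tate_algebra ord\<^esub> y)
      = tau (tate_algebra ord) x \<oplus>\<^bsub>tate_algebra ord\<^esub> tau (tate_algebra ord) y"
    by (simp add: tate_algebra_def fps_eq_iff char_two_square_add char_two)
  show "tau (tate_algebra ord) (p \<odot>\<^bsub>tate_algebra ord\<^esub> x)
      = map_poly (\<lambda>a. a\<^sup>2) p \<odot>\<^bsub>tate_algebra ord\<^esub> tau (tate_algebra ord) x"
    by (simp add: tate_algebra_def fps_eq_iff fps_mult_nth char_two_square_sum char_two coeff_map_poly
        power_mult_distrib)
qed

end

section \<open>Tensor products\<close>

definition tensor_relations ::
  "('r, 'x) ring_scheme \<Rightarrow> ('r, 'm, 'y) module_scheme \<Rightarrow> ('r, 'n, 'z) module_scheme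
    \<Rightarrow> ('m \<times> 'n \<Rightarrow>\<^sub>0 int) set" where
  "tensor_relations R M N =
     {frag_of (x \<oplus>\<^bsub>M\<^esub> x', y) - frag_of (x, y) - frag_of (x', y) | x x' y.
        x \<in> carrier M \<and> x' \<in> carrier M \<and> y \<in> carrier N}
   \<union> {frag_of (x, y \<oplus>\<^bsub>N\<^esub> y') - frag_of (x, y) - frag_of (x, y') | x y y'.
        x \<in> carrier M \<and> y \<in> carrier N \<and> y' \<in> carrier N}
   \<union> {frag_of (r \<odot>\<^bsub>M\<^esub> x, y) - frag_of (x, r \<odot>\<^bsub>N\<^esub> y) | r x y.
        r \<in> carrier R \<and> x \<in> carrier M \<and> y \<in> carrier N}"

definition tensor_null ::
  "('r, 'x) ring_scheme \<Rightarrow> ('r, 'm, 'y) module_scheme \<Rightarrow> ('r, 'n, 'z) module_scheme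
    \<Rightarrow> ('m \<times> 'n \<Rightarrow>\<^sub>0 int) set" where
  "tensor_null R M N =
     generate (free_Abelian_group (carrier M \<times> carrier N)) (tensor_relations R M N)"

definition tensor_group ::
  "('r, 'x) ring_scheme \<Rightarrow> ('r, 'm, 'y) module_scheme \<Rightarrow> ('r, 'n, 'z) module_scheme
    \<Rightarrow> ('m \<times> 'n \<Rightarrow>\<^sub>0 int) set monoid" where
  "tensor_group R M N =
     free_Abelian_group (carrier M \<times> carrier N) Mod tensor_null R M N"

text \<open>
  The map that sends the class of \<open>\<Sum>\<^sub>i x\<^sub>i \<otimes> y\<^sub>i\<close> to the class of \<open>\<Sum>\<^sub>i \<phi> x\<^sub>i \<otimes> \<psi> y\<^sub>i\<close>; the union is over
  representatives, all of which give the same coset whenever the map is well defined.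
\<close>
definition tensor_map ::
  "('r, 'x) ring_scheme \<Rightarrow> ('r, 'm, 'y) module_scheme \<Rightarrow> ('r, 'n, 'z) module_scheme
    \<Rightarrow> ('m \<Rightarrow> 'm) \<Rightarrow> ('n \<Rightarrow> 'n) \<Rightarrow> ('m \<times> 'n \<Rightarrow>\<^sub>0 int) set \<Rightarrow> ('m \<times> 'n \<Rightarrow>\<^sub>0 int) set" where
  "tensor_map R M N \<phi> \<psi> K =
     (\<Union>c\<in>K. tensor_null R M N #>\<^bsub>free_Abelian_group (carrier M \<times> carrier N)\<^esub>
               frag_extend (\<lambda>(x, y). frag_of (\<phi> x, \<psi> y)) c)"

definition tensor_product ::
  "('r, 'x) ring_scheme \<Rightarrow> ('r, 'm) tau_module \<Rightarrow> ('r, 'n) tau_module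
    \<Rightarrow> ('r, ('m \<times> 'n \<Rightarrow>\<^sub>0 int) set) tau_module" where
  "tensor_product R M N = \<lparr>carrier = carrier (tensor_group R M N),
     monoid.mult = undefined, one = undefined,
     ring.zero = one (tensor_group R M N), ring.add = monoid.mult (tensor_group R M N),
     smult = (\<lambda>r. tensor_map R M N (\<lambda>x. r \<odot>\<^bsub>M\<^esub> x) (\<lambda>y. y)),
     tau = tensor_map R M N (tau M) (tau N)\<rparr>"

section \<open>\<open>H\<^sup>1\<close> and its rank\<close>

text \<open>The \<open>\<tau>\<close>-invariants of a module over \<open>C\<^sub>\<infinity>[T, \<tau>]\<close>, as a module over \<open>F\<^sub>2[T]\<close>.\<close>
definition tau_invariants :: "('a::field poly, 'm) tau_module \<Rightarrow> (bit poly, 'm) module" where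
  "tau_invariants M = \<lparr>carrier = {x \<in> carrier M. tau M x = x},
     monoid.mult = undefined, one = undefined, ring.zero = \<zero>\<^bsub>M\<^esub>, ring.add = add M,
     smult = (\<lambda>p x. map_poly of_bit p \<odot>\<^bsub>M\<^esub> x)\<rparr>"

definition H1 :: "('a::field \<Rightarrow> ereal) \<Rightarrow> ('a poly, 'm) tau_module
    \<Rightarrow> (bit poly, ('m \<times> 'a fps \<Rightarrow>\<^sub>0 int) set) module" where
  "H1 ord M = tau_invariants (tensor_product ring_of_type_algebra M (tate_algebra ord))"

definition module_basis ::
  "('r, 'x) ring_scheme \<Rightarrow> ('r, 'm, 'y) module_scheme \<Rightarrow> 'm set \<Rightarrow> bool" where
  "module_basis R M B \<longleftrightarrow> finite B \<and> B \<subseteq> carrier M \<and>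
     (\<forall>x\<in>carrier M. \<exists>!c. c \<in> B \<rightarrow>\<^sub>E carrier R \<and> x = (\<Oplus>\<^bsub>M\<^esub>b\<in>B. c b \<odot>\<^bsub>M\<^esub> b))"

text \<open>The rank of a free module of finite rank; otherwise the value is unspecified.\<close>
definition free_rank :: "('r, 'x) ring_scheme \<Rightarrow> ('r, 'm, 'y) module_scheme \<Rightarrow> nat" where
  "free_rank R M = (THE n. \<exists>B. module_basis R M B \<and> card B = n)"

definition h1 :: "('a::field \<Rightarrow> ereal) \<Rightarrow> ('a poly, 'm) tau_module \<Rightarrow> nat" where
  "h1 ord M = free_rank (ring_of_type_algebra :: bit poly ring) (H1 ord M)"

section \<open>The domain \<open>D\<^sub>1\<^sub>3\<close>\<close>

text \<open>
  The conditions are \<open>ord (\<theta>\<^sup>4 / a\<^sub>2\<^sub>1\<^sup>4) < ord (\<theta>\<^sup>2 / a\<^sub>2\<^sub>1)\<close> and \<open>ord (\<theta>\<^sup>4 / a\<^sub>2\<^sub>1\<^sup>4) < ord (a\<^sub>1\<^sub>2\<^sup>2)\<close>, where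
  \<open>u = ord a\<^sub>1\<^sub>2\<close> and \<open>v = ord a\<^sub>2\<^sub>1\<close>.
\<close>
definition D13 :: "(real \<times> real) set" where
  "D13 = {(u, v). - 4 * v - 4 < - v - 2 \<and> - 4 * v - 4 < 2 * u}"

end

theory Submission
  imports Defs
begin

hide_const (open) Polynomials.lead_coeff

text \<open>
  In the basis \<open>e\<^sub>1, e\<^sub>2, \<tau> e\<^sub>1, \<tau> e\<^sub>2\<close> of the motive over \<open>C\<^sub>\<infinity>[T]\<close>, a \<open>\<tau>\<close>-invariant is determined by
  its last two coordinates, a pair of power series whose \<open>n\<close>-th coefficients \<open>(y1, y2)\<close> solve an
  additive system with right-hand sides \<open>w1, w2\<close> the fourth powers of the previous coefficients.
  Eliminating \<open>y2\<close> gives an additive polynomial of degree 16 in \<open>y1\<close>, so the first coefficient of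
  an invariant lies in a group of order 16. In \<open>D\<^sub>1\<^sub>3\<close> the Newton polygon of this polynomial is
  controlled by its linear coefficient and by the coefficient of \<open>y1\<^sup>4\<close>, which has order \<open>- 4 - 3 v\<close>.
  If each coefficient is chosen as the root of largest order, then for \<open>v \<ge> 0\<close> the bound on its order
  first grows by 1 at each step, up to \<open>7/3 + v\<close>, and from then on quadruples. Hence each of the 16
  elements starts a sequence that tends to 0, that is, \<open>H\<^sup>1 / T H\<^sup>1\<close> has \<open>2\<^sup>4\<close> elements. An invariant
  with all coefficients near 0 vanishes, so the invariants are filtered by the position after which
  the coefficients stay near 0, and lifting a basis of \<open>H\<^sup>1 / T H\<^sup>1\<close> adapted to this filtration gives
  a basis of \<open>H\<^sup>1\<close> over \<open>F\<^sub>2[T]\<close>.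
\<close>

section \<open>\<open>C\<^sub>\<infinity>\<close> is algebraically closed\<close>

text \<open>Roots are postulated only for polynomials over the algebraic elements, which are merely
  dense, so algebraic closedness of the whole field comes first; square roots and the count of 16
  both rest on it. The count is exact because the eliminated polynomial has derivative 1 and square
  roots in characteristic 2 are unique. The change from slow to fast growth occurs at order 2/3 of
  \<open>y2\<close>, the order of the nonzero roots of \<open>\<theta>\<^sup>2 * y ^ 4 + y\<close>.
  Below it the coefficient of \<open>y1 ^ 4\<close> gives the useful bound, above it the linear
  coefficient. For the basis, lifting arbitrary residues and dividing by T repeatedly would only
  yield coefficients that are power series in T. Lifts adapted to the filtration make each division
  by T lower the level, so the process stops and the coefficients are polynomials. As
  \<open>free_rank\<close> is a definite description, the proof needs both a basis and the equality
  of the sizes of all bases; the latter follows from the number of residues.\<close>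

lemma poly_split_induct [case_names root nonzero const mult]:
  fixes p :: "'a::field poly"
  assumes root: "\<And>q :: 'a poly. \<lbrakk>0 < degree q; degree q \<le> degree p\<rbrakk> \<Longrightarrow> \<exists>x. poly q x = 0"
    and "p \<noteq> 0"
    and const: "\<And>c. c \<noteq> 0 \<Longrightarrow> P [:c:]"
    and mult: "\<And>a q. \<lbrakk>q \<noteq> 0; P q\<rbrakk> \<Longrightarrow> P ([:- a, 1:] * q)"
  shows "P p"
  using root \<open>p \<noteq> 0\<close>
proof (induction "degree p" arbitrary: p)
  case 0
  then obtain c where "p = [:c:]" by (metis degree_eq_zeroE)
  with 0 const show ?case by auto
next
  case (Suc n)
  then obtain a where "poly p a = 0" by (metis le_refl zero_less_Suc)
  then obtain q where q: "p = [:- a, 1:] * q" by (metis dvdE poly_eq_0_iff_dvd)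
  with Suc.prems have "q \<noteq> 0" by auto
  then have "degree p = Suc (degree q)" unfolding q by (subst degree_mult_eq) auto
  with Suc have "P q" using \<open>q \<noteq> 0\<close> by (metis le_SucI nat.inject)
  with mult \<open>q \<noteq> 0\<close> q show ?case by simp
qed

text \<open>Roots are required only up to the degree of \<open>p\<close>, so the lemma also applies
  inside the induction that proves algebraic closedness, where only smaller degrees are
  settled.\<close>

lemma monic_split:
  fixes p :: "'a::field poly"
  assumes "\<And>q :: 'a poly. \<lbrakk>0 < degree q; degree q \<le> degree p\<rbrakk> \<Longrightarrow> \<exists>x. poly q x = 0"
    and "lead_coeff p = 1"
  obtains xs where "p = (\<Prod>a\<leftarrow>xs. [:- a, 1:])"
proof -
  have "p \<noteq> 0" using assms(2) by auto
  have "\<exists>xs. p = Polynomial.smult (lead_coeff p) (\<Prod>a\<leftarrow>xs. [:- a, 1:])"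
  proof (induction p rule: poly_split_induct)
    case root
    then show ?case using assms(1) by blast
  next
    case nonzero
    then show ?case by fact
  next
    case (const c)
    show ?case by (rule exI[of _ "[]"]) simp
  next
    case (mult a q)
    then obtain xs where xs: "q = Polynomial.smult (lead_coeff q) (\<Prod>a\<leftarrow>xs. [:- a, 1:])" by blast
    have l: "lead_coeff ([:- a, 1:] * q) = lead_coeff q" by (subst lead_coeff_mult) simp
    have "[:- a, 1:] * q = Polynomial.smult (lead_coeff q) ([:- a, 1:] * (\<Prod>a\<leftarrow>xs. [:- a, 1:]))"
      by (subst xs) (rule mult_smult_right)
    also have "\<dots> = Polynomial.smult (lead_coeff q) (\<Prod>a\<leftarrow>a # xs. [:- a, 1:])" by simp
    finally show ?case unfolding l by (rule exI[of _ "a # xs"])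
  qed
  with assms(2) that show thesis by auto
qed

section \<open>Bounds on orders\<close>

context C_infinity
begin

text \<open>A real bound avoids arithmetic with infinite orders: 0 satisfies every bound, so
  estimates for sums and products can be stated without excluding 0.\<close>

definition ord_ge :: "'a \<Rightarrow> real \<Rightarrow> bool" where
  "ord_ge x r \<longleftrightarrow> ereal r \<le> ord x"

text \<open>Junk value: \<open>rord 0 = 0\<close>.\<close>
definition rord :: "'a \<Rightarrow> real" where
  "rord x = real_of_ereal (ord x)"

lemma ord_eq_rord: "x \<noteq> 0 \<Longrightarrow> ord x = ereal (rord x)"
  using ord_not_MInfty[of x] ord_eq_PInfty_iff[of x] unfolding rord_def by (cases "ord x") auto

lemma ord_ge_0 [simp]: "ord_ge 0 r"
  by (simp add: ord_ge_def ord_0)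

lemma ord_ge_iff: "x \<noteq> 0 \<Longrightarrow> ord_ge x r \<longleftrightarrow> r \<le> rord x"
  by (simp add: ord_ge_def ord_eq_rord)

lemma rord_mult: "\<lbrakk>x \<noteq> 0; y \<noteq> 0\<rbrakk> \<Longrightarrow> rord (x * y) = rord x + rord y"
  using ord_mult[of x y] by (simp add: ord_eq_rord)

lemma rord_1 [simp]: "rord 1 = 0"
  using rord_mult[of 1 1] by simp

lemma rord_power: "x \<noteq> 0 \<Longrightarrow> rord (x ^ n) = n * rord x"
  by (induction n) (simp_all add: rord_mult algebra_simps)

lemma rord_divide: "\<lbrakk>x \<noteq> 0; y \<noteq> 0\<rbrakk> \<Longrightarrow> rord (x / y) = rord x - rord y"
  using rord_mult[of "x / y" y] by simp

lemma ord_ge_mono: "\<lbrakk>ord_ge x r; s \<le> r\<rbrakk> \<Longrightarrow> ord_ge x s"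
  unfolding ord_ge_def by (meson ereal_less_eq(3) order_trans)

lemma ord_ge_add: "\<lbrakk>ord_ge x r; ord_ge y r\<rbrakk> \<Longrightarrow> ord_ge (x + y) r"
  unfolding ord_ge_def using ord_add[of x y] by (meson min.boundedI order_trans)

lemma ord_ge_mult: "\<lbrakk>ord_ge x r; ord_ge y s\<rbrakk> \<Longrightarrow> ord_ge (x * y) (r + s)"
  by (cases "x = 0"; cases "y = 0") (auto simp: ord_ge_iff rord_mult)

lemma ord_ge_power: "ord_ge x r \<Longrightarrow> ord_ge (x ^ n) (n * r)"
proof (induction n)
  case (Suc n)
  then show ?case using ord_ge_mult[of x r "x ^ n" "n * r"] by (simp add: algebra_simps)
qed (simp add: ord_ge_iff)

lemma add_self [simp]: "x + x = (0 :: 'a)"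
  using of_nat_CHAR[where 'a='a] by (metis char_two mult_2 mult_zero_left of_nat_numeral)

lemma uminus_eq [simp]: "- x = (x :: 'a)"
  by (metis add_self minus_unique)

lemma minus_eq: "x - y = x + (y :: 'a)"
  by (metis diff_conv_add_uminus uminus_eq)

lemma add_self_left [simp]: "x + (x + y) = (y :: 'a)"
  by (simp flip: add.assoc)

lemma ord_ge_diff: "\<lbrakk>ord_ge x r; ord_ge y r\<rbrakk> \<Longrightarrow> ord_ge (x - y) r"
  by (simp add: minus_eq ord_ge_add)

lemma ord_ge_sum: "(\<And>i. i \<in> A \<Longrightarrow> ord_ge (f i) r) \<Longrightarrow> ord_ge (sum f A) r"
  by (induction A rule: infinite_finite_induct) (auto intro: ord_ge_add)

lemma ord_ge_unbounded: "(\<And>n::nat. ord_ge x n) \<Longrightarrow> x = 0"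
  by (rule ccontr) (metis ord_ge_iff reals_Archimedean2 not_le)

lemma tendsto_infinity_iff:
  "(\<lambda>n. ord (f n)) \<longlonglongrightarrow> \<infinity> \<longleftrightarrow> (\<forall>r. \<exists>N. \<forall>n\<ge>N. ord_ge (f n) r)"
proof
  assume "(\<lambda>n. ord (f n)) \<longlonglongrightarrow> \<infinity>"
  then show "\<forall>r. \<exists>N. \<forall>n\<ge>N. ord_ge (f n) r"
    unfolding tendsto_PInfty eventually_sequentially ord_ge_def by (meson less_imp_le)
next
  assume R: "\<forall>r. \<exists>N. \<forall>n\<ge>N. ord_ge (f n) r"
  have "\<exists>N. \<forall>n\<ge>N. ereal r < ord (f n)" for r
  proof -
    obtain N where "\<forall>n\<ge>N. ord_ge (f n) (r + 1)" using R by blast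
    moreover have "ereal r < ereal (r + 1)" by simp
    ultimately show ?thesis unfolding ord_ge_def by (meson less_le_trans)
  qed
  then show "(\<lambda>n. ord (f n)) \<longlonglongrightarrow> \<infinity>"
    unfolding tendsto_PInfty eventually_sequentially by blast
qed

text \<open>By the ultrametric inequality a bound on consecutive differences bounds all later
  differences, which gives a Cauchy sequence; the same bound passes to the limit.\<close>

lemma limit_exists:
  assumes "\<And>k. ord_ge (s k - s (Suc k)) (real k)"
  obtains x where "\<And>k. ord_ge (x - s k) (real k)"
proof -
  have d: "ord_ge (s k - s (k + j)) (real k)" for k j
  proof (induction j)
    case (Suc j)
    have "ord_ge (s (k + j) - s (Suc (k + j))) (real k)"
      by (rule ord_ge_mono[OF assms]) simp
    from ord_ge_add[OF Suc this] show ?case by (simp add: minus_eq ac_simps)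
  qed simp
  have "ord_Cauchy ord s"
    unfolding ord_Cauchy_def
  proof
    fix r :: real
    obtain N :: nat where N: "r < N" using reals_Archimedean2 by blast
    have "ereal r < ord (s m - s n)" if "m \<ge> N" "n \<ge> N" for m n
    proof -
      have "ord_ge (s N - s m) N" "ord_ge (s N - s n) N"
        using d[of N "m - N"] d[of N "n - N"] that by simp_all
      then have "ord_ge ((s N - s n) - (s N - s m)) N" by (rule ord_ge_diff[rotated])
      then have "ereal N \<le> ord (s m - s n)" by (simp add: ord_ge_def minus_eq ac_simps)
      then show ?thesis using N by (meson ereal_less_eq(3) less_ereal.simps(1) less_le_trans)
    qed
    then show "\<exists>N. \<forall>m\<ge>N. \<forall>n\<ge>N. ereal r < ord (s m - s n)" by blast
  qed
  then obtain x where "ord_tendsto ord s x" using complete by blast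
  then have x: "\<exists>N. \<forall>n\<ge>N. ord_ge (s n - x) r" for r
    unfolding ord_tendsto_def tendsto_infinity_iff by blast
  have "ord_ge (x - s k) (real k)" for k
  proof -
    obtain N where N: "\<forall>n\<ge>N. ord_ge (s n - x) (real k)" using x by blast
    have "ord_ge (s (k + N) - x) (real k)" using N by simp
    from ord_ge_add[OF d[of k N] this] show ?thesis by (simp add: minus_eq ac_simps)
  qed
  with that show thesis by blast
qed

section \<open>Approximate roots and their limits\<close>

lemma one_in_algebraic: "1 \<in> algebraic_over (K_infinity ord \<theta>)"
proof -
  have "1 \<in> F2_theta \<theta>"
    unfolding F2_theta_def by (intro CollectI exI[of _ "1 :: bit poly"]) (simp add: map_poly_1)
  then have "1 \<in> K_infinity ord \<theta>"
    unfolding K_infinity_def ord_closure_def ord_tendsto_def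
    by (intro CollectI exI[of _ "\<lambda>_. 1"]) (auto simp: ord_0)
  then show ?thesis
    unfolding algebraic_over_def by (intro CollectI exI[of _ "[:1, 1:]"]) simp
qed

lemma approx_algebraic: "\<exists>y \<in> algebraic_over (K_infinity ord \<theta>). ord_ge (x - y) r"
proof -
  from dense obtain s where s: "range s \<subseteq> algebraic_over (K_infinity ord \<theta>)" "ord_tendsto ord s x"
    unfolding ord_closure_def by blast
  then obtain N where N: "\<forall>n\<ge>N. ord_ge (s n - x) r"
    unfolding ord_tendsto_def tendsto_infinity_iff by blast
  then have "ord_ge (x - s N) r" by (simp add: minus_eq add.commute)
  with s show ?thesis by blast
qed

text \<open>If the order of \<open>x\<close> were below \<open>B\<close>, the leading power of
  \<open>x\<close> would have smaller order than all other terms and could not cancel.\<close>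

lemma ord_ge_root:
  assumes "degree p > 0" "lead_coeff p = 1" "poly p x = 0" "B \<le> 0" "\<And>i. ord_ge (coeff p i) B"
  shows "ord_ge x B"
proof (rule ccontr)
  assume *: "\<not> ord_ge x B"
  then have x0: "x \<noteq> 0" by auto
  with * have x: "x \<noteq> 0" "rord x < B" using ord_ge_iff[of x B] by auto
  obtain n where n: "degree p = Suc n" using assms(1) gr0_implies_Suc by blast
  have "poly p x = (\<Sum>i\<le>n. coeff p i * x ^ i) + x ^ Suc n"
    using assms(2) by (simp add: poly_altdef n)
  with assms(3) have "x ^ Suc n = (\<Sum>i\<le>n. coeff p i * x ^ i)"
    by (metis add_eq_0_iff uminus_eq add.commute)
  moreover have "ord_ge (\<Sum>i\<le>n. coeff p i * x ^ i) (B + n * rord x)"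
  proof (rule ord_ge_sum)
    fix i assume "i \<in> {..n}"
    then have "real n * rord x \<le> real i * rord x"
      using x assms(4) by (intro mult_right_mono_neg) auto
    moreover have "ord_ge (coeff p i * x ^ i) (B + i * rord x)"
      by (intro ord_ge_mult ord_ge_power assms) (use x in \<open>simp add: ord_ge_iff\<close>)
    ultimately show "ord_ge (coeff p i * x ^ i) (B + n * rord x)"
      by (elim ord_ge_mono) simp
  qed
  ultimately have "B + n * rord x \<le> Suc n * rord x"
    using x by (metis ord_ge_iff power_not_zero rord_power)
  with x show False by (simp add: algebra_simps)
qed

lemma coeffs_bounded: obtains B where "B \<le> 0" "\<And>i. ord_ge (coeff p i) B"
proof -
  have "\<exists>B\<le>0. \<forall>i. ord_ge (coeff p i) B"
  proof (induction p)
    case 0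
    then show ?case by auto
  next
    case (pCons a p)
    then obtain B where B: "B \<le> 0" "\<forall>i. ord_ge (coeff p i) B" by blast
    have "ord_ge (coeff (pCons a p) i) (min B (rord a))" for i
      using B ord_ge_mono[of _ B "min B (rord a)"]
      by (cases "a = 0") (auto simp: coeff_pCons ord_ge_iff split: nat.split)
    then show ?case using B by (intro exI[of _ "min B (rord a)"]) auto
  qed
  with that show thesis by blast
qed

lemma poly_bounded:
  fixes B C :: real
  assumes "B \<le> 0" "\<And>i. ord_ge (coeff p i) C" "ord_ge x B"
  shows "ord_ge (poly p x) (C + degree p * B)"
  unfolding poly_altdef
proof (rule ord_ge_sum)
  fix i assume "i \<in> {..degree p}"
  then have "real (degree p) * B \<le> real i * B"
    using assms(1) by (intro mult_right_mono_neg) auto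
  moreover have "ord_ge (coeff p i * x ^ i) (C + i * B)"
    by (intro ord_ge_mult ord_ge_power assms)
  ultimately show "ord_ge (coeff p i * x ^ i) (C + degree p * B)"
    by (elim ord_ge_mono) simp
qed

text \<open>The coefficients are moved to nearby algebraic elements; an exact root of the moved
  polynomial, supplied by \<open>alg_closed\<close>, nearly annihilates \<open>p\<close>.\<close>

lemma approx_root:
  assumes "degree p > 0" "lead_coeff p = 1"
  shows "\<exists>x. ord_ge (poly p x) r"
proof -
  define n where "n = degree p"
  obtain B where B: "B \<le> 0" "\<And>i. ord_ge (coeff p i) B" using coeffs_bounded by blast
  \<comment> \<open>Evaluation at an element of order at least \<open>B\<close> can lower the order
    by as much as \<open>- n * B\<close>; nonnegativity keeps \<open>B\<close> a bound for the
    coefficients of \<open>q\<close>.\<close>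
  define \<delta> where "\<delta> = max 0 (r - n * B)"
  let ?L = "algebraic_over (K_infinity ord \<theta>)"
  obtain l where l: "\<And>i. l i \<in> ?L" "\<And>i. ord_ge (coeff p i - l i) \<delta>"
    using approx_algebraic[of "coeff p _" \<delta>] unfolding Bex_def by metis
  define q where "q = (\<Sum>i<n. monom (l i) i) + monom 1 n"
  have q: "coeff q i = (if i < n then l i else if i = n then 1 else 0)" for i
    unfolding q_def by (simp add: coeff_sum)
  have dq: "degree q = n"
    by (intro antisym degree_le le_degree) (auto simp: q)
  have "set (coeffs q) \<subseteq> ?L"
    using dq l(1) one_in_algebraic by (auto simp: coeffs_def q)
  then obtain x where x: "poly q x = 0"
    using alg_closed[of q] dq assms(1) n_def by auto
  have d: "ord_ge (coeff (p - q) i) \<delta>" for i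
    using l(2)[of i] assms(2) by (auto simp: q n_def coeff_eq_0)
  have "ord_ge (coeff q i) B" for i
  proof -
    have "ord_ge (coeff p i - coeff (p - q) i) B"
      using B by (intro ord_ge_diff ord_ge_mono[OF d[of i]]) (auto simp: \<delta>_def)
    then show ?thesis by simp
  qed
  then have xB: "ord_ge x B"
    using assms(1) dq q x B by (intro ord_ge_root[of q x B]) (auto simp: n_def)
  have "degree (p - q) \<le> n" using dq n_def by (metis degree_diff_le_max max.idem)
  then have "real n * B \<le> degree (p - q) * B"
    using B by (intro mult_right_mono_neg) auto
  then have "r \<le> \<delta> + degree (p - q) * B" unfolding \<delta>_def by linarith
  with poly_bounded[OF B(1) d xB] have "ord_ge (poly (p - q) x) r" by (rule ord_ge_mono)
  with x show ?thesis by (metis diff_zero poly_diff)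
qed

text \<open>The order of a product is the sum of the orders, so the largest of them is at least the
  average.\<close>

lemma prod_list_ord_ge:
  assumes "ord_ge (\<Prod>a\<leftarrow>xs. x - a) r" "xs \<noteq> []"
  shows "\<exists>a\<in>set xs. ord_ge (x - a) (r / length xs)"
proof (rule ccontr)
  assume H: "\<not> ?thesis"
  define c where "c = r / length xs"
  have c: "\<forall>a\<in>set xs. x - a \<noteq> 0 \<and> rord (x - a) < c"
    using H unfolding c_def by (metis ord_ge_0 ord_ge_iff not_le)
  have "(\<Prod>a\<leftarrow>ys. x - a) \<noteq> 0 \<and> rord (\<Prod>a\<leftarrow>ys. x - a) < length ys * c"
    if "ys \<noteq> []" "set ys \<subseteq> set xs" for ys
    using that
  proof (induction ys rule: list_nonempty_induct)
    case (single a)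
    then show ?case using c by auto
  next
    case (cons a ys)
    then have "(\<Prod>b\<leftarrow>ys. x - b) \<noteq> 0" "rord (\<Prod>b\<leftarrow>ys. x - b) < length ys * c"
      and "x - a \<noteq> 0" "rord (x - a) < c" using c by auto
    then show ?case using rord_mult[of "x - a" "\<Prod>b\<leftarrow>ys. x - b"] by (simp add: algebra_simps)
  qed
  from this[of xs] assms have "r < length xs * c" using ord_ge_iff by fastforce
  with assms(2) show False by (simp add: c_def)
qed

text \<open>
  The polynomial \<open>p - p(y)\<close> splits by the induction hypothesis, since \<open>y\<close> is a root of it. All its
  roots are as good approximate roots of \<open>p\<close> as \<open>y\<close> is, and one of them is close to \<open>x\<close>.
\<close>
lemma better_root:
  assumes "lead_coeff p = 1" "degree p > 0"
    and IH: "\<And>q :: 'a poly. \<lbrakk>0 < degree q; degree q < degree p\<rbrakk> \<Longrightarrow> \<exists>x. poly q x = 0"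
    and x: "ord_ge (poly p x) a" "a \<le> r"
  shows "\<exists>s. ord_ge (poly p s) r \<and> ord_ge (x - s) (a / degree p)"
proof -
  obtain y where y: "ord_ge (poly p y) r" using approx_root assms by blast
  define g where "g = p - [:poly p y:]"
  have dg: "degree g = degree p" "lead_coeff g = 1"
  proof -
    show "degree g = degree p" unfolding g_def minus_eq
      by (metis assms(2) degree_add_eq_left degree_pCons_0 diff_conv_add_uminus degree_minus)
    with assms show "lead_coeff g = 1" unfolding g_def by (cases "degree p") (auto)
  qed
  have root: "poly g y = 0" by (simp add: g_def)
  obtain g' where g': "g = [:- y, 1:] * g'" using root by (metis dvdE poly_eq_0_iff_dvd)
  have "g' \<noteq> 0" using g' dg by auto
  then have "degree g = Suc (degree g')" unfolding g' by (subst degree_mult_eq) auto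
  moreover have "lead_coeff g' = 1"
    using dg(2) unfolding g' by (subst (asm) lead_coeff_mult) simp
  ultimately obtain xs where "g' = (\<Prod>a\<leftarrow>xs. [:- a, 1:])"
    using monic_split[of g'] IH dg by (metis le_imp_less_Suc)
  then have g: "g = (\<Prod>a\<leftarrow>y # xs. [:- a, 1:])" using g' by simp
  have pl: "poly (\<Prod>a\<leftarrow>zs. [:- a, 1:]) z = (\<Prod>a\<leftarrow>zs. z - a)" for zs and z :: 'a
    by (induction zs) (auto simp: minus_eq algebra_simps)
  have len: "degree (\<Prod>a\<leftarrow>zs. [:- a, 1:]) = length zs \<and> (\<Prod>a\<leftarrow>zs. [:- a, 1:]) \<noteq> 0" for zs :: "'a list"
    by (induction zs) (auto simp: degree_mult_eq simp del: mult_pCons_left)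
  have "ord_ge (poly g x) a"
    unfolding g_def using x ord_ge_mono[OF y] by (auto intro: ord_ge_diff)
  then have "ord_ge (\<Prod>a\<leftarrow>y # xs. x - a) a" unfolding g pl .
  then obtain s where "s \<in> set (y # xs)" "ord_ge (x - s) (a / length (y # xs))"
    using prod_list_ord_ge[of x "y # xs" a] by blast
  moreover have "length (y # xs) = degree p" using len[of "y # xs"] dg(1) g by metis
  ultimately have s: "s \<in> set (y # xs)" "ord_ge (x - s) (a / degree p)" by metis+
  have "poly g s = 0" unfolding g pl using s(1) by (auto simp: prod_list_zero_iff)
  then have "poly p s = poly p y" by (simp add: g_def)
  with s y show ?thesis by (intro exI[of _ s]) simp
qed

theorem algebraically_closed: "degree (p :: 'a poly) > 0 \<Longrightarrow> \<exists>x. poly p x = 0"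
proof (induction "degree p" arbitrary: p rule: less_induct)
  case (less p0)
  define p where "p = Polynomial.smult (inverse (lead_coeff p0)) p0"
  have "p0 \<noteq> 0" using less by auto
  then have p: "degree p = degree p0" "lead_coeff p = 1" by (auto simp: p_def)
  define n where "n = degree p"
  have n: "n > 0" using less p n_def by simp
  have IH: "\<exists>x. poly q x = 0" if "0 < degree q" "degree q < degree p" for q :: "'a poly"
    using less.hyps[of q] that p by simp
  \<comment> \<open>Accuracy \<open>n * k\<close>, because \<open>better_root\<close> divides by the
    degree \<open>n\<close>: consecutive approximations then agree to order
    \<open>k\<close>.\<close>
  have "\<exists>s. \<forall>k. ord_ge (poly p (s k)) (real (n * k)) \<and> ord_ge (s k - s (Suc k)) (real k)"
  proof (rule dependent_nat_choice)
    show "\<exists>x. ord_ge (poly p x) (real (n * 0))" using approx_root less.prems p by simp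
    fix x k assume "ord_ge (poly p x) (real (n * k))"
    from better_root[OF p(2) _ IH this, of "real (n * Suc k)"]
    show "\<exists>y. ord_ge (poly p y) (real (n * Suc k)) \<and> ord_ge (x - y) (real k)"
      using n by (simp add: n_def)
  qed
  then obtain s where s: "\<And>k. ord_ge (poly p (s k)) (real (n * k))" "\<And>k. ord_ge (s k - s (Suc k)) (real k)"
    by blast
  obtain x where x: "\<And>k. ord_ge (x - s k) (real k)" using limit_exists[of s] s(2) by blast
  obtain B where B: "B \<le> 0" "ord_ge x B" 
    by (metis min.cobounded1 min.cobounded2 ord_ge_0 ord_ge_iff)
  have sB: "ord_ge (s k) B" for k
  proof -
    have "ord_ge (x - (x - s k)) B"
      by (intro ord_ge_diff B ord_ge_mono[OF x[of k]]) (use B in simp)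
    then show ?thesis by simp
  qed
  \<comment> \<open>Continuity of \<open>p\<close> at \<open>x\<close> in quantitative form: the
    cofactor \<open>q\<close> is bounded at every \<open>s k\<close> by a constant independent of
    \<open>k\<close>.\<close>
  have "poly (p - [:poly p x:]) x = 0" by simp
  then obtain q where q: "p - [:poly p x:] = [:- x, 1:] * q" by (metis dvdE poly_eq_0_iff_dvd)
  obtain C where C: "C \<le> 0" "\<And>i. ord_ge (coeff q i) C" using coeffs_bounded by blast
  define D where "D = C + degree q * B"
  have D: "D \<le> 0" unfolding D_def
    by (intro add_nonpos_nonpos mult_nonneg_nonpos) (use B C in auto)
  have pk: "ord_ge (poly p x) (k + D)" for k :: nat
  proof -
    have "poly p (s k) - poly p x = (s k - x) * poly q (s k)"
      using arg_cong[OF q, of "\<lambda>r. poly r (s k)"] by (simp add: minus_eq algebra_simps)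
    moreover have "ord_ge (s k - x) k" using x[of k] by (simp add: minus_eq add.commute)
    ultimately have "ord_ge (poly p (s k) - poly p x) (k + D)"
      using poly_bounded[OF B(1) C(2) sB] unfolding D_def by (metis ord_ge_mult)
    moreover have "ord_ge (poly p (s k)) (k + D)"
    proof (rule ord_ge_mono[OF s(1)])
      have "real k \<le> real (n * k)" using n by (simp del: of_nat_mult)
      then show "real k + D \<le> real (n * k)" using D by linarith
    qed
    ultimately have "ord_ge (poly p (s k) - (poly p (s k) - poly p x)) (k + D)" by (rule ord_ge_diff[rotated])
    then show ?thesis by simp
  qed
  have "poly p x = 0"
  proof (rule ord_ge_unbounded)
    fix m :: nat
    obtain k :: nat where "m - D < k" using reals_Archimedean2 by blast
    then show "ord_ge (poly p x) m" by (intro ord_ge_mono[OF pk[of k]]) simp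
  qed
  then show ?case using \<open>p0 \<noteq> 0\<close> by (auto simp: p_def)
qed

end

section \<open>Newton polygons\<close>

text \<open>Each linear factor split off contributes a new root: if it repeated, the derivative
  would vanish there.\<close>

lemma card_simple_roots:
  fixes p :: "'a::field poly"
  assumes "\<And>q :: 'a poly. 0 < degree q \<Longrightarrow> \<exists>x. poly q x = 0" "p \<noteq> 0"
    and "\<And>x. poly p x = 0 \<Longrightarrow> poly (pderiv p) x \<noteq> 0"
  shows "card {x. poly p x = 0} = degree p"
proof -
  have "(\<forall>x. poly p x = 0 \<longrightarrow> poly (pderiv p) x \<noteq> 0) \<longrightarrow> card {x. poly p x = 0} = degree p"
  proof (induction p rule: poly_split_induct)
    case (mult a q)
    show ?case
    proof
      assume H: "\<forall>x. poly ([:- a, 1:] * q) x = 0 \<longrightarrow> poly (pderiv ([:- a, 1:] * q)) x \<noteq> 0"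
      have d: "poly (pderiv ([:- a, 1:] * q)) x = (x - a) * poly (pderiv q) x + poly q x" for x
        unfolding pderiv_mult by (simp add: pderiv_pCons algebra_simps)
      have z: "poly ([:- a, 1:] * q) x = (x - a) * poly q x" for x
        by (simp add: algebra_simps)
      from H have "\<forall>x. (x - a) * poly q x = 0 \<longrightarrow> (x - a) * poly (pderiv q) x + poly q x \<noteq> 0"
        unfolding d z .
      then have a: "poly q a \<noteq> 0" and "\<forall>x. poly q x = 0 \<longrightarrow> poly (pderiv q) x \<noteq> 0"
        by (force, fastforce)
      with mult.IH have "card {x. poly q x = 0} = degree q" by blast
      moreover have "{x. poly ([:- a, 1:] * q) x = 0} = insert a {x. poly q x = 0}"
        unfolding z by auto
      moreover have "degree ([:- a, 1:] * q) = Suc (degree q)"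
        using \<open>q \<noteq> 0\<close> by (subst degree_mult_eq) auto
      ultimately show "card {x. poly ([:- a, 1:] * q) x = 0} = degree ([:- a, 1:] * q)"
        using a poly_roots_finite[OF \<open>q \<noteq> 0\<close>] by simp
    qed
  qed (use assms in auto)
  with assms show ?thesis by blast
qed

context C_infinity
begin

text \<open>One half of the Newton polygon: multiplication by a factor X - a with a of order at most
  \<open>\<rho>\<close> keeps all coefficients on or above the line of slope \<open>- \<rho>\<close>
  through the constant coefficient.\<close>

lemma coeff_ge_of_roots:
  assumes "p \<noteq> 0" "\<And>x. poly p x = 0 \<Longrightarrow> x \<noteq> 0 \<and> rord x \<le> \<rho>"
  shows "coeff p 0 \<noteq> 0 \<and> ord_ge (coeff p j) (rord (coeff p 0) - j * \<rho>)"
proof -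
  have "(\<forall>x. poly p x = 0 \<longrightarrow> x \<noteq> 0 \<and> rord x \<le> \<rho>) \<longrightarrow>
    coeff p 0 \<noteq> 0 \<and> (\<forall>j. ord_ge (coeff p j) (rord (coeff p 0) - j * \<rho>))"
  proof (induction p rule: poly_split_induct)
    case (const c)
    then show ?case by (auto simp: coeff_pCons ord_ge_iff split: nat.split)
  next
    case (mult a q)
    show ?case
    proof
      assume H: "\<forall>x. poly ([:- a, 1:] * q) x = 0 \<longrightarrow> x \<noteq> 0 \<and> rord x \<le> \<rho>"
      have "poly ([:- a, 1:] * q) a = 0" "\<And>x. poly q x = 0 \<Longrightarrow> poly ([:- a, 1:] * q) x = 0"
        by (simp_all only: poly_mult) simp_all
      with H have a: "a \<noteq> 0" "rord a \<le> \<rho>" and "\<forall>x. poly q x = 0 \<longrightarrow> x \<noteq> 0 \<and> rord x \<le> \<rho>"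
        by blast+
      with mult.IH have q: "coeff q 0 \<noteq> 0" "\<And>j. ord_ge (coeff q j) (rord (coeff q 0) - j * \<rho>)"
        by auto
      have c0: "coeff ([:- a, 1:] * q) 0 = a * coeff q 0" by simp
      have c: "coeff ([:- a, 1:] * q) (Suc j) = a * coeff q (Suc j) + coeff q j" for j by simp
      have r: "rord (a * coeff q 0) = rord a + rord (coeff q 0)"
        using a q by (simp add: rord_mult)
      have aq: "ord_ge (a * coeff q j) (rord a + rord (coeff q 0) - j * \<rho>)" for j
        using ord_ge_mult[OF _ q(2), of a "rord a" j] a by (simp add: ord_ge_iff algebra_simps)
      have "ord_ge (coeff ([:- a, 1:] * q) j) (rord (a * coeff q 0) - j * \<rho>)" for j
      proof (cases j)
        case 0
        then show ?thesis using aq[of 0] unfolding r 0 c0 by simp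
      next
        case (Suc i)
        show ?thesis unfolding r Suc c
        proof (rule ord_ge_add[OF aq])
          show "ord_ge (coeff q i) (rord a + rord (coeff q 0) - real (Suc i) * \<rho>)"
            by (rule ord_ge_mono[OF q(2)]) (use a in \<open>simp add: algebra_simps\<close>)
        qed
      qed
      then show "coeff ([:- a, 1:] * q) 0 \<noteq> 0 \<and>
          (\<forall>j. ord_ge (coeff ([:- a, 1:] * q) j) (rord (coeff ([:- a, 1:] * q) 0) - j * \<rho>))"
        unfolding c0 using a q by simp
    qed
  qed (use assms algebraically_closed in auto)
  with assms show ?thesis by blast
qed

text \<open>The slope of the leftmost edge of the Newton polygon, attained by a root of largest order.\<close>
lemma root_of_large_ord:
  assumes "degree p > 0"
  obtains x where "poly p x = 0"
    "\<And>j r. \<lbrakk>j > 0; coeff p j \<noteq> 0; ord_ge (coeff p 0) r\<rbrakk> \<Longrightarrow> ord_ge x ((r - rord (coeff p j)) / j)"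
proof (cases "coeff p 0 = 0")
  case True
  then have "poly p 0 = 0" by (simp add: poly_0_coeff_0)
  with that[of 0] show thesis by simp
next
  case False
  let ?R = "{x. poly p x = 0}"
  have "p \<noteq> 0" using assms by auto
  then have fin: "finite (rord ` ?R)" by (intro finite_imageI poly_roots_finite)
  have ne: "rord ` ?R \<noteq> {}" using algebraically_closed[OF assms] by blast
  define \<rho> where "\<rho> = Max (rord ` ?R)"
  obtain x where x: "poly p x = 0" "rord x = \<rho>"
    using Max_in[OF fin ne] unfolding \<rho>_def by auto
  have nz: "y \<noteq> 0" if "poly p y = 0" for y using False that by (auto simp: poly_0_coeff_0)
  have "rord y \<le> \<rho>" if "poly p y = 0" for y unfolding \<rho>_def using that fin by (intro Max_ge) auto
  with nz have c: "ord_ge (coeff p j) (rord (coeff p 0) - j * \<rho>)" for j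
    using coeff_ge_of_roots[OF \<open>p \<noteq> 0\<close>] by blast
  have "ord_ge x ((r - rord (coeff p j)) / j)"
    if j: "j > 0" "coeff p j \<noteq> 0" "ord_ge (coeff p 0) r" for j r
  proof -
    have "rord (coeff p 0) - j * \<rho> \<le> rord (coeff p j)" "r \<le> rord (coeff p 0)"
      using c[of j] j False by (simp_all add: ord_ge_iff)
    then have "(r - rord (coeff p j)) / j \<le> \<rho>" using j by (simp add: field_simps)
    with x nz show ?thesis by (simp add: ord_ge_iff)
  qed
  with x that show thesis by blast
qed

lemma rord_add_eq:
  assumes "x \<noteq> 0" "ord_ge y s" "rord x < s"
  shows "x + y \<noteq> 0 \<and> rord (x + y) = rord x"
proof -
  have nz: "x + y \<noteq> 0"
  proof
    assume "x + y = 0"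
    then have "y = x" by (metis add_self add_left_cancel)
    with assms show False by (simp add: ord_ge_iff)
  qed
  have "ord_ge (x + y) (rord x)"
    by (intro ord_ge_add ord_ge_mono[OF assms(2)]) (use assms in \<open>auto simp: ord_ge_iff\<close>)
  with nz have "rord x \<le> rord (x + y)" by (simp add: ord_ge_iff)
  moreover have "\<not> rord x < rord (x + y)"
  proof
    assume *: "rord x < rord (x + y)"
    have "ord_ge ((x + y) + y) (min s (rord (x + y)))"
      by (rule ord_ge_add, use nz in \<open>simp add: ord_ge_iff\<close>, rule ord_ge_mono[OF assms(2)], simp)
    then have "ord_ge x (min s (rord (x + y)))" by (simp add: ac_simps)
    with assms * show False by (simp add: ord_ge_iff)
  qed
  ultimately show ?thesis using nz by simp
qed

lemma square_add [simp]: "(x + y)\<^sup>2 = x\<^sup>2 + (y::'a)\<^sup>2"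
  by (rule char_two_square_add[OF char_two])

lemma power4_add [simp]: "(x + y) ^ 4 = x ^ 4 + (y::'a) ^ 4"
  using square_add[of "x\<^sup>2" "y\<^sup>2"] by (simp flip: power_mult square_add)

lemma square_inject: "x\<^sup>2 = (y::'a)\<^sup>2 \<Longrightarrow> x = y"
  using square_add[of x y] by (metis add_self add_left_cancel zero_eq_power2)

lemma square_root_exists: "\<exists>y. y\<^sup>2 = (x::'a)"
proof -
  obtain y where "poly (monom 1 2 - [:x:]) y = 0"
    using algebraically_closed[of "monom 1 2 - [:x:]"]
    by (metis degree_diff_less degree_monom_eq degree_pCons_0 degree_add_eq_left diff_conv_add_uminus degree_minus pos2 zero_neq_one)
  then show ?thesis by (auto simp: poly_monom)
qed

end

section \<open>The system for the coefficients of an invariant\<close>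

locale D13_parameters = C_infinity ord \<theta> for ord :: "'a::field \<Rightarrow> ereal" and \<theta> +
  fixes a11 a12 a21 :: 'a and u v :: real
  assumes ord_a11: "ord a11 = -1"
    and a12_nz: "a12 \<noteq> 0" and a21_nz: "a21 \<noteq> 0"
    and ord_a12: "ord a12 = ereal u" and ord_a21: "ord a21 = ereal v"
    and in_D13: "(u, v) \<in> D13" and v_nonneg: "v \<ge> 0"
begin

lemma u_gt: "u > - 2 * v - 2"
  using in_D13 by (simp add: D13_def)

lemma theta_nz: "\<theta> \<noteq> 0"
proof
  assume "\<theta> = 0"
  then show False using ord_theta ord_0 by (simp add: one_ereal_def)
qed

lemma rord_theta [simp]: "rord \<theta> = -1"
  by (simp add: rord_def ord_theta)

lemma rord_a21 [simp]: "rord a21 = v"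
  by (simp add: rord_def ord_a21)

lemma ord_ge_coeffs: "ord_ge \<theta> (-1)" "ord_ge a11 (-1)" "ord_ge a12 u" "ord_ge a21 v"
  by (simp_all add: ord_ge_def ord_theta ord_a11 ord_a12 ord_a21 one_ereal_def)

text \<open>
  The equation for one coefficient of a \<open>\<tau>\<close>-invariant, in terms of the previous coefficient, whose
  entries have fourth powers \<open>w1\<close> and \<open>w2\<close>.
\<close>
definition coeff_system :: "'a \<Rightarrow> 'a \<Rightarrow> 'a \<Rightarrow> 'a \<Rightarrow> bool" where
  "coeff_system y1 y2 w1 w2 \<longleftrightarrow>
    \<theta>\<^sup>2 * y1 ^ 4 + a11 * y1\<^sup>2 + a21 * y2\<^sup>2 + y1 = w1 \<and> \<theta>\<^sup>2 * y2 ^ 4 + a12 * y1\<^sup>2 + y2 = w2"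

definition c4 :: 'a where "c4 = \<theta> ^ 4 / a21 ^ 3 + (a21 * a12\<^sup>2 + \<theta>\<^sup>2)"

definition elim_const :: "'a \<Rightarrow> 'a \<Rightarrow> 'a" where
  "elim_const w1 w2 = \<theta> ^ 4 / a21 ^ 3 * w1 ^ 4 + w1 + a21 * w2\<^sup>2"

definition elim_poly :: "'a \<Rightarrow> 'a \<Rightarrow> 'a poly" where
  "elim_poly w1 w2 = [:elim_const w1 w2, 1:] + monom a11 2 + monom c4 4
     + monom (\<theta> ^ 4 / a21 ^ 3 * a11 ^ 4) 8 + monom (\<theta> ^ 12 / a21 ^ 3) 16"

text \<open>The value that the first equation forces on \<open>a21 * y2\<^sup>2\<close>; despite the
  name, the factor \<open>a21\<close> is included.\<close>

definition y2_squared :: "'a \<Rightarrow> 'a \<Rightarrow> 'a" where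
  "y2_squared w1 y1 = w1 + y1 + a11 * y1\<^sup>2 + \<theta>\<^sup>2 * y1 ^ 4"

lemma poly_elim_poly: "poly (elim_poly w1 w2) y = elim_const w1 w2 + y + a11 * y\<^sup>2 + c4 * y ^ 4
    + \<theta> ^ 4 / a21 ^ 3 * a11 ^ 4 * y ^ 8 + \<theta> ^ 12 / a21 ^ 3 * y ^ 16"
  by (simp add: elim_poly_def poly_monom)

lemma eq_iff_add: "x = y \<longleftrightarrow> x + y = (0::'a)"
  by (metis add_self add_left_cancel)

text \<open>Squaring the second equation, which is harmless, makes the first one eliminate \<open>y2\<close>.\<close>
lemma coeff_system_iff:
  "coeff_system y1 y2 w1 w2 \<longleftrightarrow> poly (elim_poly w1 w2) y1 = 0 \<and> a21 * y2\<^sup>2 = y2_squared w1 y1"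
proof -
  define g where "g = y2_squared w1 y1"
  define e where "e = \<theta>\<^sup>2 * y2 ^ 4 + a12 * y1\<^sup>2 + y2 + w2"
  have 1: "\<theta>\<^sup>2 * y1 ^ 4 + a11 * y1\<^sup>2 + a21 * y2\<^sup>2 + y1 = w1 \<longleftrightarrow> a21 * y2\<^sup>2 = g"
    unfolding g_def y2_squared_def by (subst (1 2) eq_iff_add) (simp add: ac_simps)
  have 2: "\<theta>\<^sup>2 * y2 ^ 4 + a12 * y1\<^sup>2 + y2 = w2 \<longleftrightarrow> e = 0"
    unfolding e_def by (rule eq_iff_add)
  \<comment> \<open>Given the first equation, the eliminated polynomial is \<open>a21\<close> times
    the square of the error \<open>e\<close> in the second, so each vanishes exactly when the other
    does.\<close>
  have "poly (elim_poly w1 w2) y1 = a21 * e\<^sup>2" if g: "a21 * y2\<^sup>2 = g"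
  proof -
    have g4: "g ^ 4 = w1 ^ 4 + y1 ^ 4 + a11 ^ 4 * y1 ^ 8 + \<theta> ^ 8 * y1 ^ 16"
      unfolding g_def y2_squared_def by (simp add: power_mult_distrib flip: power_mult)
    have "\<theta> ^ 12 = \<theta> ^ 4 * \<theta> ^ 8" by (simp flip: power_add)
    then have "\<theta> ^ 12 / a21 ^ 3 * y1 ^ 16 = \<theta> ^ 4 / a21 ^ 3 * (\<theta> ^ 8 * y1 ^ 16)" by simp
    then have "poly (elim_poly w1 w2) y1 = \<theta> ^ 4 / a21 ^ 3 * g ^ 4 + a21 * a12\<^sup>2 * y1 ^ 4 + g + a21 * w2\<^sup>2"
      unfolding poly_elim_poly g4 unfolding g_def y2_squared_def elim_const_def c4_def
      by (simp add: distrib_left distrib_right ac_simps)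
    also have "\<theta> ^ 4 / a21 ^ 3 * g ^ 4 = a21 * (\<theta> ^ 4 * y2 ^ 8)"
      using a21_nz by (simp add: power_mult_distrib field_simps eval_nat_numeral flip: g)
    finally show ?thesis
      unfolding g[symmetric] e_def
      by (simp add: power_mult_distrib distrib_left ac_simps flip: power_mult)
  qed
  with 1 2 a21_nz show ?thesis unfolding coeff_system_def g_def by auto
qed

lemma a12_term: "ord_ge (a21 * a12\<^sup>2) (v + 2 * u)"
  using ord_ge_mult[OF ord_ge_coeffs(4) ord_ge_power[OF ord_ge_coeffs(3), of 2]] by simp

text \<open>The inequalities of \<open>D13\<close> amount to \<open>\<theta> ^ 4 / a21 ^ 3\<close>
  having smaller order than \<open>\<theta>\<^sup>2\<close> and than
  \<open>a21 * a12\<^sup>2\<close>; it therefore determines the order of the sum.\<close>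

lemma rord_c4: "c4 \<noteq> 0" "rord c4 = - 4 - 3 * v"
proof -
  have r: "\<theta> ^ 4 / a21 ^ 3 \<noteq> 0" "rord (\<theta> ^ 4 / a21 ^ 3) = - 4 - 3 * v"
    using theta_nz a21_nz by (simp_all add: rord_divide rord_power)
  have "ord_ge (\<theta>\<^sup>2) (-2)" using ord_ge_power[OF ord_ge_coeffs(1), of 2] by simp
  then have "ord_ge (a21 * a12\<^sup>2 + \<theta>\<^sup>2) (min (v + 2 * u) (-2))"
    by (intro ord_ge_add ord_ge_mono[OF a12_term]) (auto elim: ord_ge_mono)
  moreover have "- 4 - 3 * v < min (v + 2 * u) (-2)" using u_gt v_nonneg by simp
  ultimately show "c4 \<noteq> 0" "rord c4 = - 4 - 3 * v"
    using rord_add_eq[OF r(1), of "a21 * a12\<^sup>2 + \<theta>\<^sup>2"] r(2) unfolding c4_def by auto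
qed

lemma elim_coeffs:
  "coeff (elim_poly w1 w2) 0 = elim_const w1 w2" "coeff (elim_poly w1 w2) 1 = 1"
  "coeff (elim_poly w1 w2) 4 = c4" "coeff (elim_poly w1 w2) 16 = \<theta> ^ 12 / a21 ^ 3"
  by (simp_all add: elim_poly_def coeff_pCons split: nat.split)

lemma degree_elim_poly: "degree (elim_poly w1 w2) = 16"
proof (rule antisym)
  show "degree (elim_poly w1 w2) \<le> 16"
    unfolding elim_poly_def by (intro degree_add_le order.trans[OF degree_monom_le]) auto
  show "16 \<le> degree (elim_poly w1 w2)"
    by (rule le_degree) (use theta_nz a21_nz elim_coeffs in simp)
qed

text \<open>One root of largest order obeys both estimates: the first compares the constant
  coefficient with the linear one, the second with \<open>c4\<close>.\<close>

lemma solve_system: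
  obtains y1 y2 where "coeff_system y1 y2 w1 w2"
    "\<And>r. ord_ge (elim_const w1 w2) r \<Longrightarrow> ord_ge y1 r"
    "\<And>r. ord_ge (elim_const w1 w2) r \<Longrightarrow> ord_ge y1 ((r + 4 + 3 * v) / 4)"
proof -
  obtain y1 where y1: "poly (elim_poly w1 w2) y1 = 0"
    "\<And>j r. \<lbrakk>j > 0; coeff (elim_poly w1 w2) j \<noteq> 0; ord_ge (coeff (elim_poly w1 w2) 0) r\<rbrakk> \<Longrightarrow>
       ord_ge y1 ((r - rord (coeff (elim_poly w1 w2) j)) / j)"
    using root_of_large_ord[of "elim_poly w1 w2"] degree_elim_poly by auto
  obtain y2 where "y2\<^sup>2 = y2_squared w1 y1 / a21" using square_root_exists by blast
  then have "coeff_system y1 y2 w1 w2" using y1 a21_nz by (simp add: coeff_system_iff)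
  then show thesis
  proof (rule that)
    fix r assume r: "ord_ge (elim_const w1 w2) r"
    show "ord_ge y1 r" using y1(2)[of 1 r] r by (simp add: elim_coeffs flip: One_nat_def)
    show "ord_ge y1 ((r + 4 + 3 * v) / 4)"
      using y1(2)[of 4 r] r rord_c4 by (simp add: elim_coeffs algebra_simps)
  qed
qed

section \<open>The homogeneous system\<close>

lemma card_kernel: "card {(y1, y2). coeff_system y1 y2 0 0} = 16"
proof -
  let ?K = "{(y1, y2). coeff_system y1 y2 0 0}"
  \<comment> \<open>Squaring is injective in characteristic 2, so \<open>y1\<close> determines
    \<open>y2\<close>.\<close>
  have inj: "inj_on fst ?K"
    using a21_nz by (auto simp: inj_on_def coeff_system_iff intro: square_inject)
      (metis mult_left_cancel square_inject)
  have "fst ` ?K = {x. poly (elim_poly 0 0) x = 0}"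
  proof (intro equalityI subsetI)
    fix y1 assume "y1 \<in> {x. poly (elim_poly 0 0) x = 0}"
    moreover obtain y2 where "y2\<^sup>2 = y2_squared 0 y1 / a21" using square_root_exists by blast
    ultimately have "(y1, y2) \<in> ?K" using a21_nz by (simp add: coeff_system_iff)
    then show "y1 \<in> fst ` ?K" by force
  qed (auto simp: coeff_system_iff)
  moreover have "card {x. poly (elim_poly 0 0) x = 0} = degree (elim_poly 0 0)"
  proof (rule card_simple_roots)
    have n0: "(of_nat n :: 'a) = 0" if "even n" for n
      using that by (simp add: of_nat_eq_0_iff_char_dvd char_two)
    \<comment> \<open>All exponents above 1 are even, so only the linear term survives and all roots
      are simple.\<close>
    have "pderiv (elim_poly 0 0) = 1"
      unfolding elim_poly_def pderiv_add pderiv_monom n0[of 2, simplified]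
      using n0[of 2] n0[of 4] n0[of 8] n0[of 16] by (simp add: pderiv_pCons)
    then show "poly (pderiv (elim_poly 0 0)) x \<noteq> 0" for x by simp
    show "elim_poly 0 0 \<noteq> 0" using degree_elim_poly[of 0 0] by auto
  qed (use algebraically_closed in auto)
  ultimately show ?thesis using card_image[OF inj] degree_elim_poly by simp
qed

text \<open>At order 2/3 the terms \<open>\<theta>\<^sup>2 * y ^ 4\<close> and \<open>y\<close> have
  equal order; below it the former dominates, and the sum has order four times that of
  \<open>y\<close>, minus 2.\<close>

lemma second_equation_bound:
  assumes "ord_ge (\<theta>\<^sup>2 * y ^ 4 + y) s"
  shows "ord_ge y (min (2/3) ((s + 2) / 4))"
proof (rule ccontr)
  assume *: "\<not> ?thesis"
  then have "y \<noteq> 0" by auto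
  moreover from this * have "rord y < min (2/3) ((s + 2) / 4)" by (simp add: ord_ge_iff not_le)
  ultimately have y: "y \<noteq> 0" "rord y < 2/3" "rord y < (s + 2) / 4" by simp_all
  have "rord (\<theta>\<^sup>2 * y ^ 4) = 4 * rord y - 2"
    using y theta_nz by (simp add: rord_mult rord_power)
  then have "\<theta>\<^sup>2 * y ^ 4 + y \<noteq> 0 \<and> rord (\<theta>\<^sup>2 * y ^ 4 + y) = 4 * rord y - 2"
    using rord_add_eq[of "\<theta>\<^sup>2 * y ^ 4" y "rord y"] y theta_nz by (simp add: ord_ge_iff)
  with assms y show False by (auto simp: ord_ge_iff)
qed

lemma second_equation_iff: "\<theta>\<^sup>2 * y2 ^ 4 + a12 * y1\<^sup>2 + y2 = w2 \<longleftrightarrow> \<theta>\<^sup>2 * y2 ^ 4 + y2 = a12 * y1\<^sup>2 + (w2::'a)"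
  by (subst (1 2) eq_iff_add) (simp add: ac_simps)

text \<open>At order 1/2 the leading term of the eliminated polynomial meets the bound for the term
  in \<open>y1 ^ 8\<close>; below, it has strictly smallest order and cannot cancel. The bound on
  \<open>y2\<close> then comes from the second equation and \<open>u > - 2 * v - 2\<close>. The pair
  of bounds has the shape that \<open>near\<close> later iterates.\<close>

lemma kernel_bounds:
  assumes "coeff_system y1 y2 0 0"
  shows "ord_ge y1 (1/2)" "ord_ge y2 (min (2/3) ((1/2 - v) / 2))"
proof -
  from assms have "poly (elim_poly 0 0) y1 = 0" by (simp add: coeff_system_iff)
  then have eq: "\<theta> ^ 12 / a21 ^ 3 * y1 ^ 16 + (y1 + a11 * y1\<^sup>2 + c4 * y1 ^ 4 + \<theta> ^ 4 / a21 ^ 3 * a11 ^ 4 * y1 ^ 8) = 0"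
    unfolding poly_elim_poly by (simp add: elim_const_def ac_simps)
  show y1: "ord_ge y1 (1/2)"
  proof (rule ccontr)
    assume *: "\<not> ?thesis"
    then have "y1 \<noteq> 0" by auto
    with * have y1: "y1 \<noteq> 0" "rord y1 < 1/2" by (auto simp: ord_ge_iff)
    define x where "x = rord y1"
    have x: "ord_ge y1 x" using y1 by (simp add: x_def ord_ge_iff)
    define s where "s = min (min x (2 * x - 1)) (min (4 * x - 4 - 3 * v) (8 * x - 8 - 3 * v))"
    have t: "ord_ge (\<theta> ^ 4 / a21 ^ 3) (- 4 - 3 * v)"
      using theta_nz a21_nz by (simp add: rord_divide rord_power ord_ge_iff)
    have "ord_ge (y1 + a11 * y1\<^sup>2 + c4 * y1 ^ 4 + \<theta> ^ 4 / a21 ^ 3 * a11 ^ 4 * y1 ^ 8) s"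
    proof (intro ord_ge_add)
      show "ord_ge y1 s" by (rule ord_ge_mono[OF x]) (simp add: s_def)
      show "ord_ge (a11 * y1\<^sup>2) s"
        by (rule ord_ge_mono[OF ord_ge_mult[OF ord_ge_coeffs(2) ord_ge_power[OF x]]]) (simp add: s_def)
      have "ord_ge c4 (- 4 - 3 * v)" using rord_c4 by (simp add: ord_ge_iff)
      then show "ord_ge (c4 * y1 ^ 4) s"
        by (rule ord_ge_mono[OF ord_ge_mult[OF _ ord_ge_power[OF x]]]) (simp add: s_def)
      show "ord_ge (\<theta> ^ 4 / a21 ^ 3 * a11 ^ 4 * y1 ^ 8) s"
        by (rule ord_ge_mono[OF ord_ge_mult[OF ord_ge_mult[OF t ord_ge_power[OF ord_ge_coeffs(2)]]
              ord_ge_power[OF x]]]) (simp add: s_def)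
    qed
    moreover have "rord (\<theta> ^ 12 / a21 ^ 3 * y1 ^ 16) = 16 * x - 12 - 3 * v"
      using y1 theta_nz a21_nz by (simp add: rord_mult rord_divide rord_power x_def)
    moreover have "16 * x - 12 - 3 * v < s" using y1 v_nonneg unfolding s_def x_def by auto
    ultimately show False
      using rord_add_eq[of "\<theta> ^ 12 / a21 ^ 3 * y1 ^ 16"] eq y1 theta_nz a21_nz by auto
  qed
  have "\<theta>\<^sup>2 * y2 ^ 4 + y2 = a12 * y1\<^sup>2"
    using assms second_equation_iff[of y2 y1 0] by (simp add: coeff_system_def)
  moreover have "ord_ge (a12 * y1\<^sup>2) (u + 1)"
    by (rule ord_ge_mono[OF ord_ge_mult[OF ord_ge_coeffs(3) ord_ge_power[OF y1]]]) simp
  ultimately have "ord_ge y2 (min (2/3) ((u + 1 + 2) / 4))"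
    using second_equation_bound by metis
  then show "ord_ge y2 (min (2/3) ((1/2 - v) / 2))"
    by (rule ord_ge_mono) (use u_gt in \<open>auto simp: min_def field_simps\<close>)
qed

text \<open>From this threshold on every nonlinear term gains at least 1 in order over its argument:
  2 serves \<open>a11 * y1\<^sup>2\<close>, and \<open>1 - u\<close> serves
  \<open>a12 * y1\<^sup>2\<close>. Each unknown equals a sum of such terms, so its order exceeds
  every bound.\<close>

lemma kernel_trivial_near_0:
  assumes "coeff_system y1 y2 0 0" "ord_ge y1 (max 2 (1 - u))" "ord_ge y2 (max 2 (1 - u))"
  shows "y1 = 0" "y2 = 0"
proof -
  from assms(1) have "\<theta>\<^sup>2 * y1 ^ 4 + a11 * y1\<^sup>2 + a21 * y2\<^sup>2 + y1 = 0" "\<theta>\<^sup>2 * y2 ^ 4 + a12 * y1\<^sup>2 + y2 = 0"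
    by (simp_all add: coeff_system_def)
  then have y1: "y1 = \<theta>\<^sup>2 * y1 ^ 4 + a11 * y1\<^sup>2 + a21 * y2\<^sup>2" and y2: "y2 = \<theta>\<^sup>2 * y2 ^ 4 + a12 * y1\<^sup>2"
    using eq_iff_add by metis+
  have "ord_ge y1 (max 2 (1 - u) + n) \<and> ord_ge y2 (max 2 (1 - u) + n)" for n :: nat
  proof (induction n)
    case (Suc n)
    define m where "m = max 2 (1 - u) + n"
    have m: "m \<ge> 2" "m \<ge> 1 - u" "max 2 (1 - u) + Suc n = m + 1" by (auto simp: m_def)
    from Suc have y: "ord_ge y1 m" "ord_ge y2 m" by (auto simp: m_def)
    have t4: "ord_ge (\<theta>\<^sup>2 * z ^ 4) (m + 1)" if "ord_ge z m" for z
      by (rule ord_ge_mono[OF ord_ge_mult[OF ord_ge_power[OF ord_ge_coeffs(1)] ord_ge_power[OF that]]])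
        (use m in simp)
    have "ord_ge (a11 * y1\<^sup>2) (m + 1)"
      by (rule ord_ge_mono[OF ord_ge_mult[OF ord_ge_coeffs(2) ord_ge_power[OF y(1)]]]) (use m in simp)
    moreover have "ord_ge (a21 * y2\<^sup>2) (m + 1)"
      by (rule ord_ge_mono[OF ord_ge_mult[OF ord_ge_coeffs(4) ord_ge_power[OF y(2)]]])
        (use m v_nonneg in simp)
    moreover have "ord_ge (a12 * y1\<^sup>2) (m + 1)"
      by (rule ord_ge_mono[OF ord_ge_mult[OF ord_ge_coeffs(3) ord_ge_power[OF y(1)]]]) (use m in simp)
    ultimately have "ord_ge (\<theta>\<^sup>2 * y1 ^ 4 + a11 * y1\<^sup>2 + a21 * y2\<^sup>2) (m + 1)"
      "ord_ge (\<theta>\<^sup>2 * y2 ^ 4 + a12 * y1\<^sup>2) (m + 1)"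
      using t4 y by (auto intro: ord_ge_add)
    then show ?case unfolding m(3) y1[symmetric] y2[symmetric] by simp
  qed (use assms in auto)
  moreover have "real n \<le> max 2 (1 - u) + real n" for n by simp
  ultimately have "ord_ge y1 n \<and> ord_ge y2 n" for n :: nat
    using ord_ge_mono by blast
  then show "y1 = 0" "y2 = 0" using ord_ge_unbounded by blast+
qed

text \<open>Without the cap, the bound on \<open>y2\<close> gives \<open>a21 * y2\<^sup>2\<close>
  order at least \<open>p\<close>, matching \<open>y1\<close>; the cap 2/3 is the most that
  \<open>second_equation_bound\<close> can show.\<close>

definition near :: "real \<Rightarrow> 'a \<Rightarrow> 'a \<Rightarrow> bool" where
  "near p y1 y2 \<longleftrightarrow> ord_ge y1 p \<and> ord_ge y2 (min (2/3) ((p - v) / 2))"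

text \<open>Balanced so that \<open>y1\<close> and \<open>a21 * y2\<^sup>2\<close> have the same
  lower bound in the first equation.\<close>

definition very_near :: "real \<Rightarrow> 'a \<Rightarrow> 'a \<Rightarrow> bool" where
  "very_near t y1 y2 \<longleftrightarrow> ord_ge y1 (v + 2 * t) \<and> ord_ge y2 t"

section \<open>Growth of orders along a sequence of solutions\<close>

lemma theta_a21: "ord_ge (\<theta> ^ 4 / a21 ^ 3) (- 4 - 3 * v)"
  using theta_nz a21_nz by (simp add: rord_divide rord_power ord_ge_iff)

lemma elim_const_ge:
  assumes "ord_ge z1 p" "ord_ge z2 s" "r \<le> 16 * p - 4 - 3 * v" "r \<le> 4 * p" "r \<le> v + 8 * s"
  shows "ord_ge (elim_const (z1 ^ 4) (z2 ^ 4)) r"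
  unfolding elim_const_def
proof (intro ord_ge_add)
  show "ord_ge (\<theta> ^ 4 / a21 ^ 3 * (z1 ^ 4) ^ 4) r"
    by (rule ord_ge_mono[OF ord_ge_mult[OF theta_a21 ord_ge_power[OF ord_ge_power[OF assms(1)]]]])
      (use assms in simp)
  show "ord_ge (z1 ^ 4) r"
    by (rule ord_ge_mono[OF ord_ge_power[OF assms(1)]]) (use assms in simp)
  show "ord_ge (a21 * (z2 ^ 4)\<^sup>2) r"
    by (rule ord_ge_mono[OF ord_ge_mult[OF ord_ge_coeffs(4) ord_ge_power[OF ord_ge_power[OF assms(2)]]]])
      (use assms in simp)
qed

text \<open>Two regimes for one choice of solution. The estimate through \<open>c4\<close> adds 1 to
  the bound on \<open>y1\<close> until the contribution of \<open>z2\<close>, capped at order 2/3,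
  takes over; from order 2/3 on, the estimate through the linear coefficient passes the fourth
  powers on the right-hand side to the solution.\<close>

lemma improve_solution:
  obtains y1 y2 where "coeff_system y1 y2 (z1 ^ 4) (z2 ^ 4)"
    "\<And>p. \<lbrakk>1/2 \<le> p; near p z1 z2\<rbrakk> \<Longrightarrow> near (min (p + 1) (7/3 + v)) y1 y2"
    "\<And>t. \<lbrakk>2/3 \<le> t; very_near t z1 z2\<rbrakk> \<Longrightarrow> very_near (4 * t) y1 y2"
proof -
  obtain y1 y2 where sys: "coeff_system y1 y2 (z1 ^ 4) (z2 ^ 4)"
    and y1: "\<And>r. ord_ge (elim_const (z1 ^ 4) (z2 ^ 4)) r \<Longrightarrow> ord_ge y1 r"
      "\<And>r. ord_ge (elim_const (z1 ^ 4) (z2 ^ 4)) r \<Longrightarrow> ord_ge y1 ((r + 4 + 3 * v) / 4)"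
    using solve_system by blast
  have near: "near (min (p + 1) (7/3 + v)) y1 y2" if p: "1/2 \<le> p" "near p z1 z2" for p
  proof -
    define p' where "p' = min (p + 1) (7/3 + v)"
    from p have z: "ord_ge z1 p" "ord_ge z2 (min (2/3) ((p - v) / 2))" by (auto simp: near_def)
    \<comment> \<open>With \<open>4 + 3 * v\<close> added and divided by 4, the two entries become
      \<open>p + 1\<close> and \<open>7/3 + v\<close>; 16/3 is 8 times the cap 2/3 on the order of
      \<open>z2\<close>.\<close>
    have "ord_ge (elim_const (z1 ^ 4) (z2 ^ 4)) (min (4 * p - 3 * v) (v + 16/3))"
    proof (rule elim_const_ge[OF z])
      show "min (4 * p - 3 * v) (v + 16/3) \<le> v + 8 * min (2/3) ((p - v) / 2)"
      proof (cases "2/3 \<le> (p - v) / 2")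
        case True
        then have e: "min (2/3) ((p - v) / 2) = 2/3" by simp
        show ?thesis unfolding e by (intro order_trans[OF min.cobounded2]) simp
      next
        case False
        then have e: "min (2/3) ((p - v) / 2) = (p - v) / 2" by simp
        show ?thesis unfolding e by (intro order_trans[OF min.cobounded1]) (simp add: diff_divide_distrib)
      qed
    qed (use p(1) v_nonneg in linarith)+
    from y1(2)[OF this] have y1p: "ord_ge y1 p'"
      by (rule ord_ge_mono) (auto simp: p'_def min_def add_divide_distrib diff_divide_distrib)
    define s where "s = min (u + 2 * p') (4 * min (2/3) ((p - v) / 2))"
    have "\<theta>\<^sup>2 * y2 ^ 4 + y2 = a12 * y1\<^sup>2 + z2 ^ 4"
      using sys unfolding coeff_system_def second_equation_iff by simp
    moreover have "ord_ge (a12 * y1\<^sup>2 + z2 ^ 4) s"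
    proof (rule ord_ge_add)
      show "ord_ge (a12 * y1\<^sup>2) s"
        by (rule ord_ge_mono[OF ord_ge_mult[OF ord_ge_coeffs(3) ord_ge_power[OF y1p]]])
          (simp add: s_def)
      show "ord_ge (z2 ^ 4) s"
        by (rule ord_ge_mono[OF ord_ge_power[OF z(2)]]) (simp add: s_def)
    qed
    ultimately have "ord_ge y2 (min (2/3) ((s + 2) / 4))"
      using second_equation_bound by simp
    then have "ord_ge y2 (min (2/3) ((p' - v) / 2))"
    proof (rule ord_ge_mono)
      have "4 * min (2/3) ((p - v) / 2) = min (8/3) (2 * p - 2 * v)"
        by (simp add: min_def diff_divide_distrib)
      then have "s = min (u + 2 * p') (min (8/3) (2 * p - 2 * v))" by (simp add: s_def)
      moreover have "p' \<le> p + 1" by (simp add: p'_def)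
      \<comment> \<open>Each alternative for the minimum \<open>s\<close> is covered: the term in
        \<open>a12\<close> by \<open>u > - 2 * v - 2\<close>, the term in \<open>z2\<close> by its
        cap or by \<open>p' \<le> p + 1\<close>.\<close>
      ultimately have "8/3 \<le> s + 2 \<or> 2 * p' - 2 * v \<le> s + 2" using u_gt by linarith
      then show "min (2/3) ((p' - v) / 2) \<le> min (2/3) ((s + 2) / 4)"
        by (intro min.boundedI min.cobounded1)
          (auto simp: min_le_iff_disj diff_divide_distrib add_divide_distrib)
    qed
    with y1p show ?thesis by (simp add: near_def p'_def)
  qed
  have "very_near (4 * t) y1 y2" if t: "2/3 \<le> t" "very_near t z1 z2" for t
  proof -
    from t have z: "ord_ge z1 (v + 2 * t)" "ord_ge z2 t" by (auto simp: very_near_def)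
    have "ord_ge (elim_const (z1 ^ 4) (z2 ^ 4)) (v + 8 * t)"
      by (rule elim_const_ge[OF z]) (use t v_nonneg in auto)
    then have y1t: "ord_ge y1 (v + 8 * t)" by (rule y1(1))
    \<comment> \<open>Here \<open>y2\<close> is bounded through the first equation, since the bound
      of \<open>second_equation_bound\<close> never exceeds 2/3.\<close>
    have "ord_ge (a21 * y2\<^sup>2) (v + 8 * t)"
    proof -
      have "ord_ge (y2_squared (z1 ^ 4) y1) (v + 8 * t)"
        unfolding y2_squared_def
      proof (intro ord_ge_add y1t)
        show "ord_ge (z1 ^ 4) (v + 8 * t)"
          by (rule ord_ge_mono[OF ord_ge_power[OF z(1)]]) (use v_nonneg in simp)
        show "ord_ge (a11 * y1\<^sup>2) (v + 8 * t)"
          by (rule ord_ge_mono[OF ord_ge_mult[OF ord_ge_coeffs(2) ord_ge_power[OF y1t]]])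
            (use t v_nonneg in simp)
        show "ord_ge (\<theta>\<^sup>2 * y1 ^ 4) (v + 8 * t)"
          by (rule ord_ge_mono[OF ord_ge_mult[OF ord_ge_power[OF ord_ge_coeffs(1)] ord_ge_power[OF y1t]]])
            (use t v_nonneg in simp)
      qed
      with sys show ?thesis by (simp add: coeff_system_iff)
    qed
    then have "ord_ge y2 (4 * t)"
      using a21_nz by (cases "y2 = 0") (simp_all add: ord_ge_iff rord_mult rord_power)
    with y1t show ?thesis by (simp add: very_near_def)
  qed
  with near sys that show thesis by blast
qed

lemma solution_sequence:
  assumes "coeff_system y1 y2 0 0"
  obtains s1 s2 where "s1 0 = y1" "s2 0 = y2"
    "\<And>n. coeff_system (s1 (Suc n)) (s2 (Suc n)) (s1 n ^ 4) (s2 n ^ 4)"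
    "(\<lambda>n. ord (s1 n)) \<longlonglongrightarrow> \<infinity>" "(\<lambda>n. ord (s2 n)) \<longlonglongrightarrow> \<infinity>"
proof -
  \<comment> \<open>When \<open>y1\<close> has bound \<open>v + 4/3\<close>, the uncapped bound on
    \<open>y2\<close> in \<open>near\<close> reaches 2/3, which starts the fast regime;
    \<open>N\<close> steps of size 1 suffice.\<close>
  obtain N :: nat where N: "v + 4/3 \<le> N" using real_arch_simple by blast
  define p where "p n = min (1/2 + real n) (7/3 + v)" for n
  \<comment> \<open>The last clause fixes the initial term, which dependent choice would otherwise
    leave arbitrary.\<close>
  define P where "P n z \<longleftrightarrow> near (p n) (fst z) (snd z)
      \<and> (N \<le> n \<longrightarrow> very_near (2/3 * 4 ^ (n - N)) (fst z) (snd z)) \<and> (n = 0 \<longrightarrow> z = (y1, y2))" for n z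
  have very_near_start: "very_near (2/3) z1 z2" if "near (p N) z1 z2" for z1 z2
  proof -
    have "v + 4/3 \<le> p N" using N unfolding p_def by simp
    moreover from this have "2/3 \<le> (p N - v) / 2" by simp
    ultimately
    show ?thesis
      using that unfolding near_def very_near_def by (auto elim!: ord_ge_mono)
  qed
  have "\<exists>s. \<forall>n. P n (s n) \<and> coeff_system (fst (s (Suc n))) (snd (s (Suc n))) (fst (s n) ^ 4) (snd (s n) ^ 4)"
  proof (rule dependent_nat_choice)
    have p0: "p 0 = 1/2" using v_nonneg by (simp add: p_def)
    have "near (p 0) y1 y2" unfolding near_def p0 using kernel_bounds[OF assms] by simp
    then have "P 0 (y1, y2)" using very_near_start by (auto simp: P_def)
    then show "\<exists>z. P 0 z" by blast
  next
    fix z n assume z: "P n z"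
    obtain x1 x2 where x: "coeff_system x1 x2 (fst z ^ 4) (snd z ^ 4)"
      "\<And>p. \<lbrakk>1/2 \<le> p; near p (fst z) (snd z)\<rbrakk> \<Longrightarrow> near (min (p + 1) (7/3 + v)) x1 x2"
      "\<And>t. \<lbrakk>2/3 \<le> t; very_near t (fst z) (snd z)\<rbrakk> \<Longrightarrow> very_near (4 * t) x1 x2"
      using improve_solution by blast
    have "1/2 \<le> p n" "min (p n + 1) (7/3 + v) = p (Suc n)"
      using v_nonneg by (auto simp: p_def min_def)
    with x(2)[of "p n"] z have nr: "near (p (Suc n)) x1 x2" by (simp add: P_def)
    have "very_near (2/3 * 4 ^ (Suc n - N)) x1 x2" if "N \<le> Suc n"
    proof (cases "N = Suc n")
      case True
      with nr very_near_start show ?thesis by simp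
    next
      case False
      then have "very_near (2/3 * 4 ^ (n - N)) (fst z) (snd z)" using z that by (simp add: P_def)
      moreover have "2/3 \<le> (2/3 * 4 ^ (n - N) :: real)" by simp
      ultimately have "very_near (4 * (2/3 * 4 ^ (n - N))) x1 x2" using x(3) by blast
      then show ?thesis using False that by (simp add: Suc_diff_le)
    qed
    with nr x(1) show "\<exists>y. P (Suc n) y \<and> coeff_system (fst y) (snd y) (fst z ^ 4) (snd z ^ 4)"
      by (intro exI[of _ "(x1, x2)"]) (simp add: P_def)
  qed
  then obtain s where s: "\<And>n. P n (s n)"
    "\<And>n. coeff_system (fst (s (Suc n))) (snd (s (Suc n))) (fst (s n) ^ 4) (snd (s n) ^ 4)" by blast
  have lim: "\<exists>M. \<forall>n\<ge>M. ord_ge (fst (s n)) r \<and> ord_ge (snd (s n)) r" for r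
  proof -
    obtain k where k: "r < 4 ^ k" using real_arch_pow[of 4 r] by auto
    have "ord_ge (fst (s n)) r \<and> ord_ge (snd (s n)) r" if n: "n \<ge> N + k + 1" for n
    proof -
      have "very_near (2/3 * 4 ^ (n - N)) (fst (s n)) (snd (s n))" using s(1)[of n] n by (simp add: P_def)
      moreover have "r \<le> 2/3 * 4 ^ (n - N)"
      proof -
        have "(4::real) ^ (k + 1) \<le> 4 ^ (n - N)" using n by (intro power_increasing) auto
        moreover have "(4::real) ^ (k + 1) = 4 * 4 ^ k" "0 < (4::real) ^ (n - N)" by simp_all
        ultimately show ?thesis using k by linarith
      qed
      moreover have "2/3 * 4 ^ (n - N) \<le> v + 2 * (2/3 * 4 ^ (n - N))" using v_nonneg by simp
      ultimately show ?thesis unfolding very_near_def by (meson ord_ge_mono order_trans)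
    qed
    then show ?thesis by blast
  qed
  show thesis
  proof (rule that[of "fst \<circ> s" "snd \<circ> s"])
    show "(\<lambda>n. ord ((fst \<circ> s) n)) \<longlonglongrightarrow> \<infinity>" "(\<lambda>n. ord ((snd \<circ> s) n)) \<longlonglongrightarrow> \<infinity>"
      unfolding tendsto_infinity_iff comp_def using lim by meson+
  qed (use s in \<open>auto simp: P_def\<close>)
qed

end

section \<open>Filtered modules over \<open>F\<^sub>2[T]\<close>\<close>

lemma card_UNIV_bit: "card (UNIV :: bit set) = 2"
proof -
  have "(UNIV :: bit set) = {0, 1}" by (auto intro: bit_not_zero_iff[THEN iffD1])
  then have "card (UNIV :: bit set) = card {0, 1 :: bit}" by (rule arg_cong)
  also have "\<dots> = 2" by (subst card_insert_disjoint) auto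
  finally show ?thesis .
qed

text \<open>Models H^1 as \<open>S\<close>, with \<open>res\<close> as reduction modulo T.
  \<open>Fil_T\<close> and \<open>Fil_0\<close> make repeated division by T terminate;
  \<open>act\<close> is pinned down by Horner's rule alone.\<close>

locale filtered_F2_T_module =
  fixes act :: "bit poly \<Rightarrow> 'z::ab_group_add \<Rightarrow> 'z" and T :: "'z \<Rightarrow> 'z" and S :: "'z set"
    and res :: "'z \<Rightarrow> 'w::ab_group_add" and Fil :: "nat \<Rightarrow> 'z set"
  assumes double_z: "z + z = (0::'z)" and double_w: "w + w = (0::'w)"
    and act_0: "act 0 z = 0"
    and act_pCons: "act (pCons a p) z = (if a = 0 then 0 else z) + T (act p z)"
    and T_add: "T (y + z) = T y + T z"
    and T_inj: "T z = 0 \<Longrightarrow> z = 0"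
    and S_0: "0 \<in> S" and S_add: "\<lbrakk>y \<in> S; z \<in> S\<rbrakk> \<Longrightarrow> y + z \<in> S" and S_T: "z \<in> S \<Longrightarrow> T z \<in> S"
    and res_add: "res (y + z) = res y + res z"
    and res_T: "res (T z) = 0"
    and res_eq_0: "\<lbrakk>z \<in> S; res z = 0\<rbrakk> \<Longrightarrow> \<exists>y\<in>S. z = T y"
    and finite_res: "finite (res ` S)"
    and Fil_0: "Fil 0 = {0}"
    and Fil_S: "Fil d \<subseteq> S"
    and Fil_add: "\<lbrakk>y \<in> Fil d; z \<in> Fil d\<rbrakk> \<Longrightarrow> y + z \<in> Fil d"
    and Fil_Suc: "Fil d \<subseteq> Fil (Suc d)"
    and Fil_T: "\<lbrakk>y \<in> S; T y \<in> Fil (Suc d)\<rbrakk> \<Longrightarrow> y \<in> Fil d"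
    and Fil_exhaust: "z \<in> S \<Longrightarrow> \<exists>d. z \<in> Fil d"
begin

definition is_basis :: "'z set \<Rightarrow> bool" where
  "is_basis B \<longleftrightarrow> finite B \<and> B \<subseteq> S \<and>
     (\<forall>z\<in>S. \<exists>!c. c \<in> B \<rightarrow>\<^sub>E UNIV \<and> z = (\<Sum>b\<in>B. act (c b) b))"

text \<open>Turns the residues into a vector space over F_2, so that spans and independent sets are
  available for them.\<close>

definition bit_scale :: "bit \<Rightarrow> 'w \<Rightarrow> 'w" where
  "bit_scale a w = (if a = 0 then 0 else w)"

abbreviation bit_scale_z :: "bit \<Rightarrow> 'z \<Rightarrow> 'z" where
  "bit_scale_z a z \<equiv> (if a = 0 then 0 else z)"

interpretation W: vector_space bit_scale
  by unfold_locales (auto simp: bit_scale_def double_w)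

lemma T_0: "T 0 = 0"
  using T_add[of 0 0] by simp

lemma res_0: "res 0 = 0"
  using res_add[of 0 0] by simp

lemma T_sum: "T (sum f A) = (\<Sum>x\<in>A. T (f x))"
  by (induction A rule: infinite_finite_induct) (simp_all add: T_0 T_add)

lemma res_sum: "res (sum f A) = (\<Sum>x\<in>A. res (f x))"
  by (induction A rule: infinite_finite_induct) (simp_all add: res_0 res_add)

lemma res_bit_scale: "res (bit_scale_z a z) = bit_scale a (res z)"
  by (simp add: bit_scale_def res_0)

lemma S_sum: "(\<And>x. x \<in> A \<Longrightarrow> f x \<in> S) \<Longrightarrow> sum f A \<in> S"
  by (induction A rule: infinite_finite_induct) (simp_all add: S_0 S_add)

lemma zero_in_Fil: "0 \<in> Fil d"
  using Fil_Suc by (induction d) (auto simp: Fil_0)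

lemma Fil_sum: "(\<And>x. x \<in> A \<Longrightarrow> f x \<in> Fil d) \<Longrightarrow> sum f A \<in> Fil d"
  by (induction A rule: infinite_finite_induct) (simp_all add: zero_in_Fil Fil_add)

lemma Fil_mono: "d \<le> e \<Longrightarrow> Fil d \<subseteq> Fil e"
  by (rule lift_Suc_mono_le[of Fil, OF Fil_Suc])

lemma bit_scale_z_add: "bit_scale_z (a + b) z = bit_scale_z a z + bit_scale_z b z"
  by (cases a; cases b) (auto simp: double_z)

lemma act_add: "act (p + q) z = act p z + act q z"
proof (induction p q rule: poly_induct2)
  case (pCons a p b q)
  show ?case
    unfolding add_pCons act_pCons bit_scale_z_add pCons T_add by (simp add: ac_simps)
qed (simp add: act_0)

section \<open>Size and existence of bases\<close>

lemma sum_act_pCons: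
  "(\<Sum>b\<in>B. act (pCons (a b) (f b)) b) = (\<Sum>b\<in>B. bit_scale_z (a b) b) + T (\<Sum>b\<in>B. act (f b) b)"
  by (simp add: act_pCons sum.distrib T_sum)

lemma eq_add_of_double: "z + y = x \<Longrightarrow> z = y + (x::'z)"
  using double_z[of y] by (metis add.commute add.left_commute add_0_right)

text \<open>The residues are matched with the combinations of \<open>B\<close> with coefficients 0
  and 1. If two of these had the same residue, their sum would be T y, and expanding y in
  \<open>B\<close> would give one element two expansions with different constant terms. Conversely,
  the constant terms of an expansion alone give the residue.\<close>

theorem card_of_basis:
  assumes "is_basis B"
  shows "card (res ` S) = 2 ^ card B"
proof -
  from assms have fin: "finite B" and BS: "B \<subseteq> S"
    and uniq: "\<And>z. z \<in> S \<Longrightarrow> \<exists>!c. c \<in> B \<rightarrow>\<^sub>E UNIV \<and> z = (\<Sum>b\<in>B. act (c b) b)"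
    by (auto simp: is_basis_def)
  define h where "h c = res (\<Sum>b\<in>B. bit_scale_z (c b) b)" for c :: "'z \<Rightarrow> bit"
  have inS: "(\<Sum>b\<in>B. bit_scale_z (c b) b) \<in> S" for c
    by (rule S_sum) (use BS S_0 in auto)
  have "inj_on h (B \<rightarrow>\<^sub>E UNIV)"
  proof (rule inj_onI)
    fix c c' :: "'z \<Rightarrow> bit"
    assume c: "c \<in> B \<rightarrow>\<^sub>E UNIV" "c' \<in> B \<rightarrow>\<^sub>E UNIV" and "h c = h c'"
    then have "res ((\<Sum>b\<in>B. bit_scale_z (c b) b) + (\<Sum>b\<in>B. bit_scale_z (c' b) b)) = 0"
      unfolding h_def res_add by (simp add: double_w)
    then obtain y where y: "y \<in> S"
      "(\<Sum>b\<in>B. bit_scale_z (c b) b) + (\<Sum>b\<in>B. bit_scale_z (c' b) b) = T y"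
      using res_eq_0[OF S_add[OF inS inS]] by blast
    obtain f where f: "y = (\<Sum>b\<in>B. act (f b) b)" using uniq[OF y(1)] by blast
    define z where "z = (\<Sum>b\<in>B. bit_scale_z (c b) b)"
    have z1: "z = (\<Sum>b\<in>B. act (pCons (c b) 0) b)"
      unfolding z_def sum_act_pCons by (simp add: act_0 T_0)
    have z2: "z = (\<Sum>b\<in>B. act (pCons (c' b) (f b)) b)"
      unfolding z_def sum_act_pCons f[symmetric] by (rule eq_add_of_double[OF y(2)])
    let ?r1 = "restrict (\<lambda>b. pCons (c b) 0) B" and ?r2 = "restrict (\<lambda>b. pCons (c' b) (f b)) B"
    have "z \<in> S" unfolding z_def by (rule inS)
    moreover have "z = (\<Sum>b\<in>B. act (?r1 b) b)" unfolding z1 by (rule sum.cong) auto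
    moreover have "z = (\<Sum>b\<in>B. act (?r2 b) b)" unfolding z2 by (rule sum.cong) auto
    moreover have "?r1 \<in> B \<rightarrow>\<^sub>E UNIV" "?r2 \<in> B \<rightarrow>\<^sub>E UNIV" by auto
    ultimately have "?r1 = ?r2" using uniq by blast
    then have "c b = c' b" if "b \<in> B" for b
      using that by (metis (no_types, lifting) pCons_eq_iff restrict_apply')
    with c show "c = c'" by (intro PiE_ext)
  qed
  moreover have "h ` (B \<rightarrow>\<^sub>E UNIV) = res ` S"
  proof (intro equalityI subsetI)
    fix w assume "w \<in> res ` S"
    then obtain z where z: "z \<in> S" "w = res z" by blast
    obtain c where c: "z = (\<Sum>b\<in>B. act (c b) b)" using uniq[OF z(1)] by blast
    define a where "a b = coeff (c b) 0" for b
    have "c b = pCons (a b) (poly_shift 1 (c b))" for b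
      by (simp add: poly_eq_iff coeff_pCons coeff_poly_shift a_def split: nat.split)
    then have "z = (\<Sum>b\<in>B. act (pCons (a b) (poly_shift 1 (c b))) b)" using c by simp
    then have "w = h a" unfolding z(2) h_def sum_act_pCons by (simp add: res_add res_T)
    also have "\<dots> = h (restrict a B)" unfolding h_def by (intro arg_cong[of _ _ res] sum.cong) auto
    finally show "w \<in> h ` (B \<rightarrow>\<^sub>E UNIV)" by auto
  qed (use inS in \<open>auto simp: h_def\<close>)
  ultimately have "card (res ` S) = card (B \<rightarrow>\<^sub>E (UNIV :: bit set))"
    by (metis card_image)
  also have "\<dots> = 2 ^ card B"
    using fin by (simp add: card_PiE card_UNIV_bit)
  finally show ?thesis .
qed

text \<open>Extending an independent set through one level at a time lets the generators inside
  \<open>Fil e\<close> account for all residues of \<open>Fil e\<close>, so that matching a residue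
  never leaves the level.\<close>

lemma adapted_lifts:
  "\<exists>G \<subseteq> Fil d. finite G \<and> inj_on res G \<and> W.independent (res ` G) \<and>
     (\<forall>e\<le>d. res ` Fil e \<subseteq> W.span (res ` (G \<inter> Fil e)))"
proof (induction d)
  case 0
  show ?case by (rule exI[of _ "{}"]) (auto simp: Fil_0 res_0 W.independent_empty)
next
  case (Suc d)
  then obtain G where G: "G \<subseteq> Fil d" "finite G" "inj_on res G" "W.independent (res ` G)"
    "\<forall>e\<le>d. res ` Fil e \<subseteq> W.span (res ` (G \<inter> Fil e))" by blast
  have "res ` G \<subseteq> res ` Fil (Suc d)" using G(1) Fil_Suc by blast
  then obtain B where B: "res ` G \<subseteq> B" "B \<subseteq> res ` Fil (Suc d)" "W.independent B"
      "res ` Fil (Suc d) \<subseteq> W.span B"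
    using W.maximal_independent_subset_extend[OF _ G(4)] by blast
  define l where "l w = (SOME z. z \<in> Fil (Suc d) \<and> res z = w)" for w
  have l: "l w \<in> Fil (Suc d) \<and> res (l w) = w" if "w \<in> B" for w
    unfolding l_def by (rule someI_ex) (use that B in blast)
  define G' where "G' = G \<union> l ` (B - res ` G)"
  have GF: "G' \<subseteq> Fil (Suc d)" using G(1) Fil_Suc l by (auto simp: G'_def)
  have rG: "res ` G' = B" using B(1) l by (force simp: G'_def image_Un image_image)
  have finB: "finite B" using finite_res B(2) Fil_S by (meson finite_subset image_mono order_trans)
  have "finite G'" using G(2) finB by (simp add: G'_def)
  moreover have "inj_on res G'"
  proof -
    have "inj_on (res \<circ> l) (B - res ` G)"
      by (rule inj_onI) (metis DiffD1 comp_apply l)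
    then have "inj_on res (l ` (B - res ` G))" by (rule inj_on_imageI)
    moreover have "res ` G \<inter> res ` l ` (B - res ` G) = {}" using l by fastforce
    ultimately show ?thesis unfolding G'_def inj_on_Un using G(3) by blast
  qed
  moreover have "res ` Fil e \<subseteq> W.span (res ` (G' \<inter> Fil e))" if "e \<le> Suc d" for e
  proof (cases "e = Suc d")
    case True
    then have "G' \<inter> Fil e = G'" using GF by auto
    with True B(4) rG show ?thesis by simp
  next
    case False
    then have "res ` Fil e \<subseteq> W.span (res ` (G \<inter> Fil e))" using G(5) that by simp
    also have "\<dots> \<subseteq> W.span (res ` (G' \<inter> Fil e))" by (rule W.span_mono) (auto simp: G'_def)
    finally show ?thesis .
  qed
  ultimately show ?case using GF B(3) rG by (intro exI[of _ G']) auto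
qed

text \<open>Generation is by induction on the level: cancel the residue by generators of the same
  level, divide by T, and land one level lower. Independence follows by repeatedly dividing a
  relation by T.\<close>

theorem basis_exists: "\<exists>B. is_basis B"
proof -
  define deg where "deg w = (LEAST d. \<exists>z\<in>Fil d. res z = w)" for w
  have deg: "\<exists>z\<in>Fil (deg w). res z = w" if w: "w \<in> res ` S" for w
  proof -
    have "\<exists>d. \<exists>z\<in>Fil d. res z = w" using w Fil_exhaust by blast
    then show ?thesis unfolding deg_def by (rule LeastI_ex)
  qed
  \<comment> \<open>There are finitely many residues, so one level realises them all.\<close>
  define D where "D = Max (deg ` res ` S)"
  have D: "res ` S \<subseteq> res ` Fil D"
  proof
    fix w assume w: "w \<in> res ` S"
    then have "deg w \<le> D" unfolding D_def using finite_res by (intro Max_ge) auto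
    with deg[OF w] Fil_mono show "w \<in> res ` Fil D" by blast
  qed
  obtain G where G: "G \<subseteq> Fil D" "finite G" "inj_on res G" "W.independent (res ` G)"
    "\<forall>e\<le>D. res ` Fil e \<subseteq> W.span (res ` (G \<inter> Fil e))"
    using adapted_lifts[of D] by (elim exE conjE) (rule that)
  have GS: "G \<subseteq> S" using G(1) Fil_S by blast
  have span: "res ` Fil e \<subseteq> W.span (res ` (G \<inter> Fil e))" for e
  proof (cases "e \<le> D")
    case False
    then have "G \<inter> Fil e = G \<inter> Fil D" using G(1) Fil_mono[of D e] by auto
    moreover have "res ` Fil e \<subseteq> res ` Fil D" using Fil_S D by blast
    ultimately show ?thesis using G(5) by (metis order_refl order_trans)
  qed (use G in blast)
  have gen: "\<exists>c. z = (\<Sum>g\<in>G. act (c g) g)" if "z \<in> Fil e" for e z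
    using that
  proof (induction e arbitrary: z)
    case 0
    then show ?case by (intro exI[of _ "\<lambda>_. 0"]) (simp add: Fil_0 act_0)
  next
    case (Suc e)
    define H where "H = G \<inter> Fil (Suc e)"
    have H: "finite H" "inj_on res H" "H \<subseteq> G" "H \<subseteq> Fil (Suc e)"
      using G unfolding H_def by (auto intro: inj_on_subset)
    have "res z \<in> W.span (res ` H)" using span Suc.prems unfolding H_def by blast
    then obtain k where "res z = (\<Sum>w\<in>res ` H. bit_scale (k w) w)"
      unfolding W.span_finite[OF finite_imageI[OF H(1)]] by blast
    also have "\<dots> = (\<Sum>g\<in>H. bit_scale (k (res g)) (res g))"
      using H(2) by (simp add: sum.reindex)
    finally have rz: "res z = (\<Sum>g\<in>H. bit_scale (k (res g)) (res g))" .
    define a where "a g = (if g \<in> H then k (res g) else 0)" for g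
    have "(\<Sum>g\<in>H. bit_scale_z (k (res g)) g) = (\<Sum>g\<in>H. bit_scale_z (a g) g)"
      by (rule sum.cong) (auto simp: a_def)
    also have "\<dots> = (\<Sum>g\<in>G. bit_scale_z (a g) g)"
      by (rule sum.mono_neutral_left) (use G H in \<open>auto simp: a_def\<close>)
    finally have aH: "(\<Sum>g\<in>H. bit_scale_z (k (res g)) g) = (\<Sum>g\<in>G. bit_scale_z (a g) g)" .
    have zF: "z + (\<Sum>g\<in>H. bit_scale_z (k (res g)) g) \<in> Fil (Suc e)"
      by (intro Fil_add Fil_sum) (use Suc.prems H zero_in_Fil in auto)
    have "res (z + (\<Sum>g\<in>H. bit_scale_z (k (res g)) g)) = 0"
      unfolding res_add res_sum res_bit_scale rz by (rule double_w)
    with zF obtain y where y: "y \<in> S" "z + (\<Sum>g\<in>H. bit_scale_z (k (res g)) g) = T y"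
      using res_eq_0 Fil_S by blast
    with zF have "y \<in> Fil e" using Fil_T by metis
    with Suc.IH obtain c where c: "y = (\<Sum>g\<in>G. act (c g) g)" by blast
    have "z = (\<Sum>g\<in>G. act (pCons (a g) (c g)) g)"
      unfolding sum_act_pCons c[symmetric] aH[symmetric] by (rule eq_add_of_double[OF y(2)])
    then show ?case by (rule exI[of _ "\<lambda>g. pCons (a g) (c g)"])
  qed
  \<comment> \<open>The induction is on a common bound \<open>n\<close> for the lengths of the
    coefficients, as each division by T removes the constant terms.\<close>
  have indep: "\<forall>g\<in>G. c g = 0"
    if "(\<Sum>g\<in>G. act (c g) g) = 0" "\<forall>g\<in>G. \<forall>i\<ge>n. coeff (c g) i = 0" for c n
    using that
  proof (induction n arbitrary: c)
    case 0
    then show ?case by (simp add: poly_eq_iff)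
  next
    case (Suc n)
    define a where "a g = coeff (c g) 0" for g
    define c' where "c' g = poly_shift 1 (c g)" for g
    have cc: "c g = pCons (a g) (c' g)" for g
      by (simp add: poly_eq_iff coeff_pCons coeff_poly_shift a_def c'_def split: nat.split)
    have s: "(\<Sum>g\<in>G. bit_scale_z (a g) g) + T (\<Sum>g\<in>G. act (c' g) g) = 0"
      using Suc.prems(1) unfolding cc sum_act_pCons .
    then have "res (\<Sum>g\<in>G. bit_scale_z (a g) g) = 0"
      using arg_cong[OF s, of res] unfolding res_add res_T res_0 by simp
    then have "(\<Sum>g\<in>G. bit_scale (a g) (res g)) = 0" by (simp only: res_sum res_bit_scale)
    then have "(\<Sum>w\<in>res ` G. bit_scale (a (the_inv_into G res w)) w) = 0"
      using G(3) by (simp add: sum.reindex the_inv_into_f_f)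
    from W.independentD[OF G(4) finite_imageI[OF G(2)] order_refl this]
    have "\<forall>w\<in>res ` G. a (the_inv_into G res w) = 0" by blast
    then have a0: "\<forall>g\<in>G. a g = 0" using G(3) by (simp add: the_inv_into_f_f)
    then have "(\<Sum>g\<in>G. bit_scale_z (a g) g) = 0" by (simp cong: sum.cong)
    with s have "(\<Sum>g\<in>G. act (c' g) g) = 0" using T_inj by simp
    moreover have "\<forall>g\<in>G. \<forall>i\<ge>n. coeff (c' g) i = 0"
      using Suc.prems(2) by (simp add: c'_def coeff_poly_shift)
    ultimately have "\<forall>g\<in>G. c' g = 0" by (rule Suc.IH)
    with a0 cc show ?case by simp
  qed
  have "is_basis G"
    unfolding is_basis_def
  proof (intro conjI ballI G(2) GS)
    fix z assume "z \<in> S"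
    then obtain c where c: "z = (\<Sum>g\<in>G. act (c g) g)" using gen Fil_exhaust by blast
    show "\<exists>!c. c \<in> G \<rightarrow>\<^sub>E UNIV \<and> z = (\<Sum>b\<in>G. act (c b) b)"
    proof (rule ex1I[of _ "restrict c G"])
      show "restrict c G \<in> G \<rightarrow>\<^sub>E UNIV \<and> z = (\<Sum>b\<in>G. act (restrict c G b) b)"
        using c by (auto intro: sum.cong)
      fix c' assume c': "c' \<in> G \<rightarrow>\<^sub>E UNIV \<and> z = (\<Sum>b\<in>G. act (c' b) b)"
      define f where "f g = c' g - c g" for g
      have "act (c' g) g = act (f g) g + act (c g) g" for g
        using act_add[of "f g" "c g" g] by (simp add: f_def)
      then have "(\<Sum>b\<in>G. act (c' b) b) = (\<Sum>b\<in>G. act (f b) b) + (\<Sum>b\<in>G. act (c b) b)"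
        by (simp only: sum.distrib)
      with c c' have s0: "(\<Sum>b\<in>G. act (f b) b) = 0" by (metis add_cancel_left_left)
      obtain n where "\<forall>g\<in>G. degree (f g) < n"
      proof
        show "\<forall>g\<in>G. degree (f g) < Suc (Max (insert 0 ((\<lambda>g. degree (f g)) ` G)))"
          using G(2) by (auto simp: less_Suc_eq_le intro!: Max_ge)
      qed
      then have "\<forall>g\<in>G. \<forall>i\<ge>n. coeff (f g) i = 0" by (meson coeff_eq_0 less_le_trans)
      with s0 have f0: "\<forall>g\<in>G. f g = 0" by (rule indep)
      show "c' = restrict c G"
      proof (rule PiE_ext[of c' G "\<lambda>_. UNIV"])
        show "c' \<in> G \<rightarrow>\<^sub>E UNIV" using c' by blast
        show "restrict c G \<in> G \<rightarrow>\<^sub>E UNIV" by auto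
        fix g assume "g \<in> G"
        with f0 show "c' g = restrict c G g" by (simp add: f_def)
      qed
    qed
  qed
  then show ?thesis by blast
qed

end

section \<open>Coordinates on the motive\<close>

type_synonym 'a coords = "('a fps^2) \<times> ('a fps^2)"

locale t_motive_coordinates = C_infinity ord \<theta> for ord :: "'a::field \<Rightarrow> ereal" and \<theta> +
  fixes A :: "'a^2^2"
begin

definition frob :: "'a fps \<Rightarrow> 'a fps" where
  "frob f = Abs_fps (\<lambda>i. (fps_nth f i)\<^sup>2)"

lemma fps_nth_frob [simp]: "fps_nth (frob f) n = (fps_nth f n)\<^sup>2"
  by (simp add: frob_def)

lemma frob_add: "frob (f + g) = frob f + frob g"
  by (simp add: fps_eq_iff char_two_square_add char_two)

lemma frob_mult: "frob (f * g) = frob f * frob g"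
  by (simp add: fps_eq_iff fps_mult_nth char_two_square_sum char_two power_mult_distrib)

lemma frob_simps [simp]: "frob 0 = 0" "frob 1 = 1" "frob fps_X = fps_X"
  "frob (fps_const a) = fps_const (a\<^sup>2)"
  by (simp_all add: fps_eq_iff)

lemma frob_power_const: "(frob ^^ n) (fps_const a) = fps_const (a ^ 2 ^ n)"
  by (induction n) (simp_all add: mult.commute flip: power_mult)

lemma frob_power_X: "(frob ^^ n) fps_X = fps_X"
  by (induction n) simp_all

lemma two_eq_0 [simp]: "(2 :: 'a) = 0" "(2 :: 'a fps) = 0" "(2 :: 'a poly) = 0"
proof -
  show 2: "(2 :: 'a) = 0" using add_self[of 1] unfolding one_add_one .
  have "(2 :: 'a fps) = fps_const 2" by (metis numeral_fps_const)
  then show "(2 :: 'a fps) = 0" by (simp add: 2)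
  have "(2 :: 'a poly) = [:2:]" by (metis numeral_poly)
  then show "(2 :: 'a poly) = 0" by (simp add: 2)
qed

section \<open>Semilinear operators on coordinates\<close>

definition scale :: "'a fps \<Rightarrow> 'a coords \<Rightarrow> 'a coords" where
  "scale f z = (\<chi> j. f * fst z $ j, \<chi> j. f * snd z $ j)"

lemma scale_simps:
  "scale f (y + z) = scale f y + scale f z" "scale (f + g) z = scale f z + scale g z"
  "scale f (scale g z) = scale (f * g) z" "scale 1 z = z" "scale 0 z = 0" "scale f 0 = 0"
  by (simp_all add: scale_def prod_eq_iff vec_eq_iff distrib_left distrib_right mult.assoc)

lemma scale_sum: "scale f (sum h B) = (\<Sum>x\<in>B. scale f (h x))"
  by (induction B rule: infinite_finite_induct) (simp_all add: scale_simps)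

lemma add_self_z: "z + z = (0 :: 'a coords)"
  by (simp add: prod_eq_iff vec_eq_iff)

lemma minus_z: "y - z = y + (z :: 'a coords)"
  unfolding diff_conv_add_uminus minus_unique[OF add_self_z] ..

text \<open>
  A pair \<open>(x, y)\<close> stands for \<open>\<Sum>\<^sub>j x\<^sub>j e\<^sub>j + y\<^sub>j \<tau> e\<^sub>j\<close>, and \<open>coord_tau\<close> is \<open>\<tau>\<close> in these coordinates: by the
  formula for \<open>T e\<^sub>j\<close>, \<open>\<tau>\<^sup>2 e\<^sub>j = (T + \<theta>) e\<^sub>j + \<Sum>\<^sub>k A\<^sub>j\<^sub>k \<tau> e\<^sub>k\<close>, with signs omitted as the characteristic is 2.
\<close>
definition coord_tau :: "'a coords \<Rightarrow> 'a coords" where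
  "coord_tau z = (\<chi> j. (fps_X + fps_const \<theta>) * frob (snd z $ j),
     \<chi> j. frob (fst z $ j) + (\<Sum>i\<in>UNIV. fps_const (A $ i $ j) * frob (snd z $ i)))"

lemma coord_tau_add: "coord_tau (y + z) = coord_tau y + coord_tau z"
  by (simp add: coord_tau_def prod_eq_iff vec_eq_iff frob_add distrib_left sum.distrib ac_simps)

lemma coord_tau_0: "coord_tau 0 = 0"
  by (simp add: coord_tau_def prod_eq_iff vec_eq_iff)

lemma coord_tau_scale: "coord_tau (scale f z) = scale (frob f) (coord_tau z)"
  by (simp add: coord_tau_def scale_def prod_eq_iff vec_eq_iff frob_mult distrib_left
      sum_distrib_left ac_simps)

lemma coord_tau_power_add: "(coord_tau ^^ n) (y + z) = (coord_tau ^^ n) y + (coord_tau ^^ n) z"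
  by (induction n) (simp_all add: coord_tau_add)

lemma coord_tau_power_0: "(coord_tau ^^ n) 0 = 0"
  by (induction n) (simp_all add: coord_tau_0)

lemma coord_tau_power_sum: "(coord_tau ^^ n) (sum h B) = (\<Sum>x\<in>B. (coord_tau ^^ n) (h x))"
  by (induction B rule: infinite_finite_induct)
    (simp_all add: coord_tau_power_add coord_tau_power_0)

lemma coord_tau_power_scale:
  "(coord_tau ^^ n) (scale f z) = scale ((frob ^^ n) f) ((coord_tau ^^ n) z)"
  by (induction n) (simp_all add: coord_tau_scale)

text \<open>The action of \<open>p\<close> as a skew polynomial, with \<open>coord_tau\<close> in
  the role of tau.\<close>

definition ev :: "'a poly \<Rightarrow> 'a coords \<Rightarrow> 'a coords" where
  "ev p z = (\<Sum>n\<le>degree p. scale (fps_const (coeff p n)) ((coord_tau ^^ n) z))"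

lemma ev_bound:
  "degree p \<le> N \<Longrightarrow> ev p z = (\<Sum>n\<le>N. scale (fps_const (coeff p n)) ((coord_tau ^^ n) z))"
  unfolding ev_def by (rule sum.mono_neutral_left) (auto simp: coeff_eq_0 scale_simps)

lemma ev_add: "ev (p + q) z = ev p z + ev q z"
proof -
  define N where "N = max (degree p) (degree q)"
  have "degree p \<le> N" "degree q \<le> N" "degree (p + q) \<le> N"
    unfolding N_def by (auto intro: degree_add_le_max)
  then show ?thesis by (simp add: ev_bound sum.distrib scale_simps flip: fps_const_add)
qed

lemma ev_0: "ev 0 z = 0"
  by (simp add: ev_def scale_simps)

lemma ev_sum: "ev (sum h B) z = (\<Sum>x\<in>B. ev (h x) z)"
  by (induction B rule: infinite_finite_induct) (simp_all add: ev_add ev_0)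

lemma ev_monom: "ev (monom a n) z = scale (fps_const a) ((coord_tau ^^ n) z)"
proof -
  have "ev (monom a n) z = (\<Sum>k\<le>n. scale (fps_const (coeff (monom a n) k)) ((coord_tau ^^ k) z))"
    by (rule ev_bound) (rule degree_monom_le)
  also have "\<dots> = (\<Sum>k\<le>n. if k = n then scale (fps_const a) ((coord_tau ^^ n) z) else 0)"
    by (rule sum.cong) (auto simp: scale_simps)
  finally show ?thesis by simp
qed

lemma ev_smult: "ev (Polynomial.smult a p) z = scale (fps_const a) (ev p z)"
proof -
  have "ev (Polynomial.smult a p) z
      = (\<Sum>n\<le>degree p. scale (fps_const (coeff (Polynomial.smult a p) n)) ((coord_tau ^^ n) z))"
    by (rule ev_bound) (rule degree_smult_le)
  then show ?thesis by (simp add: ev_def scale_sum scale_simps)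
qed

lemma ev_sum_right: "ev p (sum h B) = (\<Sum>x\<in>B. ev p (h x))"
  by (simp add: ev_def coord_tau_power_sum scale_sum) (rule sum.swap)

lemma ev_scale_X: "ev p (scale fps_X z) = scale fps_X (ev p z)"
  by (simp add: ev_def coord_tau_power_scale frob_power_X scale_sum scale_simps mult.commute)

text \<open>Moving \<open>coord_tau ^^ i\<close> past a scalar raises it to the power
  \<open>2 ^ i\<close>, which is the twist in the skew product.\<close>

lemma ev_skew_times: "ev (skew_times p r) z = ev p (ev r z)"
proof -
  have "ev (skew_times p r) z = (\<Sum>i\<le>degree p. \<Sum>j\<le>degree r.
      scale (fps_const (coeff p i * coeff r j ^ 2 ^ i)) ((coord_tau ^^ (i + j)) z))"
    by (simp add: skew_times_def ev_sum ev_monom)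
  also have "\<dots> = ev p (ev r z)"
    by (simp add: ev_def coord_tau_power_sum coord_tau_power_scale frob_power_const scale_sum
        scale_simps funpow_add)
  finally show ?thesis .
qed

definition E :: "2 \<Rightarrow> 'a coords" where "E j = (axis j 1, 0)"

lemma coord_tau_E: "coord_tau (E k) = (0, axis k 1)"
  by (auto simp: coord_tau_def E_def prod_eq_iff vec_eq_iff axis_def)

text \<open>This is the formula for T applied to a basis vector, read in coordinates;
  \<open>coord_tau\<close> was designed to make T act as multiplication by
  \<open>fps_X\<close>.\<close>

lemma ev_motive_T_coeff: "(\<Sum>k\<in>UNIV. ev (motive_T_coeff \<theta> A $ j $ k) (E k)) = scale fps_X (E j)"
proof -
  have tt: "coord_tau (coord_tau (E k))
      = (\<chi> i. if i = k then fps_X + fps_const \<theta> else 0, \<chi> i. fps_const (A $ k $ i))" for k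
    unfolding coord_tau_E by (auto simp: coord_tau_def prod_eq_iff vec_eq_iff axis_def
        if_distrib[of frob] if_distrib[of "(*) _"] cong: if_cong)
  have "ev (motive_T_coeff \<theta> A $ j $ k) (E k) = scale (fps_const (A $ j $ k)) (0, axis k 1)
      + (if k = j then scale (fps_const \<theta>) (E j) + coord_tau (coord_tau (E j)) else 0)" for k
    by (simp add: motive_T_coeff_def ev_add ev_monom ev_0 coord_tau_E numeral_2_eq_2 scale_simps
        ac_simps flip: monom_0)
  then have "(\<Sum>k\<in>UNIV. ev (motive_T_coeff \<theta> A $ j $ k) (E k))
      = (\<Sum>k\<in>UNIV. scale (fps_const (A $ j $ k)) (0, axis k 1))
        + (scale (fps_const \<theta>) (E j) + coord_tau (coord_tau (E j)))"
    by (simp add: sum.distrib)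
  also have "(\<Sum>k\<in>UNIV. scale (fps_const (A $ j $ k)) (0, axis k 1)) = (0, \<chi> i. fps_const (A $ j $ i))"
    unfolding sum_2 by (simp add: scale_def prod_eq_iff vec_eq_iff axis_def forall_2)
  also have "\<dots> + (scale (fps_const \<theta>) (E j) + coord_tau (coord_tau (E j))) = scale fps_X (E j)"
    unfolding tt by (auto simp: scale_def E_def prod_eq_iff vec_eq_iff axis_def
        algebra_simps)
  finally show ?thesis .
qed

definition coord :: "'a poly^2 \<Rightarrow> 'a coords" where
  "coord m = (\<Sum>j\<in>UNIV. ev (m $ j) (E j))"

lemma coord_add: "coord (m + n) = coord m + coord n"
  by (simp add: coord_def ev_add sum.distrib)

lemma coord_vec_scale: "coord (vec_scale a m) = scale (fps_const a) (coord m)"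
  by (simp add: coord_def vec_scale_def ev_smult scale_sum)

lemma coord_motive_T: "coord (motive_T \<theta> A m) = scale fps_X (coord m)"
proof -
  have "coord (motive_T \<theta> A m) = (\<Sum>k\<in>UNIV. \<Sum>j\<in>UNIV. ev (m $ j) (ev (motive_T_coeff \<theta> A $ j $ k) (E k)))"
    by (simp add: coord_def motive_T_def ev_sum ev_skew_times)
  also have "\<dots> = (\<Sum>j\<in>UNIV. ev (m $ j) (\<Sum>k\<in>UNIV. ev (motive_T_coeff \<theta> A $ j $ k) (E k)))"
    by (subst sum.swap) (simp add: ev_sum_right)
  finally show ?thesis by (simp add: ev_motive_T_coeff ev_scale_X coord_def scale_sum)
qed

lemma coord_smult: "coord (p \<odot>\<^bsub>t_motive \<theta> A\<^esub> m) = scale (fps_of_poly p) (coord m)"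
proof (induction p)
  case 0
  have "coord 0 = 0" by (simp add: coord_def ev_0)
  then show ?case by (simp add: t_motive_smult_0 scale_simps)
next
  case (pCons a p)
  then show ?case
    by (simp add: t_motive_smult_pCons coord_add coord_vec_scale coord_motive_T scale_simps
        fps_of_poly_pCons mult.commute)
qed

lemma coord_vec_tau: "coord (vec_tau m) = coord_tau (coord m)"
proof -
  have "ev (poly_tau p) z = coord_tau (ev p z)" for p z
    unfolding poly_tau_def ev_skew_times by (simp add: ev_monom scale_simps flip: fps_const_1_eq_1)
      (simp add: scale_simps)
  then show ?thesis
    by (simp add: coord_def vec_tau_def coord_tau_power_sum[of 1, simplified])
qed

section \<open>Generators of the motive over polynomials in T\<close>

lemma power2_sum_char_two: "(x + y :: 'a) ^ 2 ^ n = x ^ 2 ^ n + y ^ 2 ^ n"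
proof (induction n)
  case (Suc n)
  have "(x + y) ^ 2 ^ Suc n = ((x + y) ^ 2 ^ n)\<^sup>2" by (simp add: mult.commute flip: power_mult)
  then show ?case using Suc char_two by (simp add: char_two_square_add mult.commute flip: power_mult)
qed simp

lemma skew_times_add_right: "skew_times p (r + s) = skew_times p r + skew_times p (s :: 'a poly)"
  by (simp add: poly_eq_iff coeff_skew_times power2_sum_char_two distrib_left sum.distrib)

lemma skew_times_monom: "skew_times (monom a n) (monom b k) = monom (a * b ^ 2 ^ n) (n + (k::nat)) "
  for a b :: 'a
proof (rule poly_eqI)
  fix m
  have "(\<Sum>i\<le>m. coeff (monom a n) i * coeff (monom b k) (m - i) ^ 2 ^ i)
     = (\<Sum>i\<le>m. if i = n then a * coeff (monom b k) (m - n) ^ 2 ^ n else 0)"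
    by (rule sum.cong) auto
  then show "coeff (skew_times (monom a n) (monom b k)) m = coeff (monom (a * b ^ 2 ^ n) (n + k)) m"
    by (auto simp: coeff_skew_times)
qed

lemma motive_T_axis: "motive_T \<theta> A (axis j (monom a n)) = axis j (monom (a * \<theta> ^ 2 ^ n) n)
    + (\<Sum>k\<in>UNIV. axis k (monom (a * (A $ j $ k) ^ 2 ^ n) (Suc n))) + axis j (monom a (Suc (Suc n)))"
proof -
  have z: "skew_times 0 p = 0" "skew_times p 0 = 0" for p :: "'a poly"
    by (simp_all add: poly_eq_iff coeff_skew_times power_0_left)
  have c: "skew_times (monom a n) [:b:] = monom (a * b ^ 2 ^ n) n" for b
    using skew_times_monom[of a n b 0] by (simp add: monom_0)
  have "skew_times (axis j (monom a n) $ i) (motive_T_coeff \<theta> A $ i $ k) =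
      (if i = j then skew_times (monom a n) (motive_T_coeff \<theta> A $ j $ k) else 0)" for i k
    by (simp add: axis_def z)
  then have "motive_T \<theta> A (axis j (monom a n)) $ k = skew_times (monom a n) (motive_T_coeff \<theta> A $ j $ k)" for k
    by (simp add: motive_T_def)
  moreover have "skew_times (monom a n) (motive_T_coeff \<theta> A $ j $ k)
    = (if j = k then monom (a * \<theta> ^ 2 ^ n) n + monom a (Suc (Suc n)) else 0)
      + monom (a * (A $ j $ k) ^ 2 ^ n) (Suc n)" for k
    by (simp add: motive_T_coeff_def skew_times_add_right skew_times_monom c z)
  ultimately show ?thesis
    by (simp add: vec_eq_iff forall_2 sum_2 axis_def)
qed

text \<open>In \<open>motive_T_axis\<close> the term of highest degree in tau has degree
  \<open>n + 2\<close> and coefficient \<open>a\<close>, so it is obtained from T and lower terms;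
  two consecutive degrees start the induction.\<close>

lemma t_motive_generated:
  assumes add: "\<And>m n. \<lbrakk>P m; P n\<rbrakk> \<Longrightarrow> P (m + n)"
    and smult: "\<And>p m. P m \<Longrightarrow> P (p \<odot>\<^bsub>t_motive \<theta> A\<^esub> m)"
    and base: "\<And>j. P (axis j 1)" "\<And>j. P (vec_tau (axis j 1))"
  shows "P m"
proof -
  have P0: "P 0" using smult[OF base(1), of 0] by (simp add: t_motive_smult_0)
  have PT: "P (motive_T \<theta> A m)" if "P m" for m
    using smult[OF that, of "[:0, 1:]"]
    by (simp add: t_motive_smult_pCons t_motive_smult_0 vec_scale_0 vec_scale_1 motive_T_0)
  have Pscale: "P (vec_scale a m)" if "P m" for a m
    using smult[OF that, of "[:a:]"] by (simp add: t_motive_smult_pCons t_motive_smult_0 motive_T_0)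
  have Pdiff: "P (m - n)" if "P m" "P n" for m n
  proof -
    have "m - n = m + vec_scale (-1) n" by (simp add: vec_scale_def vec_eq_iff)
    with add that Pscale show ?thesis by presburger
  qed
  have Psum: "P (sum h B)" if "\<And>x. x \<in> B \<Longrightarrow> P (h x)" for h :: "'x \<Rightarrow> 'a poly^2" and B
    using that by (induction B rule: infinite_finite_induct) (simp_all add: P0 add)
  have axis_scale: "axis j (monom a n) = vec_scale a (axis j (monom 1 n))" for j :: 2 and a n
    by (simp add: vec_scale_def vec_eq_iff axis_def smult_monom)
  have "P (axis j (monom a n)) \<and> P (axis j (monom a (Suc n)))" for j a n
  proof (induction n arbitrary: j a)
    case 0
    have "vec_tau (axis j 1) = axis j (monom (1::'a) 1)"
      by (simp add: vec_tau_def vec_eq_iff axis_def poly_tau_0)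
        (simp add: poly_tau_eq monom_altdef flip: one_pCons)
    then have "P (axis j (monom 1 0))" "P (axis j (monom 1 (Suc 0)))"
      using base(1)[of j] base(2)[of j] by (simp_all add: monom_0 one_pCons)
    then show ?case unfolding axis_scale[of j a] by (simp add: Pscale)
  next
    case (Suc n)
    have "axis j (monom a (Suc (Suc n))) = motive_T \<theta> A (axis j (monom a n))
      - axis j (monom (a * \<theta> ^ 2 ^ n) n) - (\<Sum>k\<in>UNIV. axis k (monom (a * (A $ j $ k) ^ 2 ^ n) (Suc n)))"
      unfolding motive_T_axis by simp
    also have "P \<dots>" by (intro Pdiff Psum PT) (use Suc in blast)+
    finally show ?case using Suc by blast
  qed
  then have axis_monom: "P (axis j (monom a n))" for j a n by blast
  have "P (axis j p)" for j p
  proof -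
    have "axis j p = (\<Sum>i\<le>degree p. axis j (monom (coeff p i) i))"
      using poly_as_sum_of_monoms[of p] by (simp add: vec_eq_iff axis_def)
    then show ?thesis by (elim ssubst) (intro Psum axis_monom)
  qed
  then have "P (\<Sum>j\<in>UNIV. axis j (m $ j))" by (intro Psum)
  moreover have "m = (\<Sum>j\<in>UNIV. axis j (m $ j))"
    by (simp add: sum_2 vec_eq_iff axis_def forall_2)
  ultimately show ?thesis by metis
qed

abbreviation "Tate \<equiv> carrier (tate_algebra ord)"

lemma Tate_closed:
  "0 \<in> Tate" "\<lbrakk>f \<in> Tate; g \<in> Tate\<rbrakk> \<Longrightarrow> f + g \<in> Tate" "f \<in> Tate \<Longrightarrow> fps_of_poly p * f \<in> Tate"
  "f \<in> Tate \<Longrightarrow> frob f \<in> Tate"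
  unfolding tate_algebra_def
  using tate_add_closed tate_poly_closed tate_square_closed by (simp_all add: ord_0)

definition Tz :: "('a coords) set" where
  "Tz = {z. \<forall>j. fst z $ j \<in> Tate \<and> snd z $ j \<in> Tate}"

lemma Tz_closed:
  "0 \<in> Tz" "\<lbrakk>y \<in> Tz; z \<in> Tz\<rbrakk> \<Longrightarrow> y + z \<in> Tz" "z \<in> Tz \<Longrightarrow> scale (fps_of_poly p) z \<in> Tz"
  by (auto simp: Tz_def scale_def Tate_closed)

lemma coord_base: "coord (axis j 1) = E j" "coord (vec_tau (axis j 1)) = coord_tau (E j)"
proof -
  have "ev 1 z = z" for z using ev_monom[of 1 0 z] by (simp add: scale_simps monom_0 one_pCons)
  moreover have "\<forall>k. ev (axis j 1 $ k) (E k) = (if k = j then ev 1 (E j) else 0)"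
    by (simp add: axis_def ev_0)
  ultimately show "coord (axis j 1) = E j" by (simp add: coord_def)
  then show "coord (vec_tau (axis j 1)) = coord_tau (E j)" by (simp add: coord_vec_tau)
qed

end

section \<open>\<open>H\<^sup>1\<close> in coordinates\<close>

lemma ex1_bij_betw:
  assumes "bij_betw h U V"
  shows "(\<exists>!x. x \<in> U \<and> P (h x)) \<longleftrightarrow> (\<exists>!y. y \<in> V \<and> P y)"
proof -
  have V: "V = h ` U" and inj: "\<And>x y. \<lbrakk>x \<in> U; y \<in> U; h x = h y\<rbrakk> \<Longrightarrow> x = y"
    using assms by (auto simp: bij_betw_def inj_on_def)
  show ?thesis
  proof
    assume "\<exists>!x. x \<in> U \<and> P (h x)"
    then obtain x where x: "x \<in> U" "P (h x)" "\<And>y. \<lbrakk>y \<in> U; P (h y)\<rbrakk> \<Longrightarrow> y = x" by blast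
    show "\<exists>!y. y \<in> V \<and> P y" unfolding V by (rule ex1I[of _ "h x"]) (use x in blast)+
  next
    assume "\<exists>!y. y \<in> V \<and> P y"
    then obtain x where x: "x \<in> U" "P (h x)" "\<And>y. \<lbrakk>y \<in> V; P y\<rbrakk> \<Longrightarrow> y = h x" unfolding V by blast
    show "\<exists>!x. x \<in> U \<and> P (h x)" by (rule ex1I[of _ x]) (use x inj in \<open>unfold V, blast\<close>)+
  qed
qed

context t_motive_coordinates
begin

abbreviation "R \<equiv> (ring_of_type_algebra :: 'a poly ring)"
abbreviation "motive \<equiv> t_motive \<theta> A"
abbreviation "Fr \<equiv> free_Abelian_group (carrier motive \<times> Tate)"
abbreviation "null \<equiv> tensor_null R motive (tate_algebra ord)"

section \<open>The tensor product as a space of coordinates\<close>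

lemma carrier_R: "carrier R = UNIV"
  by (simp add: ring_of_type_algebra_def)

lemma tate_ops: "x \<oplus>\<^bsub>tate_algebra ord\<^esub> y = x + y" "p \<odot>\<^bsub>tate_algebra ord\<^esub> x = fps_of_poly p * x"
  "tau (tate_algebra ord) x = frob x"
  by (simp_all add: tate_algebra_def frob_def)

text \<open>The map that will identify the tensor product with \<open>Tz\<close>, taken before
  passing to the quotient; its kernel on \<open>carrier Fr\<close> turns out to be
  \<open>null\<close>.\<close>

definition frag_ev :: "(('a poly^2) \<times> 'a fps \<Rightarrow>\<^sub>0 int) \<Rightarrow> 'a coords" where
  "frag_ev c = (\<Sum>x\<in>Poly_Mapping.keys c.
     scale (of_int (poly_mapping.lookup c x) * snd x) (coord (fst x)))"

lemma frag_ev_superset: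
  "\<lbrakk>finite K; Poly_Mapping.keys c \<subseteq> K\<rbrakk> \<Longrightarrow>
    frag_ev c = (\<Sum>x\<in>K. scale (of_int (poly_mapping.lookup c x) * snd x) (coord (fst x)))"
  unfolding frag_ev_def
  by (rule sum.mono_neutral_left) (auto simp: in_keys_iff scale_simps)

lemma frag_ev_add: "frag_ev (c + d) = frag_ev c + frag_ev d"
proof -
  define K where "K = Poly_Mapping.keys c \<union> Poly_Mapping.keys d"
  have K: "finite K" "Poly_Mapping.keys c \<subseteq> K" "Poly_Mapping.keys d \<subseteq> K" "Poly_Mapping.keys (c + d) \<subseteq> K"
    using keys_add[of c d] by (auto simp: K_def)
  show ?thesis
    unfolding frag_ev_superset[OF K(1,2)] frag_ev_superset[OF K(1,3)] frag_ev_superset[OF K(1,4)]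
    by (simp add: lookup_add distrib_right scale_simps sum.distrib)
qed

lemma frag_ev_of [simp]: "frag_ev (frag_of (m, f)) = scale f (coord m)"
  by (simp add: frag_ev_def)

lemma frag_ev_0 [simp]: "frag_ev 0 = 0"
  by (simp add: frag_ev_def)

lemma frag_ev_minus: "frag_ev (- c) = - frag_ev c"
  using frag_ev_add[of c "- c"] by (simp add: eq_neg_iff_add_eq_0 add.commute)

lemma frag_ev_diff: "frag_ev (c - d) = frag_ev c - frag_ev d"
  using frag_ev_add[of c "- d"] by (simp add: frag_ev_minus)

lemma frag_ev_sum: "frag_ev (sum h B) = (\<Sum>x\<in>B. frag_ev (h x))"
  by (induction B rule: infinite_finite_induct) (simp_all add: frag_ev_add)

text \<open>Only additivity of \<open>G\<close> is asked, since tau is merely semilinear; this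
  serves both tau and the action of polynomials.\<close>

lemma frag_ev_extend:
  assumes "\<And>y z. G (y + z) = G y + G z"
    and "\<And>m f. f \<in> Tate \<Longrightarrow> scale (\<psi> f) (coord (\<phi> m)) = G (scale f (coord m))"
    and "Poly_Mapping.keys c \<subseteq> UNIV \<times> Tate"
  shows "frag_ev (frag_extend (\<lambda>(x, y). frag_of (\<phi> x, \<psi> y)) c) = G (frag_ev c)"
  using assms(3)
proof (induction c rule: frag_induction)
  case zero
  show ?case using assms(1)[of 0 0] by simp
next
  case (one x)
  then show ?case using assms(2) by (cases x) auto
next
  case (diff a b)
  have "G (frag_ev a - frag_ev b) = G (frag_ev a) - G (frag_ev b)"
    using assms(1)[of "frag_ev a - frag_ev b" "frag_ev b"] by simp
  with diff show ?case by (simp add: frag_extend_diff frag_ev_diff)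
qed

lemma Fr_add: "\<lbrakk>c \<in> carrier Fr; d \<in> carrier Fr\<rbrakk> \<Longrightarrow> c + d \<in> carrier Fr"
  using keys_add[of c d] unfolding carrier_free_Abelian_group_iff by blast

lemma Fr_diff: "\<lbrakk>c \<in> carrier Fr; d \<in> carrier Fr\<rbrakk> \<Longrightarrow> c - d \<in> carrier Fr"
  using keys_diff[of c d] unfolding carrier_free_Abelian_group_iff by blast

lemma relations_in_carrier: "tensor_relations R motive (tate_algebra ord) \<subseteq> carrier Fr"
  unfolding tensor_relations_def
  by (auto simp: tate_ops t_motive_carrier Tate_closed simp del: carrier_free_Abelian_group_iff
      intro!: Fr_diff[unfolded t_motive_carrier])

lemma null_in_carrier: "null \<subseteq> carrier Fr"
  unfolding tensor_null_def
  by (rule group.generate_incl[OF group_free_Abelian_group relations_in_carrier])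

lemma null_add: "\<lbrakk>c \<in> null; d \<in> null\<rbrakk> \<Longrightarrow> c + d \<in> null"
  using generate.eng[of c Fr "tensor_relations R motive (tate_algebra ord)" d]
  by (simp add: tensor_null_def)

lemma null_minus: "c \<in> null \<Longrightarrow> - c \<in> null"
  using group.generate_m_inv_closed[OF group_free_Abelian_group relations_in_carrier, of c]
    null_in_carrier by (auto simp: tensor_null_def)

lemma null_diff: "\<lbrakk>c \<in> null; d \<in> null\<rbrakk> \<Longrightarrow> c - d \<in> null"
  using null_add[OF _ null_minus, of c d] by simp

lemma null_rel:
  "f \<in> Tate \<Longrightarrow> frag_of (m + n, f) - frag_of (m, f) - frag_of (n, f) \<in> null"
  "\<lbrakk>f \<in> Tate; g \<in> Tate\<rbrakk> \<Longrightarrow> frag_of (m, f + g) - frag_of (m, f) - frag_of (m, g) \<in> null"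
  "f \<in> Tate \<Longrightarrow> frag_of (p \<odot>\<^bsub>motive\<^esub> m, f) - frag_of (m, fps_of_poly p * f) \<in> null"
proof -
  assume f: "f \<in> Tate"
  show "frag_of (m + n, f) - frag_of (m, f) - frag_of (n, f) \<in> null"
    unfolding tensor_null_def tensor_relations_def
    by (rule generate.incl, rule UnI1, rule UnI1) (use f in \<open>force simp: t_motive_add t_motive_carrier\<close>)
  show "frag_of (m, f + g) - frag_of (m, f) - frag_of (m, g) \<in> null" if "g \<in> Tate"
    unfolding tensor_null_def tensor_relations_def
    by (rule generate.incl, rule UnI1, rule UnI2) (use f that in \<open>force simp: tate_ops t_motive_carrier\<close>)
  show "frag_of (p \<odot>\<^bsub>motive\<^esub> m, f) - frag_of (m, fps_of_poly p * f) \<in> null"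
    unfolding tensor_null_def tensor_relations_def
    by (rule generate.incl, rule UnI2) (use f in \<open>force simp: tate_ops t_motive_carrier carrier_R\<close>)
qed

lemma null_zero_right: "frag_of (m, 0) \<in> null"
  using null_minus[OF null_rel(2)[of 0 0 m]] Tate_closed(1) by simp

lemma frag_ev_null: "c \<in> null \<Longrightarrow> frag_ev c = 0"
  unfolding tensor_null_def
proof (induction c rule: generate.induct)
  case one
  show ?case by simp
next
  case (incl h)
  then show ?case
    unfolding tensor_relations_def
    by (auto simp: frag_ev_diff t_motive_add tate_ops coord_add coord_smult scale_simps mult.commute)
next
  case (inv h)
  then have "h \<in> carrier Fr" using relations_in_carrier by blast
  then have "Poly_Mapping.keys h \<subseteq> carrier motive \<times> Tate" by simp
  moreover have "frag_ev h = 0"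
    using inv unfolding tensor_relations_def
    by (auto simp: frag_ev_diff t_motive_add tate_ops coord_add coord_smult scale_simps mult.commute)
  ultimately show ?case by (simp add: frag_ev_minus)
next
  case (eng h1 h2)
  then show ?case by (simp add: frag_ev_add)
qed

text \<open>A section of \<open>frag_ev\<close> through the four basis elements; reduction to this
  normal form shows that \<open>frag_ev\<close> loses nothing modulo \<open>null\<close>.\<close>

definition rep :: "'a coords \<Rightarrow> (('a poly^2) \<times> 'a fps \<Rightarrow>\<^sub>0 int)" where
  "rep z = (\<Sum>j\<in>UNIV. frag_of (axis j 1, fst z $ j) + frag_of (vec_tau (axis j 1), snd z $ j))"

lemma frag_ev_rep: "frag_ev (rep z) = z"
  unfolding rep_def frag_ev_sum sum_2 frag_ev_add frag_ev_of coord_base coord_tau_E unfolding E_def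
  by (simp add: scale_def prod_eq_iff vec_eq_iff forall_2 axis_def)

lemma rep_carrier: "z \<in> Tz \<Longrightarrow> rep z \<in> carrier Fr"
  unfolding rep_def sum_2 carrier_free_Abelian_group_iff
  by (intro order_trans[OF keys_add] Un_least) (auto simp: Tz_def t_motive_carrier)

lemma rep_add:
  assumes "y \<in> Tz" "z \<in> Tz"
  shows "rep (y + z) - rep y - rep z \<in> null"
proof -
  have t: "fst y $ j \<in> Tate" "snd y $ j \<in> Tate" "fst z $ j \<in> Tate" "snd z $ j \<in> Tate" for j
    using assms by (auto simp: Tz_def)
  have split: "(a + b) - (c + d) - (e + g) = (a - c - e) + (b - d - g)"
    for a b c d e g :: "('a poly^2) \<times> 'a fps \<Rightarrow>\<^sub>0 int"
    by simp
  show ?thesis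
    unfolding rep_def sum_subtractf[symmetric] split sum_2 fst_add snd_add vector_add_component
    by (intro null_add null_rel(2) t)
qed

text \<open>Linearity reduces this to the generators \<open>e\<^sub>j\<close> and \<open>\<tau> e\<^sub>j\<close>, where it is clear.\<close>
lemma pure_tensor_rep:
  "\<forall>f\<in>Tate. scale f (coord m) \<in> Tz \<and> frag_of (m, f) - rep (scale f (coord m)) \<in> null"
proof (induction m rule: t_motive_generated)
  case (1 m n)
  show ?case
  proof
    fix f assume f: "f \<in> Tate"
    let ?a = "scale f (coord m)" and ?b = "scale f (coord n)"
    have "frag_of (m + n, f) - rep (?a + ?b)
      = (frag_of (m + n, f) - frag_of (m, f) - frag_of (n, f)) + (frag_of (m, f) - rep ?a)
        + (frag_of (n, f) - rep ?b) - (rep (?a + ?b) - rep ?a - rep ?b)" by simp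
    also have "\<dots> \<in> null"
      by (rule null_diff[OF null_add[OF null_add[OF null_rel(1)[OF f]]] rep_add]) (use 1 f in auto)
    finally show "scale f (coord (m + n)) \<in> Tz \<and> frag_of (m + n, f) - rep (scale f (coord (m + n))) \<in> null"
      unfolding coord_add scale_simps using 1 f Tz_closed by auto
  qed
next
  case (2 p m)
  show ?case
  proof
    fix f assume f: "f \<in> Tate"
    have e: "scale f (coord (p \<odot>\<^bsub>motive\<^esub> m)) = scale (fps_of_poly p * f) (coord m)"
      by (simp add: coord_smult scale_simps mult.commute)
    have pf: "fps_of_poly p * f \<in> Tate" using f by (rule Tate_closed)
    have "frag_of (p \<odot>\<^bsub>motive\<^esub> m, f) - rep (scale (fps_of_poly p * f) (coord m))
      = (frag_of (p \<odot>\<^bsub>motive\<^esub> m, f) - frag_of (m, fps_of_poly p * f))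
        + (frag_of (m, fps_of_poly p * f) - rep (scale (fps_of_poly p * f) (coord m)))" by simp
    also have "\<dots> \<in> null" by (rule null_add[OF null_rel(3)[OF f]]) (use 2 pf in auto)
    finally show "scale f (coord (p \<odot>\<^bsub>motive\<^esub> m)) \<in> Tz \<and>
        frag_of (p \<odot>\<^bsub>motive\<^esub> m, f) - rep (scale f (coord (p \<odot>\<^bsub>motive\<^esub> m))) \<in> null"
      unfolding e using 2 pf by auto
  qed
next
  case (3 j)
  show ?case
  proof
    fix f assume f: "f \<in> Tate"
    have e: "scale f (coord (axis j 1)) = (axis j f, 0)"
      unfolding coord_base E_def by (auto simp: scale_def prod_eq_iff vec_eq_iff axis_def)
    have "rep (axis j f, 0) - frag_of (axis j 1, f) \<in> null"
      using exhaust_2[of j] unfolding rep_def sum_2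
      by (auto simp: axis_def[of _ f] intro!: null_add null_zero_right)
    from null_minus[OF this] show "scale f (coord (axis j 1)) \<in> Tz \<and>
        frag_of (axis j 1, f) - rep (scale f (coord (axis j 1))) \<in> null"
      unfolding e using f Tate_closed(1) by (auto simp: Tz_def axis_def)
  qed
next
  case (4 j)
  show ?case
  proof
    fix f assume f: "f \<in> Tate"
    have e: "scale f (coord (vec_tau (axis j 1))) = (0, axis j f)"
      unfolding coord_base coord_tau_E by (auto simp: scale_def prod_eq_iff vec_eq_iff axis_def)
    have "rep (0, axis j f) - frag_of (vec_tau (axis j 1), f) \<in> null"
      using exhaust_2[of j] unfolding rep_def sum_2
      by (auto simp: axis_def[of _ f] intro!: null_add null_zero_right)
    from null_minus[OF this] show "scale f (coord (vec_tau (axis j 1))) \<in> Tz \<and>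
        frag_of (vec_tau (axis j 1), f) - rep (scale f (coord (vec_tau (axis j 1)))) \<in> null"
      unfolding e using f Tate_closed(1) by (auto simp: Tz_def axis_def)
  qed
qed

lemma tensor_rep:
  assumes "c \<in> carrier Fr"
  shows "frag_ev c \<in> Tz \<and> c - rep (frag_ev c) \<in> null"
proof -
  have "Poly_Mapping.keys c \<subseteq> carrier motive \<times> Tate" using assms by simp
  then show ?thesis
  proof (induction c rule: frag_induction)
    case zero
    have "- rep 0 \<in> null" using rep_add[OF Tz_closed(1) Tz_closed(1)] by simp
    then show ?case by (simp add: Tz_closed)
  next
    case (one x)
    then show ?case using pure_tensor_rep by (cases x) auto
  next
    case (diff a b)
    let ?y = "frag_ev a" and ?z = "frag_ev b"
    have yz: "?y - ?z \<in> Tz" using diff Tz_closed(2) by (simp add: minus_z)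
    have "a - b - rep (?y - ?z) = (a - rep ?y) - (b - rep ?z) + (rep ((?y - ?z) + ?z) - rep (?y - ?z) - rep ?z)"
      by simp
    also have "\<dots> \<in> null" by (rule null_add[OF null_diff rep_add]) (use diff yz in auto)
    finally show ?case using yz by (simp add: frag_ev_diff)
  qed
qed

text \<open>The relations have coordinates 0; conversely a formal sum is congruent to
  \<open>rep\<close> of its coordinates, and \<open>rep 0\<close> is null.\<close>

lemma null_iff: "c \<in> null \<longleftrightarrow> c \<in> carrier Fr \<and> frag_ev c = 0"
proof
  assume c: "c \<in> carrier Fr \<and> frag_ev c = 0"
  have "- rep 0 \<in> null" using rep_add[OF Tz_closed(1) Tz_closed(1)] by simp
  moreover have "c - rep 0 \<in> null" using tensor_rep[of c] c by simp
  ultimately have "(c - rep 0) - (- rep 0) \<in> null" by (rule null_diff[rotated])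
  then show "c \<in> null" by simp
qed (use null_in_carrier frag_ev_null in blast)

text \<open>By \<open>null_iff\<close> the cosets of \<open>null\<close> are fibres of
  \<open>frag_ev\<close>, which is how tensors are described from here on.\<close>

definition cls :: "'a coords \<Rightarrow> (('a poly^2) \<times> 'a fps \<Rightarrow>\<^sub>0 int) set" where
  "cls z = {c \<in> carrier Fr. frag_ev c = z}"

lemma rep_in_cls: "z \<in> Tz \<Longrightarrow> rep z \<in> cls z"
  by (simp only: cls_def mem_Collect_eq rep_carrier frag_ev_rep simp_thms)

lemma cls_inject: "\<lbrakk>y \<in> Tz; cls y = cls z\<rbrakk> \<Longrightarrow> y = z"
proof -
  assume "y \<in> Tz" "cls y = cls z"
  then have "rep y \<in> cls z" using rep_in_cls by blast
  then have "frag_ev (rep y) = z" unfolding cls_def by blast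
  then show "y = z" by (simp only: frag_ev_rep)
qed

lemma coset_eq_cls:
  assumes "c \<in> carrier Fr"
  shows "null #>\<^bsub>Fr\<^esub> c = cls (frag_ev c)"
proof (intro equalityI subsetI)
  fix d assume "d \<in> null #>\<^bsub>Fr\<^esub> c"
  then obtain h where "h \<in> null" "d = h + c" by (auto simp: r_coset_def)
  then show "d \<in> cls (frag_ev c)"
    using assms Fr_add null_iff by (auto simp: cls_def frag_ev_add simp del: carrier_free_Abelian_group_iff)
next
  fix d assume "d \<in> cls (frag_ev c)"
  then have "d - c \<in> null" using assms Fr_diff null_iff
    by (auto simp: cls_def frag_ev_diff simp del: carrier_free_Abelian_group_iff)
  then show "d \<in> null #>\<^bsub>Fr\<^esub> c" by (force simp: r_coset_def)
qed

lemma tensor_carrier: "carrier (tensor_group R motive (tate_algebra ord)) = cls ` Tz"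
proof -
  have "carrier (tensor_group R motive (tate_algebra ord)) = (\<Union>c\<in>carrier Fr. {null #>\<^bsub>Fr\<^esub> c})"
    by (simp add: tensor_group_def FactGroup_def RCOSETS_def)
  also have "\<dots> = (\<lambda>c. cls (frag_ev c)) ` carrier Fr" using coset_eq_cls by auto
  also have "\<dots> = cls ` Tz"
    using tensor_rep rep_carrier frag_ev_rep
    by (auto simp: image_iff simp del: carrier_free_Abelian_group_iff) metis
  finally show ?thesis .
qed

lemma tensor_mult:
  assumes "y \<in> Tz" "z \<in> Tz"
  shows "cls y \<otimes>\<^bsub>tensor_group R motive (tate_algebra ord)\<^esub> cls z = cls (y + z)"
proof -
  have "cls y <#>\<^bsub>Fr\<^esub> cls z = cls (y + z)"
  proof (intro equalityI subsetI)
    fix c assume "c \<in> cls y <#>\<^bsub>Fr\<^esub> cls z"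
    then show "c \<in> cls (y + z)"
      using Fr_add by (auto simp: set_mult_def cls_def frag_ev_add simp del: carrier_free_Abelian_group_iff)
  next
    fix c assume "c \<in> cls (y + z)"
    then have "c - rep y \<in> cls z"
      using Fr_diff rep_carrier[OF assms(1)]
      by (auto simp: cls_def frag_ev_diff frag_ev_rep simp del: carrier_free_Abelian_group_iff)
    with rep_in_cls[OF assms(1)] show "c \<in> cls y <#>\<^bsub>Fr\<^esub> cls z"
      by (force simp: set_mult_def)
  qed
  then show ?thesis by (simp add: tensor_group_def FactGroup_def)
qed

lemma tensor_one: "\<one>\<^bsub>tensor_group R motive (tate_algebra ord)\<^esub> = cls 0"
  by (auto simp: tensor_group_def FactGroup_def cls_def null_iff)

text \<open>Every representative of the class is sent to a formal sum with coordinates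
  \<open>G z\<close>, so the union in \<open>tensor_map\<close> runs over a single coset.\<close>

lemma tensor_map_cls:
  assumes G: "\<And>y z. G (y + z) = G y + G z"
    and "\<And>m f. f \<in> Tate \<Longrightarrow> scale (\<psi> f) (coord (\<phi> m)) = G (scale f (coord m))"
    and \<psi>: "\<And>f. f \<in> Tate \<Longrightarrow> \<psi> f \<in> Tate"
    and z: "z \<in> Tz"
  shows "tensor_map R motive (tate_algebra ord) \<phi> \<psi> (cls z) = cls (G z)"
proof -
  let ?g = "\<lambda>(x, y). frag_of (\<phi> x, \<psi> y)"
  have "null #>\<^bsub>Fr\<^esub> frag_extend ?g c = cls (G z)" if c: "c \<in> cls z" for c
  proof -
    have k: "Poly_Mapping.keys c \<subseteq> UNIV \<times> Tate" "frag_ev c = z"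
      using c by (auto simp: cls_def t_motive_carrier)
    have "Poly_Mapping.keys (frag_extend ?g c) \<subseteq> UNIV \<times> Tate"
      by (rule order_trans[OF keys_frag_extend]) (use k \<psi> in \<open>force split: prod.splits\<close>)
    then have "frag_extend ?g c \<in> carrier Fr" by (simp add: t_motive_carrier)
    then show ?thesis
      using coset_eq_cls frag_ev_extend[of G \<psi> \<phi> c, OF G assms(2) k(1)] k(2) by simp
  qed
  then show ?thesis unfolding tensor_map_def using rep_in_cls[OF z] by blast
qed

section \<open>Invariants and bases of H^1\<close>

definition invariants :: "'a coords set" where
  "invariants = {z \<in> Tz. coord_tau z = z}"

definition bit_act :: "bit poly \<Rightarrow> 'a coords \<Rightarrow> 'a coords" where
  "bit_act p z = scale (fps_of_poly (map_poly of_bit p)) z"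

lemma invariants_closed:
  "0 \<in> invariants" "\<lbrakk>y \<in> invariants; z \<in> invariants\<rbrakk> \<Longrightarrow> y + z \<in> invariants"
  "z \<in> invariants \<Longrightarrow> bit_act p z \<in> invariants"
proof -
  \<comment> \<open>Coefficients in F_2 are fixed by squaring.\<close>
  have "frob (fps_of_poly (map_poly of_bit p)) = fps_of_poly (map_poly of_bit p)"
  proof (rule fps_ext)
    fix n
    show "fps_nth (frob (fps_of_poly (map_poly of_bit p))) n = fps_nth (fps_of_poly (map_poly of_bit p)) n"
      by (cases "coeff p n") (simp_all add: coeff_map_poly)
  qed
  then show "z \<in> invariants \<Longrightarrow> bit_act p z \<in> invariants"
    by (simp add: invariants_def bit_act_def Tz_closed coord_tau_scale)
qed (simp_all add: invariants_def Tz_closed coord_tau_0 coord_tau_add)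

abbreviation "H \<equiv> H1 ord motive"

lemma H1_ops:
  "carrier H = cls ` invariants"
  "\<lbrakk>y \<in> invariants; z \<in> invariants\<rbrakk> \<Longrightarrow> cls y \<oplus>\<^bsub>H\<^esub> cls z = cls (y + z)"
  "\<zero>\<^bsub>H\<^esub> = cls 0"
  "z \<in> invariants \<Longrightarrow> p \<odot>\<^bsub>H\<^esub> cls z = cls (bit_act p z)"
proof -
  have tm: "tau motive = vec_tau" by (simp add: t_motive_def vec_tau_def poly_tau_def fun_eq_iff)
  have tau_cls: "tensor_map R motive (tate_algebra ord) (tau motive) (tau (tate_algebra ord)) (cls z)
      = cls (coord_tau z)"
    if "z \<in> Tz" for z
    by (rule tensor_map_cls[OF coord_tau_add])
      (use that in \<open>simp_all add: tm tate_ops coord_vec_tau coord_tau_scale Tate_closed\<close>)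
  have carr: "carrier H = {x \<in> cls ` Tz.
      tensor_map R motive (tate_algebra ord) (tau motive) (tau (tate_algebra ord)) x = x}"
    by (simp add: H1_def tau_invariants_def tensor_product_def tensor_carrier)
  show "carrier H = cls ` invariants"
  proof (intro equalityI subsetI)
    fix x assume "x \<in> carrier H"
    then obtain z where z: "z \<in> Tz" "x = cls z" "cls z = cls (coord_tau z)"
      unfolding carr using tau_cls by force
    then have "coord_tau z = z" using cls_inject by metis
    with z(1) have "z \<in> invariants" by (simp add: invariants_def)
    with z(2) show "x \<in> cls ` invariants" by blast
  next
    fix x assume "x \<in> cls ` invariants"
    then obtain z where "z \<in> Tz" "x = cls z" "coord_tau z = z" by (auto simp: invariants_def)
    then show "x \<in> carrier H" unfolding carr using tau_cls by simp
  qed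
  show "cls y \<oplus>\<^bsub>H\<^esub> cls z = cls (y + z)" if "y \<in> invariants" "z \<in> invariants"
    using that tensor_mult
    by (simp add: H1_def tau_invariants_def tensor_product_def invariants_def)
  show "\<zero>\<^bsub>H\<^esub> = cls 0"
    by (simp add: H1_def tau_invariants_def tensor_product_def tensor_one)
  show "p \<odot>\<^bsub>H\<^esub> cls z = cls (bit_act p z)" if "z \<in> invariants"
  proof -
    have "tensor_map R motive (tate_algebra ord) (\<lambda>x. map_poly of_bit p \<odot>\<^bsub>motive\<^esub> x) (\<lambda>y. y) (cls z)
        = cls (bit_act p z)"
      by (rule tensor_map_cls)
        (use that in \<open>simp_all add: bit_act_def invariants_def scale_simps coord_smult mult.commute\<close>)
    then show ?thesis by (simp add: H1_def tau_invariants_def tensor_product_def)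
  qed
qed

lemma cls_inj: "inj_on cls invariants"
  using cls_inject by (auto simp: inj_on_def invariants_def)

lemma abelian_monoid_H1: "abelian_monoid H"
  by (rule abelian_monoidI; unfold H1_ops(1); (elim imageE)?)
    (simp_all add: H1_ops(2,3) invariants_closed imageI ac_simps)

lemma finsum_H1:
  assumes "finite B" "\<And>b. b \<in> B \<Longrightarrow> f b \<in> invariants"
  shows "(\<Oplus>\<^bsub>H\<^esub>b\<in>B. cls (f b)) = cls (\<Sum>b\<in>B. f b) \<and> (\<Sum>b\<in>B. f b) \<in> invariants"
  using assms
proof (induction B rule: finite_induct)
  case empty
  then show ?case by (simp add: abelian_monoid.finsum_empty[OF abelian_monoid_H1] H1_ops invariants_closed)
next
  case (insert b B)
  then have "(\<lambda>b. cls (f b)) \<in> B \<rightarrow> carrier H" "cls (f b) \<in> carrier H" by (auto simp: H1_ops)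
  with insert show ?case
    by (simp add: abelian_monoid.finsum_insert[OF abelian_monoid_H1] H1_ops invariants_closed)
qed

text \<open>Classes of invariants correspond bijectively to their coordinates, so only the
  coefficient functions have to be reindexed, by \<open>h\<close>.\<close>

lemma module_basis_H1_iff:
  assumes B: "B \<subseteq> invariants"
  shows "module_basis (ring_of_type_algebra :: bit poly ring) H (cls ` B) \<longleftrightarrow>
    finite B \<and> (\<forall>z\<in>invariants. \<exists>!c. c \<in> B \<rightarrow>\<^sub>E UNIV \<and> z = (\<Sum>b\<in>B. bit_act (c b) b))"
proof -
  have inj: "inj_on cls B" using cls_inj B by (rule inj_on_subset)
  define h :: "(_ \<Rightarrow> bit poly) \<Rightarrow> _" where "h c = restrict (c \<circ> cls) B" for c
  have bij: "bij_betw h (cls ` B \<rightarrow>\<^sub>E UNIV) (B \<rightarrow>\<^sub>E UNIV)"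
  proof (rule bij_betwI[where g = "\<lambda>c. restrict (c \<circ> the_inv_into B cls) (cls ` B)"])
    fix c :: "_ \<Rightarrow> bit poly" assume c: "c \<in> cls ` B \<rightarrow>\<^sub>E UNIV"
    show "restrict (h c \<circ> the_inv_into B cls) (cls ` B) = c"
      by (rule PiE_ext[OF _ c]) (use inj in \<open>auto simp: h_def the_inv_into_f_f\<close>)
  next
    fix c :: "_ \<Rightarrow> bit poly" assume c: "c \<in> B \<rightarrow>\<^sub>E UNIV"
    show "h (restrict (c \<circ> the_inv_into B cls) (cls ` B)) = c"
      by (rule PiE_ext[OF _ c]) (use inj in \<open>auto simp: h_def the_inv_into_f_f\<close>)
  qed (auto simp: h_def)
  have key: "(\<exists>!c. c \<in> cls ` B \<rightarrow>\<^sub>E UNIV \<and> cls z = (\<Oplus>\<^bsub>H\<^esub>b\<in>cls ` B. c b \<odot>\<^bsub>H\<^esub> b)) \<longleftrightarrow>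
      (\<exists>!c. c \<in> B \<rightarrow>\<^sub>E UNIV \<and> z = (\<Sum>b\<in>B. bit_act (c b) b))"
    if fin: "finite B" and z: "z \<in> invariants" for z
  proof -
    have eq: "cls z = (\<Oplus>\<^bsub>H\<^esub>b\<in>cls ` B. c b \<odot>\<^bsub>H\<^esub> b) \<longleftrightarrow> z = (\<Sum>b\<in>B. bit_act (h c b) b)" for c
    proof -
      have "(\<Oplus>\<^bsub>H\<^esub>b\<in>cls ` B. c b \<odot>\<^bsub>H\<^esub> b) = (\<Oplus>\<^bsub>H\<^esub>b\<in>B. c (cls b) \<odot>\<^bsub>H\<^esub> cls b)"
        by (rule abelian_monoid.finsum_reindex[OF abelian_monoid_H1 _ inj])
          (use B invariants_closed in \<open>auto simp: H1_ops\<close>)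
      also have "\<dots> = (\<Oplus>\<^bsub>H\<^esub>b\<in>B. cls (bit_act (h c b) b))"
        by (rule abelian_monoid.finsum_cong'[OF abelian_monoid_H1])
          (use B invariants_closed in \<open>auto simp: H1_ops h_def\<close>)
      also have "\<dots> = cls (\<Sum>b\<in>B. bit_act (h c b) b)"
        using finsum_H1[OF fin, of "\<lambda>b. bit_act (h c b) b"] B invariants_closed by blast
      finally have e: "(\<Oplus>\<^bsub>H\<^esub>b\<in>cls ` B. c b \<odot>\<^bsub>H\<^esub> b) = cls (\<Sum>b\<in>B. bit_act (h c b) b)" .
      have "z \<in> Tz" using z by (simp add: invariants_def)
      then show ?thesis unfolding e using cls_inject by blast
    qed
    show ?thesis unfolding eq by (rule ex1_bij_betw[OF bij])
  qed
  have "finite (cls ` B) \<longleftrightarrow> finite B" using inj by (rule finite_image_iff)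
  moreover have "carrier (ring_of_type_algebra :: bit poly ring) = UNIV"
    by (simp add: ring_of_type_algebra_def)
  moreover have "cls ` B \<subseteq> cls ` invariants" using B by (rule image_mono)
  moreover have "(\<forall>x\<in>cls ` invariants. \<exists>!c. c \<in> cls ` B \<rightarrow>\<^sub>E UNIV \<and>
        x = (\<Oplus>\<^bsub>H\<^esub>b\<in>cls ` B. c b \<odot>\<^bsub>H\<^esub> b)) \<longleftrightarrow>
      (\<forall>z\<in>invariants. \<exists>!c. c \<in> B \<rightarrow>\<^sub>E UNIV \<and> z = (\<Sum>b\<in>B. bit_act (c b) b))" if "finite B"
    unfolding ball_simps using key[OF that] by (rule ball_cong[OF refl])
  ultimately show ?thesis
    unfolding module_basis_def H1_ops(1) by (cases "finite B") (simp_all only: simp_thms)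
qed

end

section \<open>The rank of \<open>H\<^sup>1\<close>\<close>

sublocale D13_parameters \<subseteq> t_motive_coordinates ord \<theta> "vector [vector [a11, a12], vector [a21, 0]]" ..

context D13_parameters
begin

definition residue :: "'a coords \<Rightarrow> 'a \<times> 'a" where
  "residue z = (fps_nth (snd z $ 1) 0, fps_nth (snd z $ 2) 0)"

text \<open>The coefficients of T f; the value 0 at index 0 makes the system for the constant
  coefficients homogeneous.\<close>

definition previous :: "'a fps \<Rightarrow> nat \<Rightarrow> 'a" where
  "previous f n = (if n = 0 then 0 else fps_nth f (n - 1))"

lemma nth_X_plus_theta: "fps_nth ((fps_X + fps_const c) * f) n = previous f n + c * fps_nth f n"
  by (simp add: distrib_right previous_def)

text \<open>Substituting the equation for the first two coordinates into the other one applies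
  \<open>frob\<close> twice, which is the source of the fourth powers and of
  \<open>\<theta>\<^sup>2\<close>.\<close>

lemma coord_tau_fixed_iff:
  "coord_tau z = z \<longleftrightarrow> (\<forall>j. fst z $ j = (fps_X + fps_const \<theta>) * frob (snd z $ j)) \<and>
     (\<forall>n. coeff_system (fps_nth (snd z $ 1) n) (fps_nth (snd z $ 2) n)
       (previous (snd z $ 1) n ^ 4) (previous (snd z $ 2) n ^ 4))" (is "_ \<longleftrightarrow> ?X \<and> ?Y")
proof -
  have x: "fst (coord_tau z) = fst z \<longleftrightarrow> ?X"
    by (auto simp: coord_tau_def vec_eq_iff)
  have y: "snd (coord_tau z) = snd z \<longleftrightarrow> ?Y" if X: ?X
  proof -
    have f: "frob (fst z $ j) = (fps_X + fps_const (\<theta>\<^sup>2)) * frob (frob (snd z $ j))" for j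
      using X by (simp add: frob_mult frob_add)
    have p: "previous (frob (frob g)) n = previous g n ^ 4" for g n
      by (simp add: previous_def flip: power_mult)
    have q: "((fps_nth g n)\<^sup>2)\<^sup>2 = fps_nth g n ^ 4" for g :: "'a fps" and n
      by (simp flip: power_mult)
    have 1: "fps_nth (snd (coord_tau z) $ 1) n = previous (snd z $ 1) n ^ 4 + \<theta>\<^sup>2 * fps_nth (snd z $ 1) n ^ 4
        + (a11 * (fps_nth (snd z $ 1) n)\<^sup>2 + a21 * (fps_nth (snd z $ 2) n)\<^sup>2)" for n
      by (simp add: coord_tau_def f nth_X_plus_theta p q sum_2)
    have 2: "fps_nth (snd (coord_tau z) $ 2) n = previous (snd z $ 2) n ^ 4 + \<theta>\<^sup>2 * fps_nth (snd z $ 2) n ^ 4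
        + a12 * (fps_nth (snd z $ 1) n)\<^sup>2" for n
      by (simp add: coord_tau_def f nth_X_plus_theta p q sum_2)
    have e1: "w + \<theta>\<^sup>2 * y1 ^ 4 + (a11 * y1\<^sup>2 + a21 * y2\<^sup>2) = y1 \<longleftrightarrow>
        \<theta>\<^sup>2 * y1 ^ 4 + a11 * y1\<^sup>2 + a21 * y2\<^sup>2 + y1 = w" for w y1 y2
      by (subst (1 2) eq_iff_add) (simp add: ac_simps)
    have e2: "w + \<theta>\<^sup>2 * y2 ^ 4 + a12 * y1\<^sup>2 = y2 \<longleftrightarrow> \<theta>\<^sup>2 * y2 ^ 4 + a12 * y1\<^sup>2 + y2 = w" for w y1 y2
      by (subst (1 2) eq_iff_add) (simp add: ac_simps)
    show ?thesis
      unfolding vec_eq_iff forall_2 fps_eq_iff 1 2 e1 e2 coeff_system_def by blast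
  qed
  show ?thesis unfolding prod_eq_iff x using y by blast
qed

lemma X_plus_theta_Tate: "f \<in> Tate \<Longrightarrow> (fps_X + fps_const \<theta>) * f \<in> Tate"
  using Tate_closed(3)[of f "[:\<theta>, 1:]"] by (simp add: fps_of_poly_pCons add.commute)

lemma Tate_iff: "f \<in> Tate \<longleftrightarrow> (\<lambda>i. ord (fps_nth f i)) \<longlonglongrightarrow> \<infinity>"
  by (simp add: tate_algebra_def)

lemma residue_image: "residue ` invariants = {(y1, y2). coeff_system y1 y2 0 0}"
proof (intro equalityI subsetI)
  fix y assume "y \<in> residue ` invariants"
  then obtain z where z: "coord_tau z = z" "y = residue z" by (auto simp: invariants_def)
  have "coeff_system (fps_nth (snd z $ 1) 0) (fps_nth (snd z $ 2) 0)
      (previous (snd z $ 1) 0 ^ 4) (previous (snd z $ 2) 0 ^ 4)"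
    using z(1) unfolding coord_tau_fixed_iff by blast
  then show "y \<in> {(y1, y2). coeff_system y1 y2 0 0}" by (simp add: z(2) residue_def previous_def)
next
  fix y assume "y \<in> {(y1, y2). coeff_system y1 y2 0 0}"
  then obtain y1 y2 where y: "y = (y1, y2)" "coeff_system y1 y2 0 0" by blast
  obtain s1 s2 where s: "s1 0 = y1" "s2 0 = y2"
    "\<And>n. coeff_system (s1 (Suc n)) (s2 (Suc n)) (s1 n ^ 4) (s2 n ^ 4)"
    "(\<lambda>n. ord (s1 n)) \<longlonglongrightarrow> \<infinity>" "(\<lambda>n. ord (s2 n)) \<longlonglongrightarrow> \<infinity>"
    using solution_sequence[OF y(2)] by blast
  define Y :: "'a fps^2" where "Y = vector [Abs_fps s1, Abs_fps s2]"
  \<comment> \<open>The first two coordinates are forced by the first half of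
    \<open>coord_tau_fixed_iff\<close>.\<close>
  define z where "z = (\<chi> j. (fps_X + fps_const \<theta>) * frob (Y $ j), Y)"
  have Y: "Y $ 1 = Abs_fps s1" "Y $ 2 = Abs_fps s2" by (simp_all add: Y_def)
  have "Y $ j \<in> Tate" for j
    using exhaust_2[of j] s(4,5) by (auto simp: Y Tate_iff)
  then have "z \<in> Tz" by (simp add: Tz_def z_def X_plus_theta_Tate Tate_closed)
  moreover have "coord_tau z = z"
    unfolding coord_tau_fixed_iff
  proof (intro conjI allI)
    fix n
    show "coeff_system (fps_nth (snd z $ 1) n) (fps_nth (snd z $ 2) n)
        (previous (snd z $ 1) n ^ 4) (previous (snd z $ 2) n ^ 4)"
      using s y(2) by (cases n) (simp_all add: z_def Y previous_def)
  qed (simp add: z_def)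
  ultimately have "z \<in> invariants" by (simp add: invariants_def)
  moreover have "residue z = y" using s y by (simp add: residue_def z_def Y)
  ultimately show "y \<in> residue ` invariants" by blast
qed

text \<open>The threshold is that of \<open>kernel_trivial_near_0\<close>. As coefficients tend to
  0, the levels exhaust the invariants, and division by T shifts them down by one.\<close>

definition small_from :: "nat \<Rightarrow> 'a coords set" where
  "small_from d = {z \<in> invariants. \<forall>n\<ge>d. \<forall>j. ord_ge (fps_nth (snd z $ j) n) (max 2 (1 - u))}"

text \<open>Once the earlier coefficients vanish, the next ones solve the homogeneous system, to
  which \<open>kernel_trivial_near_0\<close> applies.\<close>

lemma small_from_0: "small_from 0 = {0}"
proof -
  have "z = 0" if "z \<in> small_from 0" for z
  proof -
    have z: "coord_tau z = z" "\<And>n j. ord_ge (fps_nth (snd z $ j) n) (max 2 (1 - u))"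
      using that by (auto simp: small_from_def invariants_def)
    have c: "fps_nth (snd z $ 1) n = 0 \<and> fps_nth (snd z $ 2) n = 0" for n
    proof (induction n rule: less_induct)
      case (less n)
      then have "previous (snd z $ 1) n = 0" "previous (snd z $ 2) n = 0" by (auto simp: previous_def)
      moreover have "coeff_system (fps_nth (snd z $ 1) n) (fps_nth (snd z $ 2) n)
          (previous (snd z $ 1) n ^ 4) (previous (snd z $ 2) n ^ 4)"
        using z(1) unfolding coord_tau_fixed_iff by blast
      ultimately have "coeff_system (fps_nth (snd z $ 1) n) (fps_nth (snd z $ 2) n) 0 0" by simp
      then show ?case using kernel_trivial_near_0 z(2) by blast
    qed
    then have y: "snd z = 0" by (simp add: vec_eq_iff forall_2 fps_eq_iff)
    have "\<forall>j. fst z $ j = (fps_X + fps_const \<theta>) * frob (snd z $ j)"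
      using z(1) unfolding coord_tau_fixed_iff by blast
    with y have "fst z = 0" by (simp add: vec_eq_iff)
    with y show "z = 0" by (simp add: prod_eq_iff)
  qed
  moreover have "0 \<in> small_from 0" by (simp add: small_from_def invariants_closed)
  ultimately show ?thesis by blast
qed

lemma scale_X_inject: "scale fps_X y = scale fps_X z \<Longrightarrow> y = z"
  by (simp add: scale_def prod_eq_iff vec_eq_iff)

text \<open>As tau fixes T, the factor T cancels from the invariance equation; a shift of the
  coefficients does not affect convergence.\<close>

lemma scale_X_invariant_iff: "scale fps_X z \<in> invariants \<longleftrightarrow> z \<in> invariants"
proof -
  have T: "fps_X * f \<in> Tate \<longleftrightarrow> f \<in> Tate" for f
  proof
    assume "fps_X * f \<in> Tate"
    then have "(\<lambda>i. ord (fps_nth (fps_X * f) (Suc i))) \<longlonglongrightarrow> \<infinity>"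
      unfolding Tate_iff by (rule LIMSEQ_Suc)
    then show "f \<in> Tate" by (simp add: Tate_iff)
  next
    assume "f \<in> Tate"
    then show "fps_X * f \<in> Tate" unfolding Tate_iff by (rule tate_shift_closed)
  qed
  have "coord_tau (scale fps_X z) = scale fps_X z \<longleftrightarrow> coord_tau z = z"
    unfolding coord_tau_scale frob_simps by (rule iffI, erule scale_X_inject, simp only:)
  moreover have "scale fps_X z \<in> Tz \<longleftrightarrow> z \<in> Tz" by (simp add: Tz_def scale_def T)
  ultimately show ?thesis by (simp add: invariants_def)
qed

lemma residue_eq_0:
  assumes z: "z \<in> invariants" and "residue z = 0"
  shows "\<exists>y\<in>invariants. z = scale fps_X y"
proof -
  define y :: "'a coords" where "y = (\<chi> j. fps_shift 1 (fst z $ j), \<chi> j. fps_shift 1 (snd z $ j))"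
  have s: "fps_nth (snd z $ j) 0 = 0" for j
    using assms(2) exhaust_2[of j] by (auto simp: residue_def zero_prod_def)
  \<comment> \<open>\<open>residue\<close> sees only the last two coordinates; invariance makes the
    constant terms of the others vanish as well.\<close>
  have "fst z $ j = (fps_X + fps_const \<theta>) * frob (snd z $ j)" for j
    using z unfolding invariants_def coord_tau_fixed_iff by blast
  with s have f: "fps_nth (fst z $ j) 0 = 0" for j by simp
  have X: "fps_X * fps_shift 1 g = g" if "fps_nth g 0 = 0" for g :: "'a fps"
    using that by (auto simp: fps_eq_iff)
  have "z = scale fps_X y" by (simp add: scale_def y_def prod_eq_iff vec_eq_iff X[unfolded One_nat_def] s f)
  with z show ?thesis using scale_X_invariant_iff by metis
qed

lemma filtered_invariants:
  "filtered_F2_T_module bit_act (scale fps_X) invariants residue small_from"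
proof
  fix y z :: "'a coords" and w :: "'a \<times> 'a" and a p d
  show "z + z = 0" by (rule add_self_z)
  show "w + w = 0" by (simp add: prod_eq_iff)
  show "bit_act 0 z = 0" by (simp add: bit_act_def scale_simps)
  have m: "map_poly of_bit (pCons a p) = pCons (of_bit a) (map_poly of_bit p :: 'a poly)"
    by (simp add: map_poly_pCons)
  show "bit_act (pCons a p) z = (if a = 0 then 0 else z) + scale fps_X (bit_act p z)"
    unfolding bit_act_def m by (cases a) (simp_all add: fps_of_poly_pCons scale_simps mult.commute)
  show "scale fps_X (y + z) = scale fps_X y + scale fps_X z" by (rule scale_simps)
  show "scale fps_X z = 0 \<Longrightarrow> z = 0" using scale_X_inject[of z 0] by (simp add: scale_simps)
  show "0 \<in> invariants" "\<lbrakk>y \<in> invariants; z \<in> invariants\<rbrakk> \<Longrightarrow> y + z \<in> invariants"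
    by (simp_all add: invariants_closed)
  show "z \<in> invariants \<Longrightarrow> scale fps_X z \<in> invariants" by (simp add: scale_X_invariant_iff)
  show "residue (y + z) = residue y + residue z" by (simp add: residue_def)
  show "residue (scale fps_X z) = 0" by (simp add: residue_def scale_def zero_prod_def)
  show "\<lbrakk>z \<in> invariants; residue z = 0\<rbrakk> \<Longrightarrow> \<exists>y\<in>invariants. z = scale fps_X y" by (rule residue_eq_0)
  show "finite (residue ` invariants)"
    unfolding residue_image using card_kernel by (intro card_ge_0_finite) simp
  show "small_from 0 = {0}" by (rule small_from_0)
  show "small_from d \<subseteq> invariants" "small_from d \<subseteq> small_from (Suc d)" by (auto simp: small_from_def)
  show "\<lbrakk>y \<in> small_from d; z \<in> small_from d\<rbrakk> \<Longrightarrow> y + z \<in> small_from d"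
    unfolding small_from_def using ord_ge_add invariants_closed(2) by simp
  show "y \<in> small_from d" if y: "y \<in> invariants" "scale fps_X y \<in> small_from (Suc d)"
  proof -
    have "ord_ge (fps_nth (snd y $ j) n) (max 2 (1 - u))" if "n \<ge> d" for n j
    proof -
      have "ord_ge (fps_nth (snd (scale fps_X y) $ j) (Suc n)) (max 2 (1 - u))"
        using y(2) that unfolding small_from_def by blast
      then show ?thesis by (simp add: scale_def)
    qed
    with y(1) show ?thesis by (simp add: small_from_def)
  qed
  show "\<exists>d. z \<in> small_from d" if z: "z \<in> invariants"
  proof -
    have "\<exists>N. \<forall>n\<ge>N. ord_ge (fps_nth (snd z $ j) n) (max 2 (1 - u))" for j
    proof -
      have "snd z $ j \<in> Tate" using z by (simp add: invariants_def Tz_def)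
      then show ?thesis unfolding Tate_iff tendsto_infinity_iff by blast
    qed
    then obtain N where N: "\<And>j n. n \<ge> N j \<Longrightarrow> ord_ge (fps_nth (snd z $ j) n) (max 2 (1 - u))"
      by metis
    have "z \<in> small_from (N 1 + N 2)"
      unfolding small_from_def
    proof (intro CollectI conjI z allI impI)
      fix n and j :: 2 assume "N 1 + N 2 \<le> n"
      then show "ord_ge (fps_nth (snd z $ j) n) (max 2 (1 - u))"
        using N[of j n] exhaust_2[of j] by auto
    qed
    then show ?thesis by blast
  qed
qed

text \<open>The 16 residues force 4 elements in every basis; for the uniqueness in
  \<open>free_rank\<close>, an arbitrary basis of \<open>H\<close> is pulled back to a set of
  invariants.\<close>

theorem h1_eq_4: "h1 ord motive = 4"
proof -
  interpret F: filtered_F2_T_module bit_act "scale fps_X" invariants residue small_from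
    by (rule filtered_invariants)
  have card_res: "card (residue ` invariants) = 16" unfolding residue_image by (rule card_kernel)
  have basis_iff: "module_basis (ring_of_type_algebra :: bit poly ring) H (cls ` B) \<longleftrightarrow> F.is_basis B"
    if "B \<subseteq> invariants" for B
    using module_basis_H1_iff[OF that] that by (simp add: F.is_basis_def)
  have card4: "card B = 4" if "F.is_basis B" for B
  proof -
    have "(2::nat) ^ card B = 2 ^ 4" using F.card_of_basis[OF that] card_res by simp
    then show ?thesis by (rule power_inject_exp[THEN iffD1, rotated]) simp
  qed
  have card_cls: "card (cls ` B) = card B" if "B \<subseteq> invariants" for B
    by (rule card_image[OF inj_on_subset[OF cls_inj that]])
  obtain B where B: "F.is_basis B" using F.basis_exists by blast
  have BI: "B \<subseteq> invariants" using B by (simp add: F.is_basis_def)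
  show ?thesis
    unfolding h1_def free_rank_def
  proof (rule the_equality)
    show "\<exists>C. module_basis (ring_of_type_algebra :: bit poly ring) H C \<and> card C = 4"
    proof (intro exI conjI)
      show "module_basis (ring_of_type_algebra :: bit poly ring) H (cls ` B)"
        unfolding basis_iff[OF BI] by (rule B)
      show "card (cls ` B) = 4" unfolding card_cls[OF BI] by (rule card4[OF B])
    qed
  next
    fix n assume "\<exists>C. module_basis (ring_of_type_algebra :: bit poly ring) H C \<and> card C = n"
    then obtain C where C: "module_basis (ring_of_type_algebra :: bit poly ring) H C" "card C = n" by blast
    then have "C \<subseteq> cls ` invariants" unfolding module_basis_def H1_ops(1) by blast
    then obtain D where D: "D \<subseteq> invariants" "C = cls ` D" by (meson subset_imageE)
    have "F.is_basis D" using C(1) unfolding D(2) basis_iff[OF D(1)] .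
    from card4[OF this] show "n = 4" using C(2) unfolding D(2) card_cls[OF D(1)] by simp
  qed
qed

end

theorem proposition7p1:
  fixes ord :: "'a::field \<Rightarrow> ereal" and \<theta> a11 a12 a21 :: 'a and u v :: real
  assumes "C_infinity ord \<theta>"
    and "ord a11 = -1"
    and "a12 \<noteq> 0" and "a21 \<noteq> 0"
    and "ord a12 = ereal u" and "ord a21 = ereal v"
    and "(u, v) \<in> D13" and "v \<ge> 0"
  shows "h1 ord (t_motive \<theta> (vector [vector [a11, a12], vector [a21, 0]])) = 4"
proof -
  interpret C_infinity ord \<theta> by fact
  interpret D13_parameters ord \<theta> a11 a12 a21 u v by unfold_locales fact+
  show ?thesis by (rule h1_eq_4)
qed

end
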